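(* Let $\alpha\in\mathbb{R}$. Then a function $u$ in $\mathbb{D}$ has the form of a Poisson integral $u=P_\alpha[f]$ in $\mathbb{D}$ for some $f\in\mathcal{D}'(\mathbb{T})$ if and only if $u$ is $\alpha$-harmonic in $\mathbb{D}$, $u$ has temperate growth in $\mathbb{D}$, and $\operatorname{Spec}(u)\subset\operatorname{Spec}(P_\alpha)$.
   Context: $\mathbb{D}$ is the open unit disc in $\mathbb{C}$, $\mathbb{T}=\partial\mathbb{D}$. Functions are complex-valued; $\partial_z=\frac12(\partial_x-i\partial_y)$, $\bar\partial_z=\frac12(\partial_x+i\partial_y)$. For $\alpha\in\mathbb{R}$, $u\in C^2(\mathbb{D})$ is $\alpha$-harmonic in $\mathbb{D}$ if $\partial_z\big((1-|z|^2)^{-\alpha}\bar\partial_z u(z)\big)=0$ in $\mathbb{D}$. A function $u$ has temperate growth in $\mathbb{D}$ if $|u(z)|\leq C(1-|z|^2)^{-N}$, $z\in\mathbb{D}$, for some positive constants $C,N$. Known fact used as a definition: every $\alpha$-harmonic $u$ in $\mathbb{D}$ has a unique expansion $$u(z)=\sum_{k=0}^\infty c_kz^k+\sum_{k=1}^\infty c_{-k}F(-\alpha,k;k+1;|z|^2)\bar z^k,\quad z\in\mathbb{D},$$ with $\limsup_{|k|\to\infty}|c_k|^{1/|k|}\leq1$ (and conversely every such series is $\alpha$-harmonic), where $F(a,b;c;z)=\sum_{k\geq0}\frac{(a)_k(b)_k}{(c)_k}\frac{z^k}{k!}$ is the hypergeometric function, $(a)_0=1$, $(a)_k=\prod_{j=0}^{k-1}(a+j)$.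 One has $c_k=\partial^ku(0)/k!$ and $c_{-k}=\bar\partial^ku(0)/k!$ for $k\geq0$. The spectrum of $u$ is $\operatorname{Spec}(u)=\{k\in\mathbb{Z}:c_k\neq0\}$. The $\alpha$-harmonic Poisson kernel is $P_\alpha(z)=\dfrac{(1-|z|^2)^{\alpha+1}}{(1-z)(1-\bar z)^{\alpha+1}}$, $z\in\mathbb{D}$ (principal branch of the power); it is $\alpha$-harmonic in $\mathbb{D}$ (so $\operatorname{Spec}(P_\alpha)$ is defined). $\mathcal{D}'(\mathbb{T})$ is the space of distributions on $\mathbb{T}$, with $f\in L^1(\mathbb{T})$ identified with $\langle f,\psi\rangle=\frac1{2\pi}\int_{\mathbb{T}}f(e^{i\theta})\psi(e^{i\theta})\,d\theta$, $\psi\in C^\infty(\mathbb{T})$. Fourier coefficients: $\hat f(k)=\langle f,\phi_{-k}\rangle$, $\phi_k(e^{i\theta})=e^{ik\theta}$. The convolution $f*g$ is the distribution with $(f*g)\hat{\ }(k)=\hat f(k)\hat g(k)$, $k\in\mathbb{Z}$; it is a $C^\infty$ function if $g\in C^\infty(\mathbb{T})$. For a function $v$ in $\mathbb{D}$ and $0\leq r<1$, $v_r(e^{i\theta})=v(re^{i\theta})$. The Poisson integral of $f\in\mathcal{D}'(\mathbb{T})$ is $P_\alpha[f](re^{i\theta})=(P_{\alpha,r}*f)(e^{i\theta})$, where $P_{\alpha,r}(e^{i\theta})=P_\alpha(re^{i\theta})$, $0\leq r<1$. *)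

theory Defs
  imports "HOL-Analysis.Analysis"
begin

section \<open>\<open>\<alpha>\<close>-harmonic functions in the unit disc\<close>

text \<open>
  A function in the unit disc is a total function \<^typ>\<open>complex \<Rightarrow> complex\<close> of which only the
  values on \<^term>\<open>ball 0 1 :: complex set\<close> matter.  The partial derivatives in \<open>x\<close> and \<open>y\<close> are
  the directional derivatives along \<open>1\<close> and \<open>\<i>\<close>.
\<close>

definition has_partial_at :: "complex \<Rightarrow> (complex \<Rightarrow> complex) \<Rightarrow> complex \<Rightarrow> bool" where
  "has_partial_at e u z \<longleftrightarrow> (\<lambda>t::real. u (z + t *\<^sub>R e)) differentiable (at 0)"

definition partial_deriv :: "complex \<Rightarrow> (complex \<Rightarrow> complex) \<Rightarrow> complex \<Rightarrow> complex" where
  "partial_deriv e u z = vector_derivative (\<lambda>t::real. u (z + t *\<^sub>R e)) (at 0)"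

primrec Ck_on :: "nat \<Rightarrow> complex set \<Rightarrow> (complex \<Rightarrow> complex) \<Rightarrow> bool" where
  "Ck_on 0 S u \<longleftrightarrow> continuous_on S u"
| "Ck_on (Suc n) S u \<longleftrightarrow> continuous_on S u \<and>
     (\<forall>e\<in>{1, \<i>}. (\<forall>z\<in>S. has_partial_at e u z) \<and> Ck_on n S (partial_deriv e u))"

definition d_z :: "(complex \<Rightarrow> complex) \<Rightarrow> complex \<Rightarrow> complex" where
  "d_z u z = (partial_deriv 1 u z - \<i> * partial_deriv \<i> u z) / 2"

definition dbar_z :: "(complex \<Rightarrow> complex) \<Rightarrow> complex \<Rightarrow> complex" where
  "dbar_z u z = (partial_deriv 1 u z + \<i> * partial_deriv \<i> u z) / 2"

definition alpha_harmonic :: "real \<Rightarrow> (complex \<Rightarrow> complex) \<Rightarrow> bool" where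
  "alpha_harmonic \<alpha> u \<longleftrightarrow> Ck_on 2 (ball 0 1) u \<and>
     (\<forall>z\<in>ball 0 1.
        d_z (\<lambda>w. complex_of_real ((1 - (cmod w)\<^sup>2) powr (-\<alpha>)) * dbar_z u w) z = 0)"

definition temperate_growth :: "(complex \<Rightarrow> complex) \<Rightarrow> bool" where
  "temperate_growth u \<longleftrightarrow>
     (\<exists>C>0. \<exists>N>0. \<forall>z\<in>ball 0 1. cmod (u z) \<le> C * (1 - (cmod z)\<^sup>2) powr (-N))"

definition hyp2F1 :: "real \<Rightarrow> real \<Rightarrow> real \<Rightarrow> real \<Rightarrow> real" where
  "hyp2F1 a b c x = eval_fps (fps_hypergeo [a, b] [c] 1) x"

text \<open>
  The filter \<^term>\<open>cofinite :: int filter\<close> expresses \<open>\<bar>k\<bar> \<rightarrow> \<infinity>\<close>.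
\<close>

definition has_alpha_expansion :: "real \<Rightarrow> (complex \<Rightarrow> complex) \<Rightarrow> (int \<Rightarrow> complex) \<Rightarrow> bool" where
  "has_alpha_expansion \<alpha> u c \<longleftrightarrow>
     Limsup cofinite (\<lambda>k. ereal (root (nat \<bar>k\<bar>) (cmod (c k)))) \<le> 1 \<and>
     (\<forall>z\<in>ball 0 1. \<exists>a b.
        (\<lambda>k. c (int k) * z ^ k) sums a \<and>
        (\<lambda>k. c (- int (Suc k))
              * complex_of_real (hyp2F1 (-\<alpha>) (real (Suc k)) (real (Suc k) + 1) ((cmod z)\<^sup>2))
              * cnj z ^ Suc k) sums b \<and>
        u z = a + b)"

text \<open>
  Every \<open>\<alpha>\<close>-harmonic function has exactly one such expansion; for other \<open>u\<close> the value of
  \<open>alpha_coeff\<close> carries no meaning.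
\<close>

definition alpha_coeff :: "real \<Rightarrow> (complex \<Rightarrow> complex) \<Rightarrow> int \<Rightarrow> complex" where
  "alpha_coeff \<alpha> u = (THE c. has_alpha_expansion \<alpha> u c)"

definition Spec :: "real \<Rightarrow> (complex \<Rightarrow> complex) \<Rightarrow> int set" where
  "Spec \<alpha> u = {k. alpha_coeff \<alpha> u k \<noteq> 0}"

definition poisson_kernel :: "real \<Rightarrow> complex \<Rightarrow> complex" where
  "poisson_kernel \<alpha> z = complex_of_real ((1 - (cmod z)\<^sup>2) powr (\<alpha> + 1)) /
     ((1 - z) * (1 - cnj z) powr complex_of_real (\<alpha> + 1))"


section \<open>Distributions on the unit circle\<close>

text \<open>
  A function on the circle is also represented by a total function \<^typ>\<open>complex \<Rightarrow> complex\<close>, of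
  which only the values \<open>\<psi> (cis t)\<close> matter.  Derivatives are taken in the angle \<open>t\<close>.
\<close>

definition circle_deriv :: "nat \<Rightarrow> (complex \<Rightarrow> complex) \<Rightarrow> real \<Rightarrow> complex" where
  "circle_deriv n \<psi> = ((\<lambda>g t. vector_derivative g (at t)) ^^ n) (\<lambda>t. \<psi> (cis t))"

definition C_infinity_circle :: "(complex \<Rightarrow> complex) set" where
  "C_infinity_circle = {\<psi>. \<forall>n t. circle_deriv n \<psi> differentiable (at t)}"

text \<open>
  Distributions are the linear functionals on the smooth functions that are continuous with
  respect to the seminorms \<open>\<psi> \<mapsto> sup \<bar>\<psi>\<^sup>(\<^sup>j\<^sup>)\<bar>\<close>.  The estimate forces \<open>f \<psi> = f \<eta>\<close> whenever \<open>\<psi>\<close>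
  and \<open>\<eta>\<close> agree on the circle, so \<open>f\<close> does not see the values of test functions off the circle.
  Extensionality makes equality of functionals the equality of distributions.
\<close>

definition circle_distributions :: "((complex \<Rightarrow> complex) \<Rightarrow> complex) set" where
  "circle_distributions = {f \<in> extensional C_infinity_circle.
     (\<forall>\<psi>\<in>C_infinity_circle. \<forall>\<eta>\<in>C_infinity_circle. f (\<lambda>z. \<psi> z + \<eta> z) = f \<psi> + f \<eta>) \<and>
     (\<forall>a. \<forall>\<psi>\<in>C_infinity_circle. f (\<lambda>z. a * \<psi> z) = a * f \<psi>) \<and>
     (\<exists>C N. \<forall>\<psi>\<in>C_infinity_circle.
        cmod (f \<psi>) \<le> C * (\<Sum>j\<le>N. SUP t. cmod (circle_deriv j \<psi> t)))}"

definition distribution_of :: "(complex \<Rightarrow> complex) \<Rightarrow> (complex \<Rightarrow> complex) \<Rightarrow> complex" where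
  "distribution_of h = (\<lambda>\<psi>\<in>C_infinity_circle.
     complex_of_real (1 / (2 * pi)) * (LBINT t:{0..2*pi}. h (cis t) * \<psi> (cis t)))"

definition circle_char :: "int \<Rightarrow> complex \<Rightarrow> complex" where
  "circle_char k z = z powi k"

definition fourier_coeff :: "((complex \<Rightarrow> complex) \<Rightarrow> complex) \<Rightarrow> int \<Rightarrow> complex" where
  "fourier_coeff f k = f (circle_char (-k))"

definition circle_conv ::
  "((complex \<Rightarrow> complex) \<Rightarrow> complex) \<Rightarrow> ((complex \<Rightarrow> complex) \<Rightarrow> complex) \<Rightarrow> (complex \<Rightarrow> complex) \<Rightarrow> complex"
  where
  "circle_conv f g = (THE h. h \<in> circle_distributions \<and>
     (\<forall>k. fourier_coeff h k = fourier_coeff f k * fourier_coeff g k))"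

text \<open>
  The value at a point \<open>\<zeta>\<close> of the circle of a distribution that is given by a smooth function.
\<close>

definition smooth_value :: "((complex \<Rightarrow> complex) \<Rightarrow> complex) \<Rightarrow> complex \<Rightarrow> complex" where
  "smooth_value f \<zeta> = (THE w. \<exists>h\<in>C_infinity_circle. distribution_of h = f \<and> h \<zeta> = w)"

text \<open>
  In polar coordinates \<open>z = r e\<^sup>i\<^sup>\<theta>\<close> we take \<open>r = \<bar>z\<bar>\<close> and \<open>\<theta> = Arg z\<close>; at \<open>z = 0\<close> the convolution
  is constant on the circle, so that the choice \<open>Arg 0 = 0\<close> is harmless.
\<close>

definition poisson_integral ::
  "real \<Rightarrow> ((complex \<Rightarrow> complex) \<Rightarrow> complex) \<Rightarrow> complex \<Rightarrow> complex" where
  "poisson_integral \<alpha> f z = smooth_value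
     (circle_conv (distribution_of (\<lambda>\<zeta>. poisson_kernel \<alpha> (complex_of_real (cmod z) * \<zeta>))) f)
     (cis (Arg z))"

end

theory Submission
  imports Defs "HOL-Complex_Analysis.Complex_Analysis"
begin

text \<open>
  A \<open>C\<^sup>2\<close> function \<open>u\<close> is \<open>\<alpha>\<close>-harmonic iff its \<open>dbar\<close>-derivative is \<open>(1 - |z|\<^sup>2)\<^sup>\<alpha> G (cnj z)\<close> with
  \<open>G\<close> holomorphic.  This equation is solved by the integral over \<open>s \<in> [0, 1]\<close> of
  \<open>cnj z (1 - s |z|\<^sup>2)\<^sup>\<alpha> G (s cnj z)\<close>, because the \<open>dbar\<close>-derivative of the integrand is the
  derivative of \<open>s (1 - s |z|\<^sup>2)\<^sup>\<alpha> G (s cnj z)\<close> in \<open>s\<close>.  Integrating the power series of \<open>G\<close>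
  termwise produces the hypergeometric factors, so \<open>\<alpha>\<close>-harmonicity is equivalent to the series
  expansion.  The kernel corresponds to \<open>G w = (\<alpha> + 1) (1 - w)\<^sup>-\<^sup>\<alpha>\<^sup>-\<^sup>2\<close>, so its coefficients are \<open>1\<close> for
  \<open>k \<ge> 0\<close> and \<open>(\<alpha> + 1)\<^sub>j / j!\<close> at \<open>k = -j\<close>; both they and the inverses of the nonzero ones grow
  polynomially.  On the circle of radius \<open>r\<close> the expansion is a Fourier series, so temperate growth of
  \<open>u\<close> means polynomial growth of its coefficients, as for Fourier coefficients of distributions.
  Poisson integration multiplies Fourier coefficients by those of the kernel, and the condition on the
  spectrum is what makes division by them possible.
\<close>

section \<open>Smoothness of integrals with a parameter\<close>

text \<open>The derivative in \<open>s\<close> arises because, with \<open>z\<close> and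
  \<open>cnj z\<close> treated as independent, everything behind the factor \<open>cnj z\<close> of
  the integrand is a function of \<open>s * cnj z\<close>: there \<open>cnj z\<close> times the
  \<open>dbar\<close>-derivative equals \<open>s\<close> times the \<open>s\<close>-derivative. The
  integral also controls the hypergeometric factors. The weight \<open>(k + 1) s^k\<close> has mass
  1 on the unit interval, so each factor is an average of the values
  \<open>(1 - s |z|^2)^\<alpha>\<close> and lies between powers of \<open>1 - |z|^2\<close> with
  exponents \<open>|\<alpha>|\<close> and \<open>-|\<alpha>|\<close>, whatever \<open>k\<close> and
  the sign of \<alpha> are. This uniformity in \<open>k\<close> is what carries growth bounds from
  \<open>u\<close> to its coefficients and back. Coefficients of expansions, convolutions and values
  of smooth distributions are definite descriptions. Hence the three uniqueness results: an
  expansion is determined by its function, a distribution by its Fourier coefficients, and a smooth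
  function on the circle by its distribution.\<close>

definition has_partial :: "complex \<Rightarrow> (complex \<Rightarrow> complex) \<Rightarrow> complex \<Rightarrow> complex \<Rightarrow> bool" where
  "has_partial e f D z \<longleftrightarrow> ((\<lambda>t::real. f (z + t *\<^sub>R e)) has_vector_derivative D) (at 0)"

lemma has_partial_imp:
  assumes "has_partial e f D z"
  shows "has_partial_at e f z" "partial_deriv e f z = D"
  using assms unfolding has_partial_def has_partial_at_def partial_deriv_def
  by (auto intro: differentiableI_vector vector_derivative_at)

lemma has_partial_partial_deriv:
  "has_partial_at e f z \<Longrightarrow> has_partial e f (partial_deriv e f z) z"
  unfolding has_partial_def has_partial_at_def partial_deriv_def
  by (simp add: vector_derivative_works)

lemma has_partial_transform_open:
  assumes "has_partial e f D z" "open S" "z \<in> S" "\<And>w. w \<in> S \<Longrightarrow> f w = g w"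
  shows "has_partial e g D z"
proof -
  have "open ((\<lambda>t::real. z + t *\<^sub>R e) -` S)"
    by (rule continuous_open_vimage[OF assms(2)]) (auto intro!: continuous_intros)
  then show ?thesis
    using assms unfolding has_partial_def
    by (auto intro: has_vector_derivative_transform_within_open
        [of "\<lambda>t. f (z + t *\<^sub>R e)" D 0 "(\<lambda>t::real. z + t *\<^sub>R e) -` S"])
qed

lemma has_partial_has_derivative:
  assumes "(f has_derivative f') (at z)"
  shows "has_partial e f (f' e) z"
proof -
  have g: "((\<lambda>t::real. z + t *\<^sub>R e) has_derivative (\<lambda>t. t *\<^sub>R e)) (at 0)"
    by (auto intro!: derivative_eq_intros)
  have "(f has_derivative f') (at (z + 0 *\<^sub>R e))" using assms by simp
  from diff_chain_at[OF g this] have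
    "((\<lambda>t. f (z + t *\<^sub>R e)) has_derivative (\<lambda>t. f' (t *\<^sub>R e))) (at 0)" by (simp add: o_def)
  moreover have "linear f'" using assms has_derivative_linear by blast
  ultimately show ?thesis
    unfolding has_partial_def has_vector_derivative_def by (simp add: linear_scale)
qed

lemma has_partial_add:
  "has_partial e f D z \<Longrightarrow> has_partial e g E z \<Longrightarrow> has_partial e (\<lambda>w. f w + g w) (D + E) z"
  unfolding has_partial_def by (rule has_vector_derivative_add)

lemma has_partial_diff:
  "has_partial e f D z \<Longrightarrow> has_partial e g E z \<Longrightarrow> has_partial e (\<lambda>w. f w - g w) (D - E) z"
  unfolding has_partial_def by (rule has_vector_derivative_diff)

lemma has_partial_mult:
  "has_partial e f D z \<Longrightarrow> has_partial e g E z \<Longrightarrow>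
    has_partial e (\<lambda>w. f w * g w) (f z * E + D * g z) z"
  unfolding has_partial_def
  by (drule (1) has_vector_derivative_mult) simp

section \<open>Families of functions with jointly continuous partial derivatives\<close>

text \<open>Only \<open>z\<close> is differentiated; \<open>s\<close> is a parameter, and joint
  continuity is what the Leibniz rule asks for. A derivative enters as some family with the right
  values on the disc, so that an explicit formula can serve whatever its values elsewhere.\<close>

primrec joint_Ck :: "nat \<Rightarrow> (real \<Rightarrow> complex \<Rightarrow> complex) \<Rightarrow> bool" where
  "joint_Ck 0 \<Phi> \<longleftrightarrow> continuous_on ({0..1} \<times> ball 0 1) (\<lambda>(s, z). \<Phi> s z)"
| "joint_Ck (Suc n) \<Phi> \<longleftrightarrow> continuous_on ({0..1} \<times> ball 0 1) (\<lambda>(s, z). \<Phi> s z) \<and>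
     (\<forall>e\<in>{1, \<i>}. \<exists>\<Psi>. joint_Ck n \<Psi> \<and>
        (\<forall>s\<in>{0..1}. \<forall>z\<in>ball 0 1. has_partial e (\<Phi> s) (\<Psi> s z) z))"

lemma joint_Ck_continuous:
  "joint_Ck n \<Phi> \<Longrightarrow> continuous_on ({0..1} \<times> ball 0 1) (\<lambda>(s, z). \<Phi> s z)"
  by (cases n) auto

lemma joint_Ck_SucI:
  assumes "continuous_on ({0..1} \<times> ball 0 1) (\<lambda>(s, z). \<Phi> s z)"
    and "\<And>e. e \<in> {1, \<i>} \<Longrightarrow> joint_Ck n (\<Psi> e)"
    and "\<And>e s z. e \<in> {1, \<i>} \<Longrightarrow> s \<in> {0..1} \<Longrightarrow> z \<in> ball 0 1 \<Longrightarrow> has_partial e (\<Phi> s) (\<Psi> e s z) z"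
  shows "joint_Ck (Suc n) \<Phi>"
  unfolding joint_Ck.simps
proof (intro conjI ballI)
  fix e :: complex assume e: "e \<in> {1, \<i>}"
  show "\<exists>\<Psi>. joint_Ck n \<Psi> \<and> (\<forall>s\<in>{0..1}. \<forall>z\<in>ball 0 1. has_partial e (\<Phi> s) (\<Psi> s z) z)"
    using assms(2,3)[OF e] by (intro exI[of _ "\<Psi> e"] conjI ballI)
qed (fact assms(1))

lemma joint_Ck_SucE:
  assumes "joint_Ck (Suc n) \<Phi>"
  obtains \<Psi> where "\<forall>e\<in>{1, \<i>}. joint_Ck n (\<Psi> e)"
    "\<forall>e\<in>{1, \<i>}. \<forall>s\<in>{0..1}. \<forall>z\<in>ball 0 1. has_partial e (\<Phi> s) (\<Psi> e s z) z"
proof -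
  have "\<forall>e\<in>{1, \<i>}. \<exists>\<Psi>. joint_Ck n \<Psi> \<and>
        (\<forall>s\<in>{0..1}. \<forall>z\<in>ball 0 1. has_partial e (\<Phi> s) (\<Psi> s z) z)"
    using assms by simp
  from bchoice[OF this] obtain \<Psi> where "\<forall>e\<in>{1, \<i>}. joint_Ck n (\<Psi> e) \<and>
        (\<forall>s\<in>{0..1}. \<forall>z\<in>ball 0 1. has_partial e (\<Phi> s) (\<Psi> e s z) z)" ..
  then show ?thesis by (intro that[of \<Psi>]) blast+
qed

text \<open>The product rule multiplies a derivative by an undifferentiated factor, which must be
  brought down to the order of the derivative.\<close>

lemma joint_Ck_lower: "joint_Ck (Suc n) \<Phi> \<Longrightarrow> joint_Ck n \<Phi>"
proof (induction n arbitrary: \<Phi>)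
  case (Suc n)
  from Suc.prems obtain \<Psi> where A[rule_format]: "\<forall>e\<in>{1, \<i>}. joint_Ck (Suc n) (\<Psi> e)"
    and B[rule_format]: "\<forall>e\<in>{1, \<i>}. \<forall>s\<in>{0..1}. \<forall>z\<in>ball 0 1. has_partial e (\<Phi> s) (\<Psi> e s z) z"
    by (rule joint_Ck_SucE)
  show ?case
    by (rule joint_Ck_SucI[OF joint_Ck_continuous[OF Suc.prems] Suc.IH[OF A] B])
qed simp

lemma joint_Ck_const: "joint_Ck n (\<lambda>s z. c)"
proof (induction n arbitrary: c)
  case (Suc n)
  show ?case
    by (rule joint_Ck_SucI[of _ _ "\<lambda>e s z. 0"])
      (use Suc[of 0] in \<open>auto simp: has_partial_def split_beta intro!: continuous_intros\<close>)
qed (auto simp: split_beta intro!: continuous_intros)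

lemma joint_Ck_add: "joint_Ck n \<Phi> \<Longrightarrow> joint_Ck n \<Psi> \<Longrightarrow> joint_Ck n (\<lambda>s z. \<Phi> s z + \<Psi> s z)"
proof (induction n arbitrary: \<Phi> \<Psi>)
  case 0
  then show ?case by (auto simp: split_beta intro!: continuous_intros)
next
  case (Suc n)
  obtain A where A[rule_format]: "\<forall>e\<in>{1, \<i>}. joint_Ck n (A e)"
    "\<forall>e\<in>{1, \<i>}. \<forall>s\<in>{0..1}. \<forall>z\<in>ball 0 1. has_partial e (\<Phi> s) (A e s z) z"
    using Suc.prems(1) by (rule joint_Ck_SucE)
  obtain B where B[rule_format]: "\<forall>e\<in>{1, \<i>}. joint_Ck n (B e)"
    "\<forall>e\<in>{1, \<i>}. \<forall>s\<in>{0..1}. \<forall>z\<in>ball 0 1. has_partial e (\<Psi> s) (B e s z) z"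
    using Suc.prems(2) by (rule joint_Ck_SucE)
  have "continuous_on ({0..1} \<times> ball 0 1) (\<lambda>(s, z). \<Phi> s z + \<Psi> s z)"
    using Suc.prems[THEN joint_Ck_continuous] by (auto simp: split_beta intro!: continuous_intros)
  then show ?case
    by (rule joint_Ck_SucI[of _ _ "\<lambda>e s z. A e s z + B e s z"]) (intro Suc.IH has_partial_add A B; assumption)+
qed

lemma joint_Ck_mult: "joint_Ck n \<Phi> \<Longrightarrow> joint_Ck n \<Psi> \<Longrightarrow> joint_Ck n (\<lambda>s z. \<Phi> s z * \<Psi> s z)"
proof (induction n arbitrary: \<Phi> \<Psi>)
  case 0
  then show ?case by (auto simp: split_beta intro!: continuous_intros)
next
  case (Suc n)
  obtain A where A[rule_format]: "\<forall>e\<in>{1, \<i>}. joint_Ck n (A e)"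
    "\<forall>e\<in>{1, \<i>}. \<forall>s\<in>{0..1}. \<forall>z\<in>ball 0 1. has_partial e (\<Phi> s) (A e s z) z"
    using Suc.prems(1) by (rule joint_Ck_SucE)
  obtain B where B[rule_format]: "\<forall>e\<in>{1, \<i>}. joint_Ck n (B e)"
    "\<forall>e\<in>{1, \<i>}. \<forall>s\<in>{0..1}. \<forall>z\<in>ball 0 1. has_partial e (\<Psi> s) (B e s z) z"
    using Suc.prems(2) by (rule joint_Ck_SucE)
  have "continuous_on ({0..1} \<times> ball 0 1) (\<lambda>(s, z). \<Phi> s z * \<Psi> s z)"
    using Suc.prems[THEN joint_Ck_continuous] by (auto simp: split_beta intro!: continuous_intros)
  then show ?case
    by (rule joint_Ck_SucI[of _ _ "\<lambda>e s z. \<Phi> s z * B e s z + A e s z * \<Psi> s z"])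
      (intro joint_Ck_add Suc.IH joint_Ck_lower[OF Suc.prems(1)] joint_Ck_lower[OF Suc.prems(2)]
         has_partial_mult A B; assumption)+
qed

lemma has_partial_holomorphic:
  assumes "f holomorphic_on ball 0 1" "z \<in> ball 0 1"
  shows "has_partial e f (e * deriv f z) z"
  using has_partial_has_derivative[OF has_field_derivative_imp_has_derivative[OF
    holomorphic_derivI[OF assms(1) open_ball assms(2)]]] by (simp add: mult.commute)

lemma joint_Ck_holomorphic:
  assumes "f holomorphic_on ball 0 1"
  shows "joint_Ck n (\<lambda>s z. f z)"
  using assms
proof (induction n arbitrary: f)
  case 0
  have "continuous_on ({0..1::real} \<times> ball (0::complex) 1) snd" by (intro continuous_intros)
  from continuous_on_compose2[OF holomorphic_on_imp_continuous_on[OF 0] this]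
  show ?case by (simp add: split_beta image_subset_iff)
next
  case (Suc n)
  have "joint_Ck n (\<lambda>s z. e * deriv f z)" for e
    using Suc by (intro joint_Ck_mult joint_Ck_const Suc.IH holomorphic_deriv) auto
  then show ?case
    by (rule joint_Ck_SucI[OF joint_Ck_continuous[OF Suc.IH[OF Suc.prems]] _ has_partial_holomorphic[OF Suc.prems]])
qed

lemma scaled_cnj_in_ball: "s \<in> {0..1} \<Longrightarrow> z \<in> ball 0 1 \<Longrightarrow> of_real s * cnj z \<in> ball (0::complex) 1"
  using mult_left_le_one_le[of "cmod z" s] by (auto simp: norm_mult)

lemma joint_Ck_scale: "joint_Ck n (\<lambda>s z. of_real s)"
proof (cases n)
  case (Suc m)
  have "has_partial e (\<lambda>z. of_real s) 0 z" for e z s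
    unfolding has_partial_def by simp
  moreover have "continuous_on ({0..1} \<times> ball 0 1) (\<lambda>(s, z::complex). complex_of_real s)"
    by (simp add: split_beta) (intro continuous_intros)
  ultimately show ?thesis unfolding Suc
    by (intro joint_Ck_SucI[of _ _ "\<lambda>e s z. 0"] joint_Ck_const)
qed (auto simp: split_beta intro!: continuous_intros)

lemma has_partial_cnj_comp:
  assumes "f holomorphic_on ball 0 1" "z \<in> ball 0 1" "s \<in> {0..1}"
  shows "has_partial e (\<lambda>z. f (of_real s * cnj z)) (cnj e * of_real s * deriv f (of_real s * cnj z)) z"
proof -
  have 1: "((\<lambda>z. of_real s * cnj z) has_derivative (\<lambda>h. of_real s * cnj h)) (at z)"
    by (auto intro!: derivative_eq_intros)
  have 2: "(f has_field_derivative deriv f (of_real s * cnj z)) (at (of_real s * cnj z))"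
    using assms scaled_cnj_in_ball[OF assms(3,2)] by (intro holomorphic_derivI) auto
  from has_partial_has_derivative[OF diff_chain_at[OF 1 2[unfolded has_field_derivative_def]], of e]
  show ?thesis by (simp add: mult_ac o_def)
qed

lemma joint_Ck_antiholomorphic:
  assumes "f holomorphic_on ball 0 1"
  shows "joint_Ck n (\<lambda>s z. f (of_real s * cnj z))"
  using assms
proof (induction n arbitrary: f)
  case 0
  have "continuous_on ({0..1} \<times> ball 0 1) (\<lambda>x. complex_of_real (fst x) * cnj (snd x))"
    by (intro continuous_intros)
  from continuous_on_compose2[OF holomorphic_on_imp_continuous_on[OF 0] this]
  show ?case using scaled_cnj_in_ball by (simp add: split_beta image_subset_iff)
next
  case (Suc n)
  have "joint_Ck n (\<lambda>s z. cnj e * of_real s * deriv f (of_real s * cnj z))" for e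
    using Suc by (intro joint_Ck_mult joint_Ck_const joint_Ck_scale Suc.IH holomorphic_deriv) auto
  then show ?case
    by (rule joint_Ck_SucI[OF joint_Ck_continuous[OF Suc.IH[OF Suc.prems]] _ has_partial_cnj_comp[OF Suc.prems]])
qed

lemma scaled_norm_less_1: "s \<in> {0..1} \<Longrightarrow> z \<in> ball 0 1 \<Longrightarrow> s * (cmod z)\<^sup>2 < 1"
  using mult_left_le_one_le[of "(cmod z)\<^sup>2" s] by (auto simp: abs_square_less_1 intro: le_less_trans)

text \<open>The derivative of \<open>|z|^2\<close> along \<open>e\<close> is twice the real inner
  product of \<open>z\<close> and \<open>e\<close>. Written as \<open>z * cnj e + e * cnj z\<close>,
  it makes the whole derivative a product of elementary smooth families and a power of the same kind
  with exponent lowered by one.\<close>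

lemma has_partial_norm_powr:
  assumes "s \<in> {0..1}" "z \<in> ball 0 1"
  shows "has_partial e (\<lambda>z. of_real ((1 - s * (cmod z)\<^sup>2) powr \<beta>))
    (of_real \<beta> * of_real ((1 - s * (cmod z)\<^sup>2) powr (\<beta> - 1)) * (- of_real s * (z * cnj e + e * cnj z))) z"
proof -
  have n2: "(cmod w)\<^sup>2 = w \<bullet> w" for w by (simp add: dot_square_norm)
  have "((\<lambda>z. complex_of_real ((1 - s * (cmod z)\<^sup>2) powr \<beta>)) has_derivative
     (\<lambda>h. of_real (\<beta> * (1 - s * (cmod z)\<^sup>2) powr (\<beta> - 1) * (- s * (2 * (z \<bullet> h)))))) (at z)"
    unfolding n2 using scaled_norm_less_1[OF assms, unfolded n2]
    by (auto intro!: derivative_eq_intros) (auto simp: powr_diff inner_commute field_simps)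
  moreover have "complex_of_real (2 * (z \<bullet> e)) = z * cnj e + e * cnj z"
    by (simp add: complex_eq_iff inner_complex_def algebra_simps)
  ultimately show ?thesis
    using has_partial_has_derivative[of "\<lambda>z. complex_of_real ((1 - s * (cmod z)\<^sup>2) powr \<beta>)" _ z e]
    by fastforce
qed

lemma has_partial_cnj: "has_partial e cnj (cnj e) z"
  using has_partial_has_derivative[of cnj cnj] by (auto intro!: derivative_eq_intros)

lemma joint_Ck_cnj: "joint_Ck n (\<lambda>s. cnj)"
proof (cases n)
  case (Suc m)
  show ?thesis unfolding Suc
    by (intro joint_Ck_SucI[of _ _ "\<lambda>e s z. cnj e"] joint_Ck_const has_partial_cnj)
      (auto simp: split_beta intro!: continuous_intros)
qed (auto simp: split_beta intro!: continuous_intros)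

lemma joint_Ck_norm_powr: "joint_Ck n (\<lambda>s z. of_real ((1 - s * (cmod z)\<^sup>2) powr \<beta>))"
proof -
  have c: "continuous_on ({0..1} \<times> ball 0 1)
      (\<lambda>(s, z). complex_of_real ((1 - s * (cmod z)\<^sup>2) powr \<beta>))" for \<beta>
    using scaled_norm_less_1 by (fastforce simp: split_beta intro!: continuous_intros)
  show ?thesis
  proof (induction n arbitrary: \<beta>)
    case (Suc n)
    have m: "joint_Ck n (\<lambda>s z. - complex_of_real s)"
      using joint_Ck_mult[OF joint_Ck_const[of n "-1"] joint_Ck_scale] by simp
    show ?case
      by (rule joint_Ck_SucI[OF c _ has_partial_norm_powr])
        (intro joint_Ck_mult joint_Ck_add joint_Ck_const joint_Ck_cnj joint_Ck_scale Suc m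
          joint_Ck_holomorphic holomorphic_intros; assumption)+
  qed (use c in simp)
qed

section \<open>Differentiation under the integral sign\<close>

text \<open>A partial derivative is a derivative at parameter 0, whereas the Leibniz rule needs it
  at every parameter of a segment; a shift of the origin supplies it.\<close>

lemma has_partial_along_line:
  assumes "has_partial e f D (z + x *\<^sub>R e)"
  shows "((\<lambda>x. f (z + x *\<^sub>R e)) has_vector_derivative D) (at x)"
proof -
  have 1: "((\<lambda>y. y - x) has_vector_derivative 1) (at x)"
    by (auto intro!: derivative_eq_intros)
  have 2: "((\<lambda>t. f (z + x *\<^sub>R e + t *\<^sub>R e)) has_vector_derivative D) (at (x - x))"
    using assms unfolding has_partial_def by simp
  from vector_diff_chain_at[OF 1 2] show ?thesis
    by (simp add: o_def algebra_simps)
qed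

lemma continuous_on_joint_compose:
  fixes \<Phi> :: "real \<Rightarrow> complex \<Rightarrow> complex"
  assumes "continuous_on ({0..1} \<times> ball 0 1) (\<lambda>(s, z). \<Phi> s z)"
    and "continuous_on A f" "continuous_on A g"
    and "\<And>x. x \<in> A \<Longrightarrow> f x \<in> {0..1}" "\<And>x. x \<in> A \<Longrightarrow> g x \<in> ball 0 1"
  shows "continuous_on A (\<lambda>x. \<Phi> (f x) (g x))"
proof -
  have "continuous_on A (\<lambda>x. (f x, g x))" by (intro continuous_intros assms)
  from continuous_on_compose2[OF assms(1) this] show ?thesis
    using assms(4,5) by (auto simp: image_subset_iff)
qed

lemma has_partial_integral:
  fixes \<Phi> :: "real \<Rightarrow> complex \<Rightarrow> complex"
  assumes "continuous_on ({0..1} \<times> ball 0 1) (\<lambda>(s, z). \<Phi> s z)"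
    and "continuous_on ({0..1} \<times> ball 0 1) (\<lambda>(s, z). \<Psi> s z)"
    and p: "\<And>s z. s \<in> {0..1} \<Longrightarrow> z \<in> ball 0 1 \<Longrightarrow> has_partial e (\<Phi> s) (\<Psi> s z) z"
    and z: "z \<in> ball 0 1"
  shows "has_partial e (\<lambda>z. integral {0..1} (\<lambda>s. \<Phi> s z)) (integral {0..1} (\<lambda>s. \<Psi> s z)) z"
proof -
  have "open ((\<lambda>t::real. z + t *\<^sub>R e) -` ball 0 1)"
    by (rule continuous_open_vimage[OF open_ball]) (auto intro!: continuous_intros)
  moreover have "0 \<in> (\<lambda>t::real. z + t *\<^sub>R e) -` ball 0 1" using z by simp
  \<comment> \<open>For parameters in \<open>ball 0 d\<close> the line through \<open>z\<close>
    stays in the disc, so the Leibniz rule in one variable applies.\<close>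
  ultimately obtain d where d: "d > 0" "ball 0 d \<subseteq> (\<lambda>t::real. z + t *\<^sub>R e) -` ball 0 1"
    unfolding open_contains_ball by blast
  then have U: "\<And>t. t \<in> ball 0 d \<Longrightarrow> z + t *\<^sub>R e \<in> ball 0 1" by auto
  have int: "(\<lambda>s. \<Phi> s w) integrable_on {0..1}" if "w \<in> ball 0 1" for w
    using that by (intro integrable_continuous_interval continuous_on_joint_compose[OF assms(1)] continuous_intros)
      auto
  have c: "continuous_on (ball 0 d \<times> {0..1}) (\<lambda>(t, s). \<Psi> s (z + t *\<^sub>R e))"
    unfolding split_beta using U
    by (intro continuous_on_joint_compose[OF assms(2)] continuous_intros) auto
  have "((\<lambda>x. integral {0..1} (\<lambda>s. \<Phi> s (z + x *\<^sub>R e))) has_vector_derivative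
     integral {0..1} (\<lambda>s. \<Psi> s (z + 0 *\<^sub>R e))) (at 0 within ball 0 d)"
    using d U int by (intro leibniz_rule_vector_derivative[of _ "0::real" "1::real", unfolded box_real, OF _ _ c])
       (auto intro!: has_vector_derivative_at_within has_partial_along_line p)
  then show ?thesis unfolding has_partial_def using d
    by (simp add: at_within_open[of 0 "ball 0 d"])
qed

lemma Ck_on_cong:
  assumes "open S" "\<And>z. z \<in> S \<Longrightarrow> f z = g z" "Ck_on n S f"
  shows "Ck_on n S g"
  using assms(2,3)
proof (induction n arbitrary: f g)
  case 0
  then show ?case using continuous_on_cong[of S S f g] by auto
next
  case (Suc n)
  have p: "has_partial e g (partial_deriv e f z) z" if "e \<in> {1, \<i>}" "z \<in> S" for e z
    using Suc.prems that by (intro has_partial_transform_open[OF has_partial_partial_deriv \<open>open S\<close>]) auto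
  have "Ck_on n S (partial_deriv e g)" if "e \<in> {1, \<i>}" for e
    using Suc.prems(2) that
    by (intro Suc.IH[of "partial_deriv e f" "partial_deriv e g"] has_partial_imp(2)[OF p, symmetric]) auto
  moreover have "continuous_on S g" using Suc.prems continuous_on_cong[of S S f g] by auto
  ultimately show ?case using has_partial_imp(1)[OF p] by simp
qed

lemma Ck_on_integral:
  assumes "joint_Ck n \<Phi>"
  shows "Ck_on n (ball 0 1) (\<lambda>z. integral {0..1} (\<lambda>s. \<Phi> s z))"
  using assms
proof (induction n arbitrary: \<Phi>)
  case 0
  have "continuous_on (ball 0 1 \<times> {0..1}) (\<lambda>(z, s). \<Phi> s z)"
    unfolding split_beta
    by (intro continuous_on_joint_compose[OF joint_Ck_continuous[OF 0]] continuous_intros) auto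
  from integral_continuous_on_param[of _ "0::real" "1::real", unfolded box_real, OF this] show ?case by simp
next
  case (Suc n)
  obtain A where A[rule_format]: "\<forall>e\<in>{1, \<i>}. joint_Ck n (A e)"
    and p[rule_format]: "\<forall>e\<in>{1, \<i>}. \<forall>s\<in>{0..1}. \<forall>z\<in>ball 0 1. has_partial e (\<Phi> s) (A e s z) z"
    using Suc.prems by (rule joint_Ck_SucE)
  have h: "has_partial e (\<lambda>z. integral {0..1} (\<lambda>s. \<Phi> s z)) (integral {0..1} (\<lambda>s. A e s z)) z"
    if "e \<in> {1, \<i>}" "z \<in> ball 0 1" for e z
    using joint_Ck_continuous[OF Suc.prems] joint_Ck_continuous[OF A[OF that(1)]] p[OF that(1)] that(2)
    by (rule has_partial_integral)
  have "continuous_on (ball 0 1 \<times> {0..1}) (\<lambda>(z, s). \<Phi> s z)"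
    unfolding split_beta
    by (intro continuous_on_joint_compose[OF joint_Ck_continuous[OF Suc.prems]] continuous_intros) auto
  from integral_continuous_on_param[of _ "0::real" "1::real", unfolded box_real, OF this]
  have "continuous_on (ball 0 1) (\<lambda>z. integral {0..1} (\<lambda>s. \<Phi> s z))" by simp
  moreover have "Ck_on n (ball 0 1) (partial_deriv e (\<lambda>z. integral {0..1} (\<lambda>s. \<Phi> s z)))"
    if "e \<in> {1, \<i>}" for e
    by (rule Ck_on_cong[OF open_ball _ Suc.IH[OF A[OF that]]])
       (simp add: has_partial_imp(2)[OF h[OF that]])
  ultimately show ?case using has_partial_imp(1)[OF h] by simp
qed

lemma joint_Ck_of_Ck_on: "Ck_on n (ball 0 1) f \<Longrightarrow> joint_Ck n (\<lambda>s. f)"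
proof (induction n arbitrary: f)
  case 0
  have "continuous_on ({0..1::real} \<times> ball (0::complex) 1) snd" by (intro continuous_intros)
  from continuous_on_compose2[OF 0[simplified] this] show ?case
    by (simp add: split_beta image_subset_iff)
next
  case (Suc n)
  have "continuous_on ({0..1::real} \<times> ball (0::complex) 1) snd" by (intro continuous_intros)
  from continuous_on_compose2[of "ball 0 1" f, OF _ this] Suc.prems
  have "continuous_on ({0..1} \<times> ball 0 1) (\<lambda>(s::real, z). f z)"
    by (simp add: split_beta image_subset_iff)
  then show ?case
    by (rule joint_Ck_SucI[of _ _ "\<lambda>e s. partial_deriv e f"])
      (use Suc in \<open>auto intro!: has_partial_partial_deriv\<close>)
qed

section \<open>From the Cauchy-Riemann equation to holomorphy\<close>

text \<open>Continuity of the partial derivatives gives real differentiability, and the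
  Cauchy-Riemann equation turns the differential into multiplication by
  \<open>D 1 z\<close>.\<close>

lemma Cauchy_Riemann_imp_holomorphic:
  assumes c: "\<And>e. e \<in> {1, \<i>} \<Longrightarrow> continuous_on (ball 0 1) (D e)"
    and p: "\<And>e z. e \<in> {1, \<i>} \<Longrightarrow> z \<in> ball 0 1 \<Longrightarrow> has_partial e f (D e z) z"
    and cr: "\<And>z. z \<in> ball 0 1 \<Longrightarrow> D 1 z + \<i> * D \<i> z = 0"
  shows "f holomorphic_on ball 0 1"
proof (rule holomorphic_onI)
  fix z :: complex assume z: "z \<in> ball 0 1"
  \<comment> \<open>Half of the distance to the boundary, since the modulus of a displacement is
    estimated by the sum of its two coordinates.\<close>
  define d where "d = (1 - cmod z) / 2"
  have d: "d > 0" using z by (simp add: d_def)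
  define X Y where "X = {Re z - d<..<Re z + d}" and "Y = {Im z - d<..<Im z + d}"
  have XY: "Complex x y \<in> ball 0 1" if "x \<in> X" "y \<in> Y" for x y
  proof -
    have "cmod (Complex x y - z) \<le> \<bar>x - Re z\<bar> + \<bar>y - Im z\<bar>"
      by (rule order.trans[OF cmod_le]) simp
    also have "\<dots> < 2 * d" using that by (auto simp: X_def Y_def)
    finally have "cmod (Complex x y - z) < 1 - cmod z" by (simp add: d_def)
    then show ?thesis using norm_triangle_ineq[of z "Complex x y - z"] by simp
  qed
  define F where "F x y = f (Complex x y)" for x y
  have open_XY: "open X" "open Y" "Re z \<in> X" "Im z \<in> Y" using d by (auto simp: X_def Y_def)
  \<comment> \<open>The theorem on partial derivatives asks for the horizontal derivative at
    \<open>z\<close> only, but for the vertical one, with continuity, on the square around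
    \<open>z\<close>.\<close>
  have fx: "((\<lambda>x. F x (Im z)) has_derivative (\<lambda>h. h *\<^sub>R D 1 z)) (at (Re z) within X)"
  proof -
    have "z - of_real (Re z) + Re z *\<^sub>R 1 = z" by (simp add: complex_eq_iff)
    then have "((\<lambda>x. f (z - of_real (Re z) + x *\<^sub>R 1)) has_vector_derivative D 1 z) (at (Re z))"
      using p[of 1 z] z by (intro has_partial_along_line) simp_all
    moreover have "z - of_real (Re z) + x *\<^sub>R 1 = Complex x (Im z)" for x
      by (simp add: complex_eq_iff)
    ultimately show ?thesis
      by (auto simp: F_def has_vector_derivative_def intro: has_derivative_at_withinI)
  qed
  have fy: "((\<lambda>y. F x y) has_derivative blinfun_apply (blinfun_scaleR_left (D \<i> (Complex x y)))) (at y within Y)"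
    if "x \<in> X" "y \<in> Y" for x y
  proof -
    have "of_real x + y *\<^sub>R \<i> = Complex x y" by (simp add: complex_eq_iff)
    then have "((\<lambda>y. f (of_real x + y *\<^sub>R \<i>)) has_vector_derivative D \<i> (Complex x y)) (at y)"
      using p[OF _ XY[OF that], of \<i>] by (intro has_partial_along_line) simp_all
    moreover have "of_real x + y *\<^sub>R \<i> = Complex x y" for y
      by (simp add: complex_eq_iff)
    ultimately show ?thesis
      by (auto simp: F_def has_vector_derivative_def blinfun_scaleR_left.rep_eq intro: has_derivative_at_withinI)
  qed
  have "continuous_on (X \<times> Y) (\<lambda>(x, y). Complex x y)"
    unfolding split_beta Complex_eq by (intro continuous_intros)
  then have "continuous_on (X \<times> Y) (\<lambda>q. D \<i> (case q of (x, y) \<Rightarrow> Complex x y))"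
    using XY by (intro continuous_on_compose2[OF c[of \<i>]]) auto
  from bounded_linear.continuous_on[OF bounded_linear_blinfun_scaleR_left this]
  have "continuous_on (X \<times> Y) (\<lambda>(x, y). blinfun_scaleR_left (D \<i> (Complex x y)))"
    by (simp add: split_beta)
  then have "continuous (at (Re z, Im z) within X \<times> Y) (\<lambda>(x, y). blinfun_scaleR_left (D \<i> (Complex x y)))"
    using open_XY by (auto simp: continuous_on_eq_continuous_within)
  moreover have "convex Y" by (simp add: Y_def)
  ultimately have "((\<lambda>(x, y). F x y) has_derivative
      (\<lambda>(tx, ty). tx *\<^sub>R D 1 z + blinfun_apply (blinfun_scaleR_left (D \<i> (Complex (Re z) (Im z)))) ty))
      (at (Re z, Im z) within X \<times> Y)"
    using fx fy open_XY(4) by (intro has_derivative_partialsI)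
  then
  have "((\<lambda>(x, y). F x y) has_derivative (\<lambda>(tx, ty). tx *\<^sub>R D 1 z + ty *\<^sub>R D \<i> z)) (at (Re z, Im z))"
    using open_XY by (simp add: at_within_open[of _ "X \<times> Y"] open_Times)
  from diff_chain_at[where f = "\<lambda>w. (Re w, Im w)" and f' = "\<lambda>h. (Re h, Im h)" and x = z, OF _ this]
  have "(f has_derivative (\<lambda>h. Re h *\<^sub>R D 1 z + Im h *\<^sub>R D \<i> z)) (at z)"
    by (simp add: o_def F_def has_derivative_Pair bounded_linear_imp_has_derivative bounded_linear_Re bounded_linear_Im)
  moreover have "Re h *\<^sub>R D 1 z + Im h *\<^sub>R D \<i> z = D 1 z * h" for h
  proof -
    have "D 1 z = - \<i> * D \<i> z" using cr[OF z] by (simp add: add_eq_0_iff2)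
    then have "Re h *\<^sub>R D 1 z + Im h *\<^sub>R D \<i> z = - \<i> * D \<i> z * (of_real (Re h) + \<i> * of_real (Im h))"
      by (simp add: scaleR_conv_of_real algebra_simps)
    then show ?thesis using \<open>D 1 z = _\<close> complex_eq[of h] by simp
  qed
  ultimately have "(f has_field_derivative D 1 z) (at z)"
    by (simp add: has_field_derivative_def)
  then show "f field_differentiable at z within ball 0 1"
    using field_differentiable_at_within field_differentiable_def by blast
qed

section \<open>Coefficient sequences of subexponential growth\<close>

text \<open>Boundedness for each radius below 1 replaces the limsup of roots, because it passes to
  products and yields geometric majorants directly; \<open>Limsup_root_le_1_iff_subexp\<close> is
  the equivalence.\<close>

definition subexp :: "(int \<Rightarrow> complex) \<Rightarrow> bool" where
  "subexp c \<longleftrightarrow> (\<forall>r\<in>{0<..<1}. \<exists>C. \<forall>k. cmod (c k) * r ^ nat \<bar>k\<bar> \<le> C)"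

lemma subexp_mult:
  assumes "subexp c" "subexp d"
  shows "subexp (\<lambda>k. c k * d k)"
  unfolding subexp_def
proof
  fix r :: real assume r: "r \<in> {0<..<1}"
  \<comment> \<open>Each factor gets one square root of the radius.\<close>
  then have "sqrt r \<in> {0<..<1}" by auto
  with assms obtain A B where A: "\<And>k. cmod (c k) * sqrt r ^ nat \<bar>k\<bar> \<le> A"
    and B: "\<And>k. cmod (d k) * sqrt r ^ nat \<bar>k\<bar> \<le> B"
    unfolding subexp_def by metis
  have "cmod (c k * d k) * r ^ nat \<bar>k\<bar> \<le> A * B" for k
  proof -
    have "r ^ nat \<bar>k\<bar> = sqrt r ^ nat \<bar>k\<bar> * sqrt r ^ nat \<bar>k\<bar>"
      using r by (simp flip: power_mult_distrib)
    then have "cmod (c k * d k) * r ^ nat \<bar>k\<bar> =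
        (cmod (c k) * sqrt r ^ nat \<bar>k\<bar>) * (cmod (d k) * sqrt r ^ nat \<bar>k\<bar>)"
      by (simp add: norm_mult)
    also have "\<dots> \<le> A * B"
    proof (rule mult_mono[OF A B])
      show "0 \<le> A" using A[of k] r by (rule_tac order.trans[rotated]) auto
    qed (use r in auto)
    finally show ?thesis .
  qed
  then show "\<exists>C. \<forall>k. cmod (c k * d k) * r ^ nat \<bar>k\<bar> \<le> C" by blast
qed

lemma subexp_mono: "subexp d \<Longrightarrow> (\<And>k. cmod (c k) \<le> cmod (d k)) \<Longrightarrow> subexp c"
  unfolding subexp_def
  by (metis greaterThanLessThan_iff less_imp_le mult_right_mono order.trans zero_le_power)

lemma subexp_const: "subexp (\<lambda>k. a)"
  unfolding subexp_def
proof
  fix r :: real assume r: "r \<in> {0<..<1}"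
  then have "cmod a * r ^ nat \<bar>k\<bar> \<le> cmod a" for k
    by (intro mult_right_le_one_le power_le_one) auto
  then show "\<exists>C. \<forall>k. cmod a * r ^ nat \<bar>k\<bar> \<le> C" by blast
qed

lemma subexp_linear: "subexp (\<lambda>k. of_real (1 + real_of_int \<bar>k\<bar>))"
  unfolding subexp_def
proof
  fix r :: real assume r: "r \<in> {0<..<1}"
  have "(\<lambda>n. real n * r ^ n) \<longlonglongrightarrow> 0" using r by (intro powser_times_n_limit_0) auto
  then have "Bseq (\<lambda>n. real n * r ^ n)" by (intro convergent_imp_Bseq convergentI)
  then obtain K where K: "\<And>n. real n * r ^ n \<le> K"
    by (metis BseqE real_norm_def abs_le_D1)
  have "cmod (of_real (1 + real_of_int \<bar>k\<bar>)) * r ^ nat \<bar>k\<bar> \<le> 1 + K" for k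
  proof -
    have "real_of_int \<bar>k\<bar> = real (nat \<bar>k\<bar>)" by simp
    then have "cmod (of_real (1 + real_of_int \<bar>k\<bar>)) * r ^ nat \<bar>k\<bar> = r ^ nat \<bar>k\<bar> + real (nat \<bar>k\<bar>) * r ^ nat \<bar>k\<bar>"
      unfolding norm_of_real by (simp add: algebra_simps)
    also have "\<dots> \<le> 1 + K" using r by (intro add_mono K power_le_one) auto
    finally show ?thesis .
  qed
  then show "\<exists>C. \<forall>k. cmod (of_real (1 + real_of_int \<bar>k\<bar>)) * r ^ nat \<bar>k\<bar> \<le> C" by blast
qed

definition poly_bounded :: "(int \<Rightarrow> complex) \<Rightarrow> bool" where
  "poly_bounded c \<longleftrightarrow> (\<exists>C N. \<forall>k. cmod (c k) \<le> C * (1 + real_of_int \<bar>k\<bar>) ^ N)"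

lemma poly_bounded_imp_subexp: 
  assumes "poly_bounded c"
  shows "subexp c"
proof -
  obtain C N where C: "\<And>k. cmod (c k) \<le> C * (1 + real_of_int \<bar>k\<bar>) ^ N"
    using assms unfolding poly_bounded_def by blast
  have "subexp (\<lambda>k. of_real (1 + real_of_int \<bar>k\<bar>) ^ n)" for n
    by (induction n) (use subexp_const subexp_mult[OF subexp_linear] in \<open>simp_all del: of_real_add of_int_abs\<close>)
  then have s: "subexp (\<lambda>k. of_real C * of_real (1 + real_of_int \<bar>k\<bar>) ^ N)"
    by (intro subexp_mult subexp_const)
  show ?thesis
  proof (rule subexp_mono[OF s])
    fix k
    have "cmod (of_real C * of_real (1 + real_of_int \<bar>k\<bar>) ^ N) = \<bar>C\<bar> * (1 + real_of_int \<bar>k\<bar>) ^ N"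
      by (simp add: norm_mult norm_power del: of_real_add)
    moreover have "C * (1 + real_of_int \<bar>k\<bar>) ^ N \<le> \<bar>C\<bar> * (1 + real_of_int \<bar>k\<bar>) ^ N"
      by (intro mult_right_mono) auto
    ultimately show "cmod (c k) \<le> cmod (of_real C * of_real (1 + real_of_int \<bar>k\<bar>) ^ N)"
      using C[of k] by linarith
  qed
qed

lemma poly_bounded_mult:
  assumes "poly_bounded c" "poly_bounded d"
  shows "poly_bounded (\<lambda>k. c k * d k)"
proof -
  obtain C N where C: "\<And>k. cmod (c k) \<le> C * (1 + real_of_int \<bar>k\<bar>) ^ N"
    using assms unfolding poly_bounded_def by blast
  obtain D M where D: "\<And>k. cmod (d k) \<le> D * (1 + real_of_int \<bar>k\<bar>) ^ M"
    using assms unfolding poly_bounded_def by blast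
  have "cmod (c k * d k) \<le> (C * D) * (1 + real_of_int \<bar>k\<bar>) ^ (N + M)" for k
  proof -
    have "cmod (c k) * cmod (d k) \<le> (C * (1 + real_of_int \<bar>k\<bar>) ^ N) * (D * (1 + real_of_int \<bar>k\<bar>) ^ M)"
      using order.trans[OF norm_ge_zero C[of k]] by (intro mult_mono C D) auto
    then show ?thesis by (simp add: norm_mult power_add mult_ac)
  qed
  then show ?thesis unfolding poly_bounded_def by blast
qed

text \<open>The condition on \<open>f\<close> covers the enumerations \<open>k\<close> and
  \<open>- (k + 1)\<close> of the two halves of the integers; the shift by one costs the factor
  \<open>1 / q\<close>. The intermediate radius \<open>q\<close> leaves a geometric series of ratio
  \<open>r / q\<close>.\<close>

lemma summable_of_subexp:
  assumes "subexp c" "\<And>k. nat \<bar>f k\<bar> \<le> Suc k" "0 \<le> r" "r < 1"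
  shows "summable (\<lambda>k. cmod (c (f k)) * r ^ k)"
proof -
  define q where "q = (1 + r) / 2"
  have q: "0 < q" "q < 1" "r < q" using assms by (auto simp: q_def)
  then have "q \<in> {0<..<1}" by simp
  then obtain C where C: "\<And>k. cmod (c k) * q ^ nat \<bar>k\<bar> \<le> C"
    using assms(1) unfolding subexp_def by blast
  have le: "cmod (c (f k)) * r ^ k \<le> C / q * (r / q) ^ k" for k
  proof -
    have "cmod (c (f k)) * q ^ Suc k \<le> cmod (c (f k)) * q ^ nat \<bar>f k\<bar>"
      using q assms(2) by (intro mult_left_mono power_decreasing) auto
    also have "\<dots> \<le> C" by (rule C)
    finally have "cmod (c (f k)) \<le> C / q ^ Suc k" using q by (simp add: field_simps)
    then have "cmod (c (f k)) * r ^ k \<le> C / q ^ Suc k * r ^ k"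
      using assms by (intro mult_right_mono) auto
    then show ?thesis by (simp add: power_divide)
  qed
  have "summable (\<lambda>k. C / q * (r / q) ^ k)"
    using q assms by (intro summable_mult summable_geometric) auto
  then show ?thesis
    by (rule summable_comparison_test') (use le assms in auto)
qed

lemma Limsup_root_le_1_iff_subexp:
  "Limsup cofinite (\<lambda>k. ereal (root (nat \<bar>k\<bar>) (cmod (c k)))) \<le> 1 \<longleftrightarrow> subexp c"
proof
  assume L: "Limsup cofinite (\<lambda>k. ereal (root (nat \<bar>k\<bar>) (cmod (c k)))) \<le> 1"
  show "subexp c" unfolding subexp_def
  proof
    fix r :: real assume r: "r \<in> {0<..<1}"
    then have "ereal (1 / r) > 1" by simp
    with L have "\<forall>\<^sub>F k in cofinite. ereal (root (nat \<bar>k\<bar>) (cmod (c k))) < ereal (1 / r)"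
      unfolding Limsup_le_iff by blast
    then have fin: "finite {k. \<not> root (nat \<bar>k\<bar>) (cmod (c k)) < 1 / r}" (is "finite ?S")
      by (simp add: eventually_cofinite)
    \<comment> \<open>\<open>root 0\<close> is constantly 0, so the condition on the roots says
      nothing about \<open>c 0\<close>, which joins the exceptions.\<close>
    define S where "S = insert 0 ?S"
    have "finite S" using fin by (simp add: S_def)
    have "cmod (c k) * r ^ nat \<bar>k\<bar> \<le> 1 + (\<Sum>k\<in>S. cmod (c k) * r ^ nat \<bar>k\<bar>)" for k
    proof (cases "k \<in> S")
      case True
      have "cmod (c k) * r ^ nat \<bar>k\<bar> \<le> (\<Sum>k\<in>S. cmod (c k) * r ^ nat \<bar>k\<bar>)"
        using r True \<open>finite S\<close> by (intro member_le_sum) auto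
      then show ?thesis by simp
    next
      case False
      then have n: "nat \<bar>k\<bar> > 0" and "root (nat \<bar>k\<bar>) (cmod (c k)) < 1 / r" by (auto simp: S_def)
      then have "root (nat \<bar>k\<bar>) (cmod (c k)) ^ nat \<bar>k\<bar> \<le> (1 / r) ^ nat \<bar>k\<bar>"
        by (intro power_mono) auto
      then have "cmod (c k) \<le> (1 / r) ^ nat \<bar>k\<bar>" using n by simp
      then have "cmod (c k) * r ^ nat \<bar>k\<bar> \<le> 1" using r by (simp add: field_simps)
      moreover have "0 \<le> (\<Sum>k\<in>S. cmod (c k) * r ^ nat \<bar>k\<bar>)" using r by (intro sum_nonneg) auto
      ultimately show ?thesis by simp
    qed
    then show "\<exists>C. \<forall>k. cmod (c k) * r ^ nat \<bar>k\<bar> \<le> C" by blast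
  qed
next
  assume s: "subexp c"
  show "Limsup cofinite (\<lambda>k. ereal (root (nat \<bar>k\<bar>) (cmod (c k)))) \<le> 1"
    unfolding Limsup_le_iff
  proof (intro allI impI)
    fix y :: ereal assume y: "y > 1"
    show "\<forall>\<^sub>F k in cofinite. ereal (root (nat \<bar>k\<bar>) (cmod (c k))) < y"
    proof (cases y)
      case (real t)
      then have t: "t > 1" using y by simp
      \<comment> \<open>Then \<open>r < 1\<close> while \<open>t * r = sqrt t > 1\<close>, whose
        powers eventually exceed any bound.\<close>
      define r where "r = 1 / sqrt t"
      have r: "r \<in> {0<..<1}" and tr: "t * r > 1" using t real_less_rsqrt[of 1 t] real_less_lsqrt[of t t]
        by (auto simp: r_def field_simps power2_eq_square)
      then obtain C where C: "\<And>k. cmod (c k) * r ^ nat \<bar>k\<bar> \<le> C"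
        using s unfolding subexp_def by blast
      obtain M where M: "C < (t * r) ^ M" using real_arch_pow[OF tr] by blast
      have *: "root (nat \<bar>k\<bar>) (cmod (c k)) < t" if "nat \<bar>k\<bar> > M" for k
      proof -
        have "cmod (c k) * r ^ nat \<bar>k\<bar> \<le> C" by (rule C)
        also have "\<dots> < (t * r) ^ M" by (rule M)
        also have "\<dots> \<le> (t * r) ^ nat \<bar>k\<bar>" using that tr by (intro power_increasing) auto
        finally have "cmod (c k) < t ^ nat \<bar>k\<bar>" using r by (simp add: power_mult_distrib)
        then have "root (nat \<bar>k\<bar>) (cmod (c k)) < root (nat \<bar>k\<bar>) (t ^ nat \<bar>k\<bar>)"
          using that by simp
        then show ?thesis using that t by (simp add: real_root_power_cancel)
      qed
      have "{k. \<not> ereal (root (nat \<bar>k\<bar>) (cmod (c k))) < y} \<subseteq> {- int M..int M}"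
      proof
        fix k assume "k \<in> {k. \<not> ereal (root (nat \<bar>k\<bar>) (cmod (c k))) < y}"
        then have "\<not> nat \<bar>k\<bar> > M" using *[of k] real by auto
        then show "k \<in> {- int M..int M}" by auto
      qed
      then show ?thesis unfolding eventually_cofinite by (rule finite_subset) auto
    qed (use y in auto)
  qed
qed

section \<open>The hypergeometric factor\<close>

text \<open>This is the factor of \<open>cnj z ^ Suc k\<close>; the index is shifted so that
  \<open>k\<close> runs through all natural numbers.\<close>

definition radial :: "real \<Rightarrow> nat \<Rightarrow> real \<Rightarrow> real" where
  "radial \<alpha> k x = hyp2F1 (- \<alpha>) (real (Suc k)) (real (Suc k) + 1) x"

text \<open>The two products share all factors except the first of one and the last of the
  other.\<close>

lemma pochhammer_quotient:
  assumes "k > 0"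
  shows "pochhammer k n / pochhammer (k + 1) n = k / (k + real n)"
proof -
  have "pochhammer k (Suc n) = k * pochhammer (k + 1) n" by (rule pochhammer_rec)
  moreover have "pochhammer k (Suc n) = pochhammer k n * (k + real n)" by (rule pochhammer_Suc)
  moreover have "pochhammer (k + 1) n > 0" using assms by (intro pochhammer_pos) auto
  ultimately show ?thesis using assms by (simp add: field_simps)
qed

lemma binomial_sums:
  assumes "\<bar>y\<bar> < (1::real)"
  shows "(\<lambda>n. pochhammer (- \<alpha>) n / fact n * y ^ n) sums (1 - y) powr \<alpha>"
proof -
  have "(\<lambda>n. (\<alpha> gchoose n) * (- y) ^ n) sums (1 + (- y)) powr \<alpha>"
    using assms by (intro gen_binomial_real) auto
  moreover have "(\<alpha> gchoose n) * (- y) ^ n = pochhammer (- \<alpha>) n / fact n * y ^ n" for n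
    by (simp add: gbinomial_pochhammer power_minus[of y])
  ultimately show ?thesis by simp
qed

lemma hypergeo_coeff:
  assumes "k > 0"
  shows "fps_hypergeo [a, k] [k + 1] 1 $ n = pochhammer a n / fact n * (k / (k + real n))"
proof -
  have "fps_hypergeo [a, k] [k + 1] 1 $ n =
      pochhammer a n / fact n * (pochhammer k n / pochhammer (k + 1) n)"
    by (simp add: mult.commute)
  then show ?thesis by (simp only: pochhammer_quotient[OF assms])
qed

text \<open>Multiplied by \<open>y^k\<close>, the equation says that \<open>y^(k+1)\<close> times
  \<open>radial \<alpha> k y\<close> has the derivative \<open>(k + 1) y^k (1 - y)^\<alpha>\<close>.
  On coefficients it reads \<open>(k + 1 + n) f n = (k + 1) b n\<close>, where \<open>b\<close>
  belongs to the binomial series.\<close>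

lemma radial_has_derivative:
  assumes y: "\<bar>y\<bar> < 1"
  obtains D where "(radial \<alpha> k has_real_derivative D) (at y)"
    "y * D + real (Suc k) * radial \<alpha> k y = real (Suc k) * (1 - y) powr \<alpha>"
proof -
  define b where "b n = pochhammer (- \<alpha>) n / fact n" for n
  define f where "f n = b n * (real (Suc k) / (real (Suc k) + real n))" for n
  have b: "summable (\<lambda>n. b n * z ^ n)" if "\<bar>z\<bar> < 1" for z
    using sums_summable[OF binomial_sums[OF that]] by (simp add: b_def)
  have f: "summable (\<lambda>n. f n * z ^ n)" if "\<bar>z\<bar> < 1" for z
  proof -
    from dense[OF that] obtain w where w: "\<bar>z\<bar> < w" "w < 1" by blast
    have "summable (\<lambda>n. norm (b n * z ^ n))"
      using w by (intro powser_insidea[OF b[of w]]) auto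
    moreover have "norm (f n * z ^ n) \<le> norm (b n * z ^ n)" for n
    proof -
      have "\<bar>f n\<bar> \<le> \<bar>b n\<bar>" unfolding f_def abs_mult
        by (intro mult_right_le_one_le) (auto simp: field_simps)
      then show ?thesis by (simp add: abs_mult mult_right_mono)
    qed
    ultimately show ?thesis by (rule summable_comparison_test')
  qed
  have rad: "radial \<alpha> k z = (\<Sum>n. f n * z ^ n)" for z
    by (simp only: radial_def hyp2F1_def eval_fps_def hypergeo_coeff[of "real (Suc k)", simplified of_nat_0_less_iff, OF zero_less_Suc] f_def b_def)
  obtain w where w: "\<bar>y\<bar> < w" "w < 1" using dense[OF y] by blast
  have der: "((\<lambda>z. \<Sum>n. f n * z ^ n) has_real_derivative (\<Sum>n. diffs f n * y ^ n)) (at y)"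
    using w by (intro termdiffs_strong[of f w] f) auto
  have "summable (\<lambda>n. diffs f n * y ^ n)"
    using y f by (intro termdiff_converges[of y 1]) auto
  then have "(\<lambda>n. real n * f n * y ^ (n - Suc 0)) sums (\<Sum>n. diffs f n * y ^ n)"
    by (rule diffs_equiv)
  from sums_mult[OF this, of y]
  have "(\<lambda>n. real n * f n * y ^ n) sums (y * (\<Sum>n. diffs f n * y ^ n))"
  proof (rule sums_cong[THEN iffD1, rotated])
    show "y * (real n * f n * y ^ (n - Suc 0)) = real n * f n * y ^ n" for n
      by (cases n) auto
  qed
  from sums_add[OF this sums_mult[OF summable_sums[OF f[OF y]], of "real (Suc k)"]]
  have "(\<lambda>n. real (Suc k) * (b n * y ^ n)) sums (y * (\<Sum>n. diffs f n * y ^ n) + real (Suc k) * radial \<alpha> k y)"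
    unfolding rad
  proof (rule sums_cong[THEN iffD1, rotated])
    fix n
    have "real n * f n + real (Suc k) * f n = real (Suc k) * b n"
    proof -
      have "real (Suc k) + real n \<noteq> 0" by simp
      then have "(real (Suc k) + real n) * f n = real (Suc k) * b n"
        by (simp add: f_def del: of_nat_Suc)
      then show ?thesis by (simp only: distrib_right add.commute)
    qed
    then show "real n * f n * y ^ n + real (Suc k) * (f n * y ^ n) = real (Suc k) * (b n * y ^ n)"
      by (metis distrib_right mult.assoc)
  qed
  moreover have "(\<lambda>n. real (Suc k) * (b n * y ^ n)) sums (real (Suc k) * (1 - y) powr \<alpha>)"
    unfolding b_def by (intro sums_mult binomial_sums y)
  ultimately have "y * (\<Sum>n. diffs f n * y ^ n) + real (Suc k) * radial \<alpha> k y = real (Suc k) * (1 - y) powr \<alpha>"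
    by (rule sums_unique2)
  moreover have "(\<lambda>z. \<Sum>n. f n * z ^ n) = radial \<alpha> k" using rad by auto
  ultimately show ?thesis using der that by metis
qed

text \<open>\<open>s\<^sup>k\<^sup>+\<^sup>1 F(-\<alpha>, k+1; k+2; s x)\<close> is a primitive of the integrand.\<close>

lemma radial_has_integral:
  assumes x: "0 \<le> x" "x < 1"
  shows "((\<lambda>s. real (Suc k) * s ^ k * (1 - s * x) powr \<alpha>) has_integral radial \<alpha> k x) {0..1}"
proof -
  have "((\<lambda>s. real (Suc k) * s ^ k * (1 - s * x) powr \<alpha>) has_integral
      (1 ^ Suc k * radial \<alpha> k (1 * x) - 0 ^ Suc k * radial \<alpha> k (0 * x))) {0..1}"
  proof (rule fundamental_theorem_of_calculus)
    fix s :: real assume s: "s \<in> {0..1}"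
    then have sx: "\<bar>s * x\<bar> < 1" using x mult_left_le_one_le[of x s] by auto
    obtain D where D: "(radial \<alpha> k has_real_derivative D) (at (s * x))"
      "s * x * D + real (Suc k) * radial \<alpha> k (s * x) = real (Suc k) * (1 - s * x) powr \<alpha>"
      using radial_has_derivative[OF sx] .
    have "((\<lambda>s. radial \<alpha> k (s * x)) has_real_derivative D * x) (at s)"
      by (rule DERIV_chain2[where g = "\<lambda>s. s * x", OF D(1)]) (auto intro!: derivative_eq_intros)
    from DERIV_mult[OF DERIV_pow[of "Suc k" s] this]
    have "((\<lambda>s. s ^ Suc k * radial \<alpha> k (s * x)) has_real_derivative
       (real (Suc k) * s ^ k * radial \<alpha> k (s * x) + D * x * s ^ Suc k)) (at s)"
      by simp
    also have "real (Suc k) * s ^ k * radial \<alpha> k (s * x) + D * x * s ^ Suc k =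
        s ^ k * (s * x * D + real (Suc k) * radial \<alpha> k (s * x))" by (simp add: algebra_simps)
    finally have "((\<lambda>s. s ^ Suc k * radial \<alpha> k (s * x)) has_real_derivative
       (real (Suc k) * s ^ k * (1 - s * x) powr \<alpha>)) (at s)"
      unfolding D(2) by (simp add: mult_ac)
    then show "((\<lambda>s. s ^ Suc k * radial \<alpha> k (s * x)) has_vector_derivative
       real (Suc k) * s ^ k * (1 - s * x) powr \<alpha>) (at s within {0..1})"
      by (auto simp flip: has_real_derivative_iff_has_vector_derivative intro: has_field_derivative_at_within)
  qed simp
  then show ?thesis by simp
qed

lemma power_has_integral: "((\<lambda>s. real (Suc k) * s ^ k * c) has_integral c) {0..1}"
proof -
  have "((\<lambda>s. real (Suc k) * s ^ k * c) has_integral (1 ^ Suc k * c - 0 ^ Suc k * c)) {0..1}"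
    by (rule fundamental_theorem_of_calculus)
      (auto intro!: derivative_eq_intros simp flip: has_real_derivative_iff_has_vector_derivative
        simp del: of_nat_Suc power_Suc)
  then show ?thesis by simp
qed

text \<open>The base lies between 0 and 1, so the exponents \<open>|\<alpha>|\<close> and
  \<open>-|\<alpha>|\<close> treat both signs of \<alpha> at once.\<close>

lemma powr_bounds:
  fixes x s \<alpha> :: real
  assumes "0 \<le> x" "x < 1" "s \<in> {0..1}"
  shows "(1 - x) powr \<bar>\<alpha>\<bar> \<le> (1 - s * x) powr \<alpha>" "(1 - s * x) powr \<alpha> \<le> (1 - x) powr (- \<bar>\<alpha>\<bar>)"
proof -
  have sx: "s * x \<le> x" "0 \<le> s * x" using assms mult_left_le_one_le[of x s] by auto
  have "(1 - x) powr \<bar>\<alpha>\<bar> \<le> (1 - s * x) powr \<bar>\<alpha>\<bar>" using assms sx by (intro powr_mono2) auto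
  also have "\<dots> \<le> (1 - s * x) powr \<alpha>" using assms sx by (intro powr_mono') auto
  finally show "(1 - x) powr \<bar>\<alpha>\<bar> \<le> (1 - s * x) powr \<alpha>" .
  have "(1 - s * x) powr \<alpha> \<le> (1 - s * x) powr (- \<bar>\<alpha>\<bar>)" using assms sx by (intro powr_mono') auto
  also have "\<dots> \<le> (1 - x) powr (- \<bar>\<alpha>\<bar>)" using assms sx by (intro powr_mono2') auto
  finally show "(1 - s * x) powr \<alpha> \<le> (1 - x) powr (- \<bar>\<alpha>\<bar>)" .
qed

text \<open>The integral representation is compared with the integral of a constant against the same
  weight of mass 1. The bounds are free of \<open>k\<close>.\<close>

lemma radial_bounds:
  assumes x: "0 \<le> x" "x < 1"
  shows "(1 - x) powr \<bar>\<alpha>\<bar> \<le> radial \<alpha> k x" "radial \<alpha> k x \<le> (1 - x) powr (- \<bar>\<alpha>\<bar>)"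
  by (rule has_integral_le[OF power_has_integral radial_has_integral[OF x]]
           has_integral_le[OF radial_has_integral[OF x] power_has_integral];
      use powr_bounds[OF x] in \<open>auto intro!: mult_left_mono\<close>)+

section \<open>Solutions as integrals of antiholomorphic functions\<close>

text \<open>A right inverse of \<open>(1 - |z|\<^sup>2)\<^sup>-\<^sup>\<alpha>\<close> times \<^const>\<open>dbar_z\<close> on the functions \<open>G (cnj z)\<close>, \<open>G\<close> holomorphic.\<close>

definition anti_part :: "real \<Rightarrow> (complex \<Rightarrow> complex) \<Rightarrow> complex \<Rightarrow> complex" where
  "anti_part \<alpha> G z = integral {0..1}
     (\<lambda>s. cnj z * (of_real ((1 - s * (cmod z)\<^sup>2) powr \<alpha>) * G (of_real s * cnj z)))"

text \<open>At \<open>s = 1\<close> the family of weights becomes the single weight that occurs in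
  the differential operator.\<close>

lemma joint_Ck_freeze: "joint_Ck n \<Phi> \<Longrightarrow> s \<in> {0..1} \<Longrightarrow> joint_Ck n (\<lambda>_. \<Phi> s)"
proof (induction n arbitrary: \<Phi>)
  case 0
  have "continuous_on ({0..1} \<times> ball 0 1) (\<lambda>p. \<Phi> s (snd (p :: real \<times> complex)))"
    using 0(2) by (intro continuous_on_joint_compose[OF joint_Ck_continuous[OF 0(1)]] continuous_intros) auto
  then show ?case by (simp add: split_beta)
next
  case (Suc n)
  obtain A where A[rule_format]: "\<forall>e\<in>{1, \<i>}. joint_Ck n (A e)"
    and p[rule_format]: "\<forall>e\<in>{1, \<i>}. \<forall>s\<in>{0..1}. \<forall>z\<in>ball 0 1. has_partial e (\<Phi> s) (A e s z) z"
    using Suc.prems(1) by (rule joint_Ck_SucE)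
  have "continuous_on ({0..1} \<times> ball 0 1) (\<lambda>p. \<Phi> s (snd (p :: real \<times> complex)))"
    using Suc.prems(2)
    by (intro continuous_on_joint_compose[OF joint_Ck_continuous[OF Suc.prems(1)]] continuous_intros) auto
  then have "continuous_on ({0..1} \<times> ball 0 1) (\<lambda>(t :: real, z). \<Phi> s z)" by (simp add: split_beta)
  then show ?case
    by (rule joint_Ck_SucI[of _ _ "\<lambda>e _. A e s"]) (use Suc.IH[OF A Suc.prems(2)] p Suc.prems(2) in blast)+
qed

text \<open>A family constant in \<open>s\<close> is its own integral over the unit interval. The
  equivalence makes the sum and product rules of \<open>joint_Ck\<close> available for
  \<open>Ck_on\<close>.\<close>

lemma Ck_on_iff_joint: "Ck_on n (ball 0 1) f \<longleftrightarrow> joint_Ck n (\<lambda>_. f)"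
  using joint_Ck_of_Ck_on Ck_on_integral[of n "\<lambda>_. f"] by auto

lemma anti_part_Ck:
  assumes "G holomorphic_on ball 0 1"
  shows "Ck_on n (ball 0 1) (anti_part \<alpha> G)"
  unfolding anti_part_def
  by (intro Ck_on_integral joint_Ck_mult joint_Ck_cnj joint_Ck_norm_powr joint_Ck_antiholomorphic assms)

lemma dbar_z_eqI:
  assumes "has_partial 1 f A z" "has_partial \<i> f B z" "A + \<i> * B = 2 * C"
  shows "dbar_z f z = C"
  using assms by (simp add: dbar_z_def has_partial_imp(2))

lemma dbar_anti_part:
  assumes G: "G holomorphic_on ball 0 1" and z: "z \<in> ball 0 1"
  shows "dbar_z (anti_part \<alpha> G) z = of_real ((1 - (cmod z)\<^sup>2) powr \<alpha>) * G (cnj z)"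
proof -
  define x where "x = (cmod z)\<^sup>2"
  have x: "0 \<le> x" "x < 1" using z by (auto simp: x_def abs_square_less_1)
  define P where "P s z = complex_of_real ((1 - s * (cmod z)\<^sup>2) powr \<alpha>)" for s and z :: complex
  define K where "K s z = G (complex_of_real s * cnj z)" for s z
  define dP where "dP e s z = of_real \<alpha> * of_real ((1 - s * (cmod z)\<^sup>2) powr (\<alpha> - 1)) * (- of_real s * (z * cnj e + e * cnj z))" 
    for e s and z :: complex
  define dK where "dK e s z = cnj e * of_real s * deriv G (of_real s * cnj z)" for e s z
  define \<Psi> where "\<Psi> e s z = cnj z * (P s z * dK e s z + dP e s z * K s z) + cnj e * (P s z * K s z)" for e s z
  have G': "deriv G holomorphic_on ball 0 1" using G by (intro holomorphic_deriv) auto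
  have jneg: "joint_Ck n (\<lambda>s z. - complex_of_real s)" for n
    using joint_Ck_mult[OF joint_Ck_const[of n "-1"] joint_Ck_scale] by simp
  have jP: "joint_Ck 0 P" unfolding P_def by (intro joint_Ck_norm_powr)
  have jK: "joint_Ck 0 K" unfolding K_def by (intro joint_Ck_antiholomorphic G)
  have jdP: "joint_Ck 0 (dP e)" for e unfolding dP_def
    by (intro joint_Ck_mult joint_Ck_add joint_Ck_const joint_Ck_norm_powr jneg joint_Ck_cnj joint_Ck_holomorphic holomorphic_intros)
  have jdK: "joint_Ck 0 (dK e)" for e unfolding dK_def
    by (intro joint_Ck_mult joint_Ck_const joint_Ck_scale joint_Ck_antiholomorphic G')
  have j\<Phi>: "joint_Ck 0 (\<lambda>s z. cnj z * (P s z * K s z))"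
    by (intro joint_Ck_mult joint_Ck_cnj jP jK)
  have j\<Psi>: "joint_Ck 0 (\<Psi> e)" for e unfolding \<Psi>_def
    by (intro joint_Ck_mult joint_Ck_add joint_Ck_const joint_Ck_cnj jP jK jdP jdK)
  have pa: "has_partial e (anti_part \<alpha> G) (integral {0..1} (\<lambda>s. \<Psi> e s z)) z" for e
  proof -
    have "anti_part \<alpha> G = (\<lambda>z. integral {0..1} (\<lambda>s. cnj z * (P s z * K s z)))"
      by (simp add: anti_part_def P_def K_def fun_eq_iff)
    moreover have "has_partial e (\<lambda>z. cnj z * (P s z * K s z)) (\<Psi> e s z) z"
      if "s \<in> {0..1}" "z \<in> ball 0 1" for s z
      unfolding \<Psi>_def
      by (intro has_partial_mult has_partial_cnj)
        (use that has_partial_norm_powr has_partial_cnj_comp[OF G] in \<open>auto simp: P_def K_def dP_def dK_def\<close>)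
    ultimately show ?thesis
      using z has_partial_integral[OF joint_Ck_continuous[OF j\<Phi>] joint_Ck_continuous[OF j\<Psi>]] by auto
  qed
  have int: "(\<lambda>s. \<Psi> e s z) integrable_on {0..1}" for e
    using z by (intro integrable_continuous_interval continuous_on_joint_compose[OF joint_Ck_continuous[OF j\<Psi>]]
        continuous_intros) auto
  \<comment> \<open>The 2 compensates for the 1/2 in \<open>dbar_z\<close>. The factor
    \<open>s\<close> in the primitive kills the boundary term at 0, and the value at 1 is the
    claim.\<close>
  have "((\<lambda>s. \<Psi> 1 s z + \<i> * \<Psi> \<i> s z) has_integral 2 * (of_real 1 * P 1 z * K 1 z) - 2 * (of_real 0 * P 0 z * K 0 z)) {0..1}"
  proof (rule fundamental_theorem_of_calculus)
    fix s :: real assume s: "s \<in> {0..1}"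
    then have sx: "s * x < 1" using scaled_norm_less_1 z by (simp add: x_def)
    have "((\<lambda>s. (1 - s * x) powr \<alpha>) has_real_derivative \<alpha> * (1 - s * x) powr (\<alpha> - 1) * (- x)) (at s)"
      using sx by (auto intro!: derivative_eq_intros)
    then have dPs: "((\<lambda>s. P s z) has_vector_derivative of_real (\<alpha> * (1 - s * x) powr (\<alpha> - 1) * (- x))) (at s)"
      unfolding P_def x_def
      by (rule has_vector_derivative_of_real)
    have 1: "((\<lambda>s. complex_of_real s * cnj z) has_vector_derivative cnj z) (at s)"
      by (auto intro!: derivative_eq_intros)
    have 2: "(G has_field_derivative deriv G (of_real s * cnj z)) (at (of_real s * cnj z))"
      using G scaled_cnj_in_ball[OF s z] by (intro holomorphic_derivI) auto
    from field_vector_diff_chain_at[OF 1 2]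
    have dKs: "((\<lambda>s. K s z) has_vector_derivative cnj z * deriv G (of_real s * cnj z)) (at s)"
      by (simp add: K_def o_def)
    have ds: "((\<lambda>s. complex_of_real s) has_vector_derivative 1) (at s)"
      by (auto intro!: derivative_eq_intros)
    have n2: "complex_of_real x = z * cnj z" unfolding x_def by (rule complex_norm_square)
    have "((\<lambda>s. 2 * (of_real s * P s z * K s z)) has_vector_derivative
       2 * (of_real s * P s z * (cnj z * deriv G (of_real s * cnj z)) +
        (of_real s * of_real (\<alpha> * (1 - s * x) powr (\<alpha> - 1) * (- x)) + 1 * P s z) * K s z)) (at s)"
      by (intro has_vector_derivative_mult_right has_vector_derivative_mult dPs dKs ds)
    \<comment> \<open>In the combination of the directions 1 and \<open>\<i>\<close> the coefficient
      \<open>cnj e\<close> contributes 2 and the coefficient \<open>e\<close> contributes 0.\<close>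
    also have "2 * (of_real s * P s z * (cnj z * deriv G (of_real s * cnj z)) +
        (of_real s * of_real (\<alpha> * (1 - s * x) powr (\<alpha> - 1) * (- x)) + 1 * P s z) * K s z)
       = \<Psi> 1 s z + \<i> * \<Psi> \<i> s z"
      by (simp add: \<Psi>_def dP_def dK_def n2 x_def[symmetric] algebra_simps)
    finally show "((\<lambda>s. 2 * (of_real s * P s z * K s z)) has_vector_derivative \<Psi> 1 s z + \<i> * \<Psi> \<i> s z) (at s within {0..1})"
      by (rule has_vector_derivative_at_within)
  qed simp
  then have "integral {0..1} (\<lambda>s. \<Psi> 1 s z + \<i> * \<Psi> \<i> s z) = 2 * (P 1 z * K 1 z)"
    by (simp add: integral_unique)
  moreover have "integral {0..1} (\<lambda>s. \<Psi> 1 s z + \<i> * \<Psi> \<i> s z) =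
      integral {0..1} (\<lambda>s. \<Psi> 1 s z) + \<i> * integral {0..1} (\<lambda>s. \<Psi> \<i> s z)"
    using int by (subst integral_add) (auto intro: integrable_on_mult_right)
  ultimately show ?thesis
    by (intro dbar_z_eqI[OF pa pa]) (simp add: P_def K_def)
qed

section \<open>The splitting of \<alpha>-harmonic functions into a holomorphic part and
  \<open>anti_part\<close>\<close>

lemma Ck_on_Suc_has_partial:
  assumes "Ck_on (Suc n) S f" "e \<in> {1, \<i>}" "z \<in> S"
  shows "has_partial e f (partial_deriv e f z) z"
  using assms by (intro has_partial_partial_deriv) auto

lemma Ck_on_Suc_continuous_partial:
  assumes "Ck_on (Suc n) S f" "e \<in> {1, \<i>}"
  shows "continuous_on S (partial_deriv e f)"
  using assms by (cases n) auto

lemma d_z_cong: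
  assumes "open S" "z \<in> S" "\<And>w. w \<in> S \<Longrightarrow> f w = g w" "has_partial_at 1 f z" "has_partial_at \<i> f z"
  shows "d_z g z = d_z f z"
  using has_partial_imp(2)[OF has_partial_transform_open[OF has_partial_partial_deriv[OF assms(4)] assms(1-3)]]
    has_partial_imp(2)[OF has_partial_transform_open[OF has_partial_partial_deriv[OF assms(5)] assms(1-3)]]
  by (simp add: d_z_def)

text \<open>\<open>dbar_z\<close> annihilates \<open>h\<close>, and the weight cancels the power
  found in \<open>dbar_anti_part\<close>; what remains, \<open>G (cnj z)\<close>, is annihilated by
  \<open>d_z\<close>.\<close>

lemma alpha_harmonicI:
  assumes h: "h holomorphic_on ball 0 1" and G: "G holomorphic_on ball 0 1"
    and u: "\<And>z. z \<in> ball 0 1 \<Longrightarrow> u z = h z + anti_part \<alpha> G z"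
  shows "alpha_harmonic \<alpha> u"
proof -
  have dbar: "dbar_z u z = of_real ((1 - (cmod z)\<^sup>2) powr \<alpha>) * G (cnj z)" if z: "z \<in> ball 0 1" for z
  proof -
    note hp = has_partial_holomorphic[OF h z]
    have ap: "has_partial e (anti_part \<alpha> G) (partial_deriv e (anti_part \<alpha> G) z) z" if "e \<in> {1, \<i>}" for e
      using anti_part_Ck[OF G] that z by (rule Ck_on_Suc_has_partial)
    have "has_partial e u (e * deriv h z + partial_deriv e (anti_part \<alpha> G) z) z" if "e \<in> {1, \<i>}" for e
      by (rule has_partial_transform_open[OF has_partial_add[OF hp ap[OF that]] open_ball z]) (simp add: u)
    note p = this[of 1] this[of \<i>]
    show ?thesis
      by (rule dbar_z_eqI[OF p])
         (use dbar_anti_part[OF G z, of \<alpha>] in \<open>auto simp: dbar_z_def algebra_simps\<close>)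
  qed
  have "joint_Ck 2 (\<lambda>_ z. h z + anti_part \<alpha> G z)"
    by (intro joint_Ck_add joint_Ck_holomorphic h joint_Ck_of_Ck_on anti_part_Ck G)
  then have "Ck_on 2 (ball 0 1) (\<lambda>z. h z + anti_part \<alpha> G z)" unfolding Ck_on_iff_joint .
  then have "Ck_on 2 (ball 0 1) u" by (rule Ck_on_cong[OF open_ball, rotated]) (simp add: u)
  moreover have "d_z (\<lambda>w. of_real ((1 - (cmod w)\<^sup>2) powr (-\<alpha>)) * dbar_z u w) z = 0" if z: "z \<in> ball 0 1" for z
  proof -
    have p: "has_partial e (\<lambda>w. G (cnj w)) (cnj e * deriv G (cnj z)) z" for e
      using has_partial_cnj_comp[OF G z, of 1 e] by simp
    have "d_z (\<lambda>w. of_real ((1 - (cmod w)\<^sup>2) powr (-\<alpha>)) * dbar_z u w) z = d_z (\<lambda>w. G (cnj w)) z"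
    proof (rule d_z_cong[OF open_ball z])
      fix w :: complex assume w: "w \<in> ball 0 1"
      then have "(1 - (cmod w)\<^sup>2) > 0" by (auto simp: abs_square_less_1)
      then show "G (cnj w) = of_real ((1 - (cmod w)\<^sup>2) powr (-\<alpha>)) * dbar_z u w"
        by (simp add: dbar[OF w] powr_minus mult.assoc[symmetric] flip: of_real_mult)
    qed (use has_partial_imp(1)[OF p] in auto)
    also have "\<dots> = 0" by (simp add: d_z_def has_partial_imp(2)[OF p])
    finally show ?thesis .
  qed
  ultimately show ?thesis unfolding alpha_harmonic_def by blast
qed

lemma has_partial_uminus_dir:
  assumes "has_partial e f D z"
  shows "has_partial (- e) f (- D) z"
proof -
  have 1: "((\<lambda>t::real. - t) has_vector_derivative -1) (at 0)"
    by (auto intro!: derivative_eq_intros)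
  have "((\<lambda>t. f (z + t *\<^sub>R e)) has_vector_derivative D) (at (- 0))"
    using assms unfolding has_partial_def by simp
  from vector_diff_chain_at[OF 1 this] show ?thesis
    unfolding has_partial_def by (simp add: o_def)
qed

lemma has_partial_comp_cnj:
  assumes "has_partial (cnj e) f D (cnj z)"
  shows "has_partial e (\<lambda>w. f (cnj w)) D z"
  using assms unfolding has_partial_def by simp

text \<open>Two derivatives of \<open>u\<close> leave one for the weighted function
  \<open>\<phi>\<close>, and \<open>d_z \<phi> = 0\<close> is the Cauchy-Riemann equation for
  \<open>\<phi>\<close> composed with conjugation. Subtracting the particular solution
  \<open>anti_part\<close> leaves a function with vanishing \<open>dbar_z\<close>.\<close>

lemma alpha_harmonicE:
  assumes "alpha_harmonic \<alpha> u"
  obtains h G where "h holomorphic_on ball 0 1" "G holomorphic_on ball 0 1"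
    "\<And>z. z \<in> ball 0 1 \<Longrightarrow> u z = h z + anti_part \<alpha> G z"
proof -
  define \<phi> where "\<phi> w = of_real ((1 - (cmod w)\<^sup>2) powr (-\<alpha>)) * dbar_z u w" for w
  define G where "G w = \<phi> (cnj w)" for w
  have C2: "Ck_on (Suc (Suc 0)) (ball 0 1) u"
    and dz: "\<And>z. z \<in> ball 0 1 \<Longrightarrow> d_z \<phi> z = 0"
    using assms unfolding alpha_harmonic_def \<phi>_def by (auto simp: numeral_2_eq_2)
  have jp: "joint_Ck (Suc 0) (\<lambda>_. partial_deriv e u)" if "e \<in> {1, \<i>}" for e
    using C2 that by (intro joint_Ck_of_Ck_on) auto
  have jn: "joint_Ck n (\<lambda>_ z. of_real ((1 - (cmod z)\<^sup>2) powr \<beta>))" for n \<beta>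
    using joint_Ck_freeze[OF joint_Ck_norm_powr[of n \<beta>], of 1] by simp
  have "joint_Ck (Suc 0) (\<lambda>_ w. of_real ((1 - (cmod w)\<^sup>2) powr (-\<alpha>)) *
      ((1 / 2) * (partial_deriv 1 u w + \<i> * partial_deriv \<i> u w)))"
    by (intro joint_Ck_mult joint_Ck_add joint_Ck_const jn jp) auto
  moreover have "(\<lambda>_ w. of_real ((1 - (cmod w)\<^sup>2) powr (-\<alpha>)) *
      ((1 / 2) * (partial_deriv 1 u w + \<i> * partial_deriv \<i> u w))) = (\<lambda>_::real. \<phi>)"
    by (simp add: \<phi>_def dbar_z_def fun_eq_iff)
  ultimately have C\<phi>: "Ck_on (Suc 0) (ball 0 1) \<phi>" by (simp only: Ck_on_iff_joint)
  have cnj_c: "continuous_on (ball 0 1) (\<lambda>w. partial_deriv e \<phi> (cnj w))" if "e \<in> {1, \<i>}" for e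
    by (rule continuous_on_compose2[OF Ck_on_Suc_continuous_partial[OF C\<phi> that]])
       (auto intro!: continuous_intros)
  \<comment> \<open>Conjugation reverses the direction \<open>\<i>\<close>, hence the sign of the
    vertical derivative.\<close>
  have G: "G holomorphic_on ball 0 1"
  proof (rule Cauchy_Riemann_imp_holomorphic[where
        D = "\<lambda>e w. if e = 1 then partial_deriv 1 \<phi> (cnj w) else - partial_deriv \<i> \<phi> (cnj w)"])
    show "continuous_on (ball 0 1) (\<lambda>w. if e = 1 then partial_deriv 1 \<phi> (cnj w) else - partial_deriv \<i> \<phi> (cnj w))" for e
      using cnj_c[of 1] cnj_c[of \<i>] by (cases "e = 1") (auto intro!: continuous_intros)
    fix z :: complex assume z: "z \<in> ball 0 1"
    then have z': "cnj z \<in> ball 0 1" by simp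
    show "has_partial e G (if e = 1 then partial_deriv 1 \<phi> (cnj z) else - partial_deriv \<i> \<phi> (cnj z)) z"
      if "e \<in> {1, \<i>}" for e
      unfolding G_def
      using that Ck_on_Suc_has_partial[OF C\<phi> _ z', of 1]
        has_partial_uminus_dir[OF Ck_on_Suc_has_partial[OF C\<phi> _ z', of \<i>]]
      by (intro has_partial_comp_cnj) auto
    show "(if 1 = (1::complex) then partial_deriv 1 \<phi> (cnj z) else - partial_deriv \<i> \<phi> (cnj z)) +
      \<i> * (if \<i> = 1 then partial_deriv 1 \<phi> (cnj z) else - partial_deriv \<i> \<phi> (cnj z)) = 0"
      using dz[OF z'] by (simp add: d_z_def)
  qed
  have "(\<lambda>z. u z - anti_part \<alpha> G z) holomorphic_on ball 0 1"
  proof (rule Cauchy_Riemann_imp_holomorphic[where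
        D = "\<lambda>e z. partial_deriv e u z - partial_deriv e (anti_part \<alpha> G) z"])
    show "continuous_on (ball 0 1) (\<lambda>z. partial_deriv e u z - partial_deriv e (anti_part \<alpha> G) z)"
      if "e \<in> {1, \<i>}" for e
      using Ck_on_Suc_continuous_partial[OF C2 that]
        Ck_on_Suc_continuous_partial[OF anti_part_Ck[OF G, of "Suc 0"] that] by (intro continuous_intros)
    fix z :: complex assume z: "z \<in> ball 0 1"
    show "has_partial e (\<lambda>z. u z - anti_part \<alpha> G z) (partial_deriv e u z - partial_deriv e (anti_part \<alpha> G) z) z"
      if "e \<in> {1, \<i>}" for e
      using Ck_on_Suc_has_partial[OF C2 that z] Ck_on_Suc_has_partial[OF anti_part_Ck[OF G, of "Suc 0"] that z]
      by (rule has_partial_diff)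
    have "(1 - (cmod z)\<^sup>2) > 0" using z by (auto simp: abs_square_less_1)
    then have "dbar_z u z = of_real ((1 - (cmod z)\<^sup>2) powr \<alpha>) * G (cnj z)"
      by (simp add: G_def \<phi>_def powr_minus mult.assoc[symmetric] flip: of_real_mult)
    then have "dbar_z u z = dbar_z (anti_part \<alpha> G) z" by (simp add: dbar_anti_part[OF G z])
    then have "partial_deriv 1 u z + \<i> * partial_deriv \<i> u z =
        partial_deriv 1 (anti_part \<alpha> G) z + \<i> * partial_deriv \<i> (anti_part \<alpha> G) z"
      unfolding dbar_z_def by (metis divide_cancel_right zero_neq_numeral)
    then show "partial_deriv 1 u z - partial_deriv 1 (anti_part \<alpha> G) z +
       \<i> * (partial_deriv \<i> u z - partial_deriv \<i> (anti_part \<alpha> G) z) = 0"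
      by (simp add: algebra_simps)
  qed
  with G show ?thesis by (intro that[of "\<lambda>z. u z - anti_part \<alpha> G z" G]) auto
qed

section \<open>The series expansion\<close>

text \<open>The factor \<open>Suc k\<close> in the coefficients of \<open>G\<close> is the one of
  the weight in \<open>radial_has_integral\<close>. Sum and integral are interchanged by means of
  the majorant \<open>M\<close>, which is uniform in \<open>s\<close> and valid for either sign of
  \<alpha>.\<close>

lemma anti_part_sums:
  assumes G: "\<And>w. w \<in> ball 0 1 \<Longrightarrow> (\<lambda>k. a k * of_nat (Suc k) * w ^ k) sums G w"
    and z: "z \<in> ball 0 1"
  shows "(\<lambda>k. a k * of_real (radial \<alpha> k ((cmod z)\<^sup>2)) * cnj z ^ Suc k) sums anti_part \<alpha> G z"
proof -
  define x where "x = (cmod z)\<^sup>2"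
  have x: "0 \<le> x" "x < 1" using z by (auto simp: x_def abs_square_less_1)
  define f where "f k s = cnj z * (of_real ((1 - s * x) powr \<alpha>) * (a k * of_nat (Suc k) * (of_real s * cnj z) ^ k))" for k s
  define M where "M k = (1 - x) powr (- \<bar>\<alpha>\<bar>) * cmod (a k * of_nat (Suc k) * of_real (cmod z) ^ k)" for k
  have fM: "cmod (f k s) \<le> M k" if s: "s \<in> {0..1}" for k s
  proof -
    have le: "cmod (of_real s * cnj z) \<le> cmod z"
      using s mult_left_le_one_le[of "cmod z" s] by (auto simp: norm_mult)
    have "cmod (f k s) = cmod z * ((1 - s * x) powr \<alpha> * (cmod (a k * of_nat (Suc k)) * cmod (of_real s * cnj z) ^ k))"
      unfolding f_def norm_mult norm_power norm_of_real complex_mod_cnj by simp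
    also have "\<dots> \<le> 1 * ((1 - x) powr (- \<bar>\<alpha>\<bar>) * (cmod (a k * of_nat (Suc k)) * cmod z ^ k))"
      using z le s by (intro mult_mono powr_bounds x power_mono) auto
    also have "\<dots> = M k" unfolding M_def norm_mult norm_power by simp
    finally show ?thesis .
  qed
  have "cmod z < 1" using z by simp
  \<comment> \<open>Convergence at the larger radius \<open>w\<close> gives absolute convergence at
    \<open>cmod z\<close>.\<close>
  from dense[OF this] obtain w where w: "cmod z < w" "w < 1" by blast
  have "w > 0" using order.strict_trans1[OF norm_ge_zero w(1)] .
  have "summable (\<lambda>k. a k * of_nat (Suc k) * of_real w ^ k)"
    using G[of "of_real w"] w \<open>w > 0\<close> by (intro sums_summable) auto
  then have "summable (\<lambda>k. cmod (a k * of_nat (Suc k) * of_real (cmod z) ^ k))"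
    using w \<open>w > 0\<close> by (intro powser_insidea) auto
  then have "summable M" unfolding M_def by (rule summable_mult)
  then have "uniform_limit {0..1} (\<lambda>n s. \<Sum>k<n. f k s) (\<lambda>s. suminf (\<lambda>k. f k s)) sequentially"
    using fM by (intro Weierstrass_m_test)
  moreover have "1 - s * x \<noteq> 0" if "s \<in> {0..1}" for s
    using scaled_norm_less_1[OF that z] by (simp add: x_def)
  then have "continuous_on {0..1} (\<lambda>s. \<Sum>k<n. f k s)" for n
    unfolding f_def by (intro continuous_intros) auto
  ultimately obtain I J where IJ: "\<And>n. ((\<lambda>s. \<Sum>k<n. f k s) has_integral I n) {0..1}"
    "((\<lambda>s. suminf (\<lambda>k. f k s)) has_integral J) {0..1}" "I \<longlonglongrightarrow> J"
    by (rule uniform_limit_integral) (auto simp: trivial_limit_sequentially)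
  have "suminf (\<lambda>k. f k s) = cnj z * (of_real ((1 - s * (cmod z)\<^sup>2) powr \<alpha>) * G (of_real s * cnj z))"
    if "s \<in> {0..1}" for s
    unfolding f_def x_def
    by (intro sums_unique[symmetric] sums_mult G scaled_cnj_in_ball z that)
  with IJ(2) have J: "J = anti_part \<alpha> G z"
    unfolding anti_part_def by (metis (no_types, lifting) Henstock_Kurzweil_Integration.integral_cong integral_unique)
  have "(f k has_integral a k * of_real (radial \<alpha> k x) * cnj z ^ Suc k) {0..1}" for k
  proof -
    have "((\<lambda>s. a k * cnj z ^ Suc k * of_real (real (Suc k) * s ^ k * (1 - s * x) powr \<alpha>)) has_integral
       (a k * cnj z ^ Suc k * of_real (radial \<alpha> k x))) {0..1}"
      using has_integral_linear[OF radial_has_integral[OF x] bounded_linear_of_real]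
      by (intro has_integral_mult_right) (simp add: o_def)
    moreover have "a k * cnj z ^ Suc k * of_real (real (Suc k) * s ^ k * (1 - s * x) powr \<alpha>) = f k s" for s
      unfolding f_def by (simp add: power_mult_distrib mult_ac)
    ultimately show ?thesis by (simp add: mult_ac)
  qed
  then have "((\<lambda>s. \<Sum>k<n. f k s) has_integral (\<Sum>k<n. a k * of_real (radial \<alpha> k x) * cnj z ^ Suc k)) {0..1}" for n
    by (intro has_integral_sum) auto
  then have "I = (\<lambda>n. \<Sum>k<n. a k * of_real (radial \<alpha> k x) * cnj z ^ Suc k)"
    using IJ(1) has_integral_unique by blast
  then show ?thesis using IJ(3) unfolding sums_def J x_def by simp
qed

lemma has_alpha_expansion_iff:
  "has_alpha_expansion \<alpha> u c \<longleftrightarrow> subexp c \<and> (\<forall>z\<in>ball 0 1. \<exists>a b.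
    (\<lambda>k. c (int k) * z ^ k) sums a \<and>
    (\<lambda>k. c (- int (Suc k)) * of_real (radial \<alpha> k ((cmod z)\<^sup>2)) * cnj z ^ Suc k) sums b \<and> u z = a + b)"
  unfolding has_alpha_expansion_def Limsup_root_le_1_iff_subexp radial_def ..

lemma subexp_series:
  assumes "subexp c"
  shows "(\<lambda>z. \<Sum>k. c (int k) * z ^ k) holomorphic_on ball 0 1"
    and "z \<in> ball 0 1 \<Longrightarrow> (\<lambda>k. c (int k) * z ^ k) sums (\<Sum>k. c (int k) * z ^ k)"
    and "(\<lambda>w. \<Sum>k. c (- int (Suc k)) * of_nat (Suc k) * w ^ k) holomorphic_on ball 0 1"
    and "z \<in> ball 0 1 \<Longrightarrow> (\<lambda>k. c (- int (Suc k)) * of_nat (Suc k) * z ^ k) sums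
           (\<Sum>k. c (- int (Suc k)) * of_nat (Suc k) * z ^ k)"
proof -
  have p: "(\<lambda>k. c (int k) * z ^ k) sums (\<Sum>k. c (int k) * z ^ k)" if "z \<in> ball 0 1" for z
  proof (rule summable_sums[OF summable_norm_cancel])
    show "summable (\<lambda>k. cmod (c (int k) * z ^ k))"
      using that summable_of_subexp[OF assms, of int "cmod z"] by (simp add: norm_mult norm_power)
  qed
  \<comment> \<open>Up to sign, the factor \<open>Suc k\<close> of the second series is the index
    itself, and polynomial factors preserve subexponential growth.\<close>
  have "poly_bounded (\<lambda>k. of_int k)"
    unfolding poly_bounded_def by (intro exI[of _ 1]) auto
  from subexp_mult[OF assms poly_bounded_imp_subexp[OF this]]
  have s: "subexp (\<lambda>k. c k * of_int k)" .
  have m: "(\<lambda>k. c (- int (Suc k)) * of_nat (Suc k) * z ^ k) sums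
      (\<Sum>k. c (- int (Suc k)) * of_nat (Suc k) * z ^ k)" if "z \<in> ball 0 1" for z
  proof (rule summable_sums[OF summable_norm_cancel])
    have "cmod (c (- int (Suc k)) * of_nat (Suc k) * z ^ k) =
        cmod (c (- int (Suc k)) * of_int (- int (Suc k))) * cmod z ^ k" for k
      by (simp only: norm_mult norm_power of_int_minus norm_minus_cancel of_int_of_nat_eq)
    moreover have "summable (\<lambda>k. cmod (c (- int (Suc k)) * of_int (- int (Suc k))) * cmod z ^ k)"
      using that by (intro summable_of_subexp[OF s, of "\<lambda>k. - int (Suc k)"]) auto
    ultimately show "summable (\<lambda>k. cmod (c (- int (Suc k)) * of_nat (Suc k) * z ^ k))" by simp
  qed
  show "(\<lambda>z. \<Sum>k. c (int k) * z ^ k) holomorphic_on ball 0 1"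
    using p by (intro power_series_holomorphic[of 0 1 "\<lambda>k. c (int k)"]) auto
  show "(\<lambda>w. \<Sum>k. c (- int (Suc k)) * of_nat (Suc k) * w ^ k) holomorphic_on ball 0 1"
    using m by (intro power_series_holomorphic[of 0 1 "\<lambda>k. c (- int (Suc k)) * of_nat (Suc k)"]) auto
  show "(\<lambda>k. c (int k) * z ^ k) sums (\<Sum>k. c (int k) * z ^ k)" if "z \<in> ball 0 1" using p[OF that] .
  show "(\<lambda>k. c (- int (Suc k)) * of_nat (Suc k) * z ^ k) sums
      (\<Sum>k. c (- int (Suc k)) * of_nat (Suc k) * z ^ k)" if "z \<in> ball 0 1" using m[OF that] .
qed

lemma powser_bounded:
  fixes a :: "nat \<Rightarrow> complex"
  assumes "summable (\<lambda>k. a k * of_real r ^ k)" "0 \<le> r"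
  shows "\<exists>C. \<forall>k. cmod (a k) * r ^ k \<le> C"
proof -
  have "Bseq (\<lambda>k. a k * of_real r ^ k)"
    by (rule convergent_imp_Bseq[OF convergentI[OF summable_LIMSEQ_zero[OF assms(1)]]])
  then obtain K where "\<forall>k. cmod (a k * of_real r ^ k) \<le> K"
    unfolding Bseq_def by (elim exE conjE) (rule that)
  then show ?thesis using assms(2) by (intro exI[of _ K]) (simp add: norm_mult norm_power)
qed

lemma alpha_harmonic_iff_expansion:
  "alpha_harmonic \<alpha> u \<longleftrightarrow> (\<exists>c. has_alpha_expansion \<alpha> u c)"
proof
  assume "\<exists>c. has_alpha_expansion \<alpha> u c"
  then obtain c where "has_alpha_expansion \<alpha> u c" ..
  note c = this[unfolded has_alpha_expansion_iff, THEN conjunct1]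
    and u = this[unfolded has_alpha_expansion_iff, THEN conjunct2, THEN bspec]
  note s = subexp_series[OF c]
  show "alpha_harmonic \<alpha> u"
  proof (rule alpha_harmonicI[OF s(1,3)])
    fix z :: complex assume z: "z \<in> ball 0 1"
    obtain a b where ab: "(\<lambda>k. c (int k) * z ^ k) sums a"
      "(\<lambda>k. c (- int (Suc k)) * of_real (radial \<alpha> k ((cmod z)\<^sup>2)) * cnj z ^ Suc k) sums b" "u z = a + b"
      using u[OF z] by (elim exE conjE) (rule that)
    show "u z = (\<Sum>k. c (int k) * z ^ k) +
        anti_part \<alpha> (\<lambda>w. \<Sum>k. c (- int (Suc k)) * of_nat (Suc k) * w ^ k) z"
      using sums_unique2[OF ab(1) s(2)[OF z]] sums_unique2[OF ab(2) anti_part_sums[OF s(4) z]] ab(3) by simp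
  qed
next
  assume "alpha_harmonic \<alpha> u"
  then obtain h G where h: "h holomorphic_on ball 0 1" and G: "G holomorphic_on ball 0 1"
    and u: "\<And>z. z \<in> ball 0 1 \<Longrightarrow> u z = h z + anti_part \<alpha> G z"
    by (rule alpha_harmonicE) (rule that)
  define a where "a n = (deriv ^^ n) h 0 / fact n" for n
  \<comment> \<open>\<open>anti_part_sums\<close> expects the coefficients of \<open>G\<close> with
    the factor \<open>Suc n\<close> split off.\<close>
  define b where "b n = (deriv ^^ n) G 0 / fact n / of_nat (Suc n)" for n
  define c where "c k = (if k \<ge> 0 then a (nat k) else b (nat (- k) - 1))" for k :: int
  have c_simps [simp]: "c (int k) = a k" "c (- int (Suc k)) = b k" for k by (auto simp: c_def nat_add_distrib)
  have a: "(\<lambda>k. a k * z ^ k) sums h z" if "z \<in> ball 0 1" for z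
    using holomorphic_power_series[OF h that] by (simp add: a_def)
  have b: "(\<lambda>k. b k * of_nat (Suc k) * z ^ k) sums G z" if "z \<in> ball 0 1" for z
    using holomorphic_power_series[OF G that] by (simp add: b_def del: of_nat_Suc)
  have "subexp c" unfolding subexp_def
  proof
    fix r :: real assume r: "r \<in> {0<..<1}"
    then have "\<exists>C. \<forall>k. cmod (a k) * r ^ k \<le> C"
      using a[of "of_real r"] by (intro powser_bounded sums_summable) auto
    then obtain A where A: "\<And>k. cmod (a k) * r ^ k \<le> A" by blast
    have "\<exists>C. \<forall>k. cmod (b k * of_nat (Suc k)) * r ^ k \<le> C"
      using r b[of "of_real r"] by (intro powser_bounded sums_summable) auto
    then obtain B where B: "\<And>k. cmod (b k * of_nat (Suc k)) * r ^ k \<le> B" by blast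
    \<comment> \<open>The index \<open>- (k + 1)\<close> has modulus \<open>k + 1\<close>; the
      additional power of \<open>r\<close> and the dropped factor \<open>Suc k\<close> both go in
      the right direction.\<close>
    have B': "cmod (b k) * r ^ Suc k \<le> B" for k
    proof -
      have "cmod (b k) * r ^ Suc k \<le> cmod (b k * of_nat (Suc k)) * r ^ k"
        unfolding norm_mult norm_of_nat using r
        by (intro mult_mono power_decreasing) (auto simp: mult_le_cancel_left1)
      then show ?thesis using B[of k] by linarith
    qed
    have "cmod (c k) * r ^ nat \<bar>k\<bar> \<le> max A B" for k
    proof (cases k rule: int_cases)
      case (nonneg n)
      then show ?thesis using A[of n] by (simp add: max.coboundedI1)
    next
      case (neg n)
      have "nat \<bar>k\<bar> = Suc n" "c k = b n" unfolding neg by (simp, rule c_simps)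
      then show ?thesis using B'[of n] by (simp add: max.coboundedI2)
    qed
    then show "\<exists>C. \<forall>k. cmod (c k) * r ^ nat \<bar>k\<bar> \<le> C" by blast
  qed
  moreover have "\<exists>p q. (\<lambda>k. c (int k) * z ^ k) sums p \<and>
    (\<lambda>k. c (- int (Suc k)) * of_real (radial \<alpha> k ((cmod z)\<^sup>2)) * cnj z ^ Suc k) sums q \<and> u z = p + q"
    if z: "z \<in> ball 0 1" for z
    using a[OF z] anti_part_sums[of b, OF b z] u[OF z]
    by (intro exI[of _ "h z"] exI[of _ "anti_part \<alpha> G z"]) (simp del: of_nat_Suc)
  ultimately have "has_alpha_expansion \<alpha> u c" unfolding has_alpha_expansion_iff by (intro conjI ballI)
  then show "\<exists>c. has_alpha_expansion \<alpha> u c" by (rule exI[of _ c])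
qed

section \<open>The expansion of the Poisson kernel\<close>

text \<open>For negative indices these are the Taylor coefficients of
  \<open>(1 - w)^(-\<alpha>-1)\<close>. They vanish exactly when \<alpha> is a negative integer and
  the index is at most \<alpha>; for all other \<alpha> the spectrum of the kernel is the whole of
  the integers.\<close>

definition kernel_coeff :: "real \<Rightarrow> int \<Rightarrow> complex" where
  "kernel_coeff \<alpha> k =
     (if k \<ge> 0 then 1 else of_real (pochhammer (\<alpha> + 1) (nat (- k)) / fact (nat (- k))))"

lemma kernel_coeff_simps:
  "kernel_coeff \<alpha> (int k) = 1"
  "kernel_coeff \<alpha> (- int (Suc k)) = of_real (pochhammer (\<alpha> + 1) (Suc k) / fact (Suc k))"
  unfolding kernel_coeff_def by (simp_all add: nat_add_distrib del: fact_Suc)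

section \<open>Polynomial growth of the kernel coefficients and of their inverses\<close>

lemma pochhammer_fact_Suc:
  "pochhammer (a + 1) (Suc n) / fact (Suc n) = pochhammer (a + 1) n / fact n * (1 + a / real (Suc n))"
  by (simp add: pochhammer_Suc divide_simps)

lemma one_plus_mult_step: "(1 + real n) * (1 + 1 / real (Suc n)) = 1 + real (Suc n)"
  by (simp add: field_simps)

text \<open>The quotient of consecutive terms is \<open>1 + a / n\<close>. By Bernoulli's inequality
  its modulus is at most \<open>(1 + 1 / n)^M\<close>, and the product of these bounds telescopes by
  \<open>one_plus_mult_step\<close>.\<close>

lemma pochhammer_fact_le:
  assumes "\<bar>a\<bar> \<le> real M"
  shows "\<bar>pochhammer (a + 1) n / fact n\<bar> \<le> (1 + real n) ^ M"
proof (induction n)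
  case (Suc n)
  have "\<bar>1 + a / real (Suc n)\<bar> \<le> 1 + \<bar>a / real (Suc n)\<bar>" by linarith
  also have "\<dots> \<le> 1 + real M * (1 / real (Suc n))" using assms by (simp add: divide_right_mono)
  also have "\<dots> \<le> (1 + 1 / real (Suc n)) ^ M"
    by (intro Bernoulli_inequality) (auto intro: order.trans[of _ 0])
  finally have *: "\<bar>1 + a / real (Suc n)\<bar> \<le> (1 + 1 / real (Suc n)) ^ M" .
  have "\<bar>pochhammer (a + 1) (Suc n) / fact (Suc n)\<bar>
      = \<bar>pochhammer (a + 1) n / fact n\<bar> * \<bar>1 + a / real (Suc n)\<bar>"
    unfolding pochhammer_fact_Suc abs_mult ..
  also have "\<dots> \<le> (1 + real n) ^ M * (1 + 1 / real (Suc n)) ^ M"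
    by (intro mult_mono Suc *) auto
  also have "\<dots> = (1 + real (Suc n)) ^ M"
    unfolding power_mult_distrib[symmetric] one_plus_mult_step ..
  finally show ?case .
qed simp

text \<open>The argument for the upper bound works for the inverse quotients as soon as
  \<open>t = |a| / n\<close> is at most 1/2, because then \<open>1 / (1 - t) \<le> 1 + 2 t\<close>.
  The terms before that go into \<open>D\<close>. Vanishing terms are harmless, since
  \<open>inverse 0 = 0\<close>.\<close>

lemma pochhammer_fact_inverse_le:
  obtains D M where "\<And>n. \<bar>inverse (pochhammer (a + 1) n / fact n)\<bar> \<le> D * (1 + real n) ^ M"
proof -
  define q where "q n = \<bar>inverse (pochhammer (a + 1) n / fact n)\<bar>" for n
  \<comment> \<open>The 2 serves twice: beyond \<open>M\<close> it gives \<open>t \<le> 1/2\<close>,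
    and it bounds the increment \<open>2 t\<close> by \<open>M / n\<close>.\<close>
  obtain M :: nat where M: "2 * \<bar>a\<bar> \<le> real M" using real_arch_simple by blast
  define D where "D = (\<Sum>n\<le>M. q n)"
  have q0: "q n \<ge> 0" for n by (simp add: q_def)
  have "q n \<le> D * (1 + real n) ^ M" for n
  proof (induction n)
    case 0
    have "q 0 \<le> D" unfolding D_def by (intro member_le_sum) (auto simp: q0)
    then show ?case by simp
  next
    case (Suc n)
    show ?case
    proof (cases "Suc n \<le> M")
      case True
      then have "q (Suc n) \<le> D" unfolding D_def by (intro member_le_sum) (auto simp: q0)
      also have "\<dots> * 1 \<le> D * (1 + real (Suc n)) ^ M"
        using q0 by (intro mult_left_mono one_le_power) (auto simp: D_def sum_nonneg)
      finally show ?thesis by simp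
    next
      case False
      define t where "t = \<bar>a\<bar> / real (Suc n)"
      have "2 * \<bar>a\<bar> / real (Suc n) \<le> real M / real (Suc n)"
        using M by (intro divide_right_mono) auto
      moreover have "2 * \<bar>a\<bar> \<le> real (Suc n)" using M False by linarith
      ultimately have t: "0 \<le> t" "2 * t \<le> real M * (1 / real (Suc n))" "t \<le> 1 / 2"
        by (simp_all add: t_def)
      have "\<bar>a / real (Suc n)\<bar> = t" by (simp add: t_def)
      then have "1 - t \<le> \<bar>1 + a / real (Suc n)\<bar>" by linarith
      then have "inverse \<bar>1 + a / real (Suc n)\<bar> \<le> inverse (1 - t)"
        using t by (intro le_imp_inverse_le) auto
      also have "\<dots> \<le> 1 + 2 * t"
      proof -
        have "t * t \<le> t * (1 / 2)" using t by (intro mult_left_mono) auto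
        then have "1 \<le> (1 + 2 * t) * (1 - t)" by (simp add: algebra_simps)
        then show ?thesis using t by (simp add: inverse_eq_divide pos_divide_le_eq)
      qed
      also have "\<dots> \<le> 1 + real M * (1 / real (Suc n))" using t by simp
      also have "\<dots> \<le> (1 + 1 / real (Suc n)) ^ M"
        by (intro Bernoulli_inequality) (auto intro: order.trans[of _ 0])
      finally have *: "inverse \<bar>1 + a / real (Suc n)\<bar> \<le> (1 + 1 / real (Suc n)) ^ M" .
      have "q (Suc n) = q n * inverse \<bar>1 + a / real (Suc n)\<bar>"
        by (simp only: q_def pochhammer_fact_Suc inverse_mult_distrib abs_mult abs_inverse)
      also have "\<dots> \<le> (D * (1 + real n) ^ M) * (1 + 1 / real (Suc n)) ^ M"
        using order.trans[OF q0 Suc] by (intro mult_mono Suc *) auto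
      also have "\<dots> = D * (1 + real (Suc n)) ^ M"
        unfolding mult.assoc power_mult_distrib[symmetric] one_plus_mult_step ..
      finally show ?thesis .
    qed
  qed
  then show ?thesis using that unfolding q_def by blast
qed

lemma kernel_coeff_poly_bounded: "poly_bounded (kernel_coeff \<alpha>)"
proof -
  obtain M :: nat where M: "\<bar>\<alpha>\<bar> \<le> real M" using real_arch_simple by blast
  have "cmod (kernel_coeff \<alpha> k) \<le> 1 * (1 + real_of_int \<bar>k\<bar>) ^ M" for k
  proof (cases "k \<ge> 0")
    case False
    then have "cmod (kernel_coeff \<alpha> k) = \<bar>pochhammer (\<alpha> + 1) (nat (- k)) / fact (nat (- k))\<bar>"
      unfolding kernel_coeff_def by (simp only: if_False norm_of_real)
    also have "\<dots> \<le> (1 + real (nat (- k))) ^ M" by (rule pochhammer_fact_le[OF M])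
    finally show ?thesis using False by simp
  qed (auto simp: kernel_coeff_def)
  then show ?thesis unfolding poly_bounded_def by blast
qed

lemma kernel_coeff_inverse_poly_bounded: "poly_bounded (\<lambda>k. inverse (kernel_coeff \<alpha> k))"
proof -
  obtain D M where M: "\<And>n. \<bar>inverse (pochhammer (\<alpha> + 1) n / fact n)\<bar> \<le> D * (1 + real n) ^ M"
    by (rule pochhammer_fact_inverse_le) (rule that)
  have "cmod (inverse (kernel_coeff \<alpha> k)) \<le> max 1 D * (1 + real_of_int \<bar>k\<bar>) ^ M" for k
  proof (cases "k \<ge> 0")
    case False
    then have "cmod (inverse (kernel_coeff \<alpha> k)) = \<bar>inverse (pochhammer (\<alpha> + 1) (nat (- k)) / fact (nat (- k)))\<bar>"
      unfolding kernel_coeff_def norm_inverse abs_inverse by (simp only: if_False norm_of_real)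
    also have "\<dots> \<le> D * (1 + real (nat (- k))) ^ M" by (rule M)
    also have "\<dots> \<le> max 1 D * (1 + real (nat (- k))) ^ M" by (intro mult_right_mono) auto
    finally show ?thesis using False by simp
  next
    case True
    have "1 * 1 \<le> max 1 D * (1 + real_of_int \<bar>k\<bar>) ^ M"
      by (intro mult_mono one_le_power) auto
    then show ?thesis using True by (simp add: kernel_coeff_def)
  qed
  then show ?thesis unfolding poly_bounded_def by blast
qed

text \<open>
  Up to the factor \<open>1 - z\<close>, the integrand of \<^const>\<open>anti_part\<close> at \<open>G w = (\<alpha> + 1) (1 - w)\<^sup>-\<^sup>\<alpha>\<^sup>-\<^sup>2\<close>
  is the derivative of \<open>(1 - s |z|\<^sup>2)\<^sup>\<alpha>\<^sup>+\<^sup>1 (1 - s cnj z)\<^sup>-\<^sup>\<alpha>\<^sup>-\<^sup>1\<close> in \<open>s\<close>.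
\<close>

lemma poisson_kernel_decomp:
  assumes z: "z \<in> ball 0 1"
  shows "poisson_kernel \<alpha> z = 1 / (1 - z) +
    anti_part \<alpha> (\<lambda>w. of_real (\<alpha> + 1) * (1 - w) powr of_real (- \<alpha> - 2)) z"
proof -
  define x where "x = (cmod z)\<^sup>2"
  have n2: "complex_of_real x = z * cnj z" unfolding x_def by (rule complex_norm_square)
  define A where "A s = (1 - s * x) powr \<alpha>" for s
  define B where "B s = (1 - of_real s * cnj z) powr complex_of_real (- \<alpha> - 2)" for s
  define T where "T s = complex_of_real ((1 - s * x) powr (\<alpha> + 1)) *
    (1 - of_real s * cnj z) powr complex_of_real (- \<alpha> - 1)" for s
  define F where "F s = cnj z * (of_real (A s) * (of_real (\<alpha> + 1) * B s))" for s
  have z1: "1 - z \<noteq> 0" using z by auto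
  have "((\<lambda>s. (1 - z) * F s) has_integral T 1 - T 0) {0..1}"
  proof (rule fundamental_theorem_of_calculus)
    fix s :: real assume s: "s \<in> {0..1}"
    have sx: "1 - s * x > 0" using scaled_norm_less_1[OF s z] by (simp add: x_def)
    \<comment> \<open>A positive real part keeps the base off the cut of the principal
      branch.\<close>
    have "Re (of_real s * cnj z) < 1"
      using scaled_cnj_in_ball[OF s z] abs_Re_le_cmod[of "of_real s * cnj z"] by auto
    then have nz: "1 - of_real s * cnj z \<notin> \<real>\<^sub>\<le>\<^sub>0"
      by (auto simp: complex_nonpos_Reals_iff)
    then have nz0: "1 - of_real s * cnj z \<noteq> 0" by auto
    have "((\<lambda>s. (1 - s * x) powr (\<alpha> + 1)) has_real_derivative (\<alpha> + 1) * A s * (- x)) (at s)"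
      using sx unfolding A_def by (auto intro!: derivative_eq_intros)
    then have d1: "((\<lambda>s. complex_of_real ((1 - s * x) powr (\<alpha> + 1))) has_vector_derivative
        of_real ((\<alpha> + 1) * A s * (- x))) (at s)"
      by (rule has_vector_derivative_of_real)
    have g: "((\<lambda>s. 1 - complex_of_real s * cnj z) has_vector_derivative - cnj z) (at s)"
      by (auto intro!: derivative_eq_intros)
    have "((\<lambda>w. w powr complex_of_real (- \<alpha> - 1)) has_field_derivative of_real (- \<alpha> - 1) * B s)
        (at (1 - of_real s * cnj z))"
    proof -
      have "complex_of_real (- \<alpha> - 1) - 1 = of_real (- \<alpha> - 2)" by simp
      then show ?thesis
        using has_field_derivative_powr[OF nz, of "complex_of_real (- \<alpha> - 1)"]
        unfolding B_def by (simp only:)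
    qed
    from field_vector_diff_chain_at[OF g this]
    have d2: "((\<lambda>s. (1 - of_real s * cnj z) powr complex_of_real (- \<alpha> - 1)) has_vector_derivative
        - cnj z * (of_real (- \<alpha> - 1) * B s)) (at s)" by (simp add: o_def)
    \<comment> \<open>With both exponents lowered by one, the two terms share the factor
      \<open>A s * B s\<close>, and the remaining bracket \<open>(1 - s x) - z (1 - s cnj z)\<close>
      is \<open>1 - z\<close>, because \<open>x = z cnj z\<close>.\<close>
    have A1: "(1 - s * x) powr (\<alpha> + 1) = A s * (1 - s * x)"
      using sx by (simp add: A_def powr_add)
    have B1: "(1 - of_real s * cnj z) powr complex_of_real (- \<alpha> - 1) = B s * (1 - of_real s * cnj z)"
    proof -
      have "complex_of_real (- \<alpha> - 1) = of_real (- \<alpha> - 2) + 1" by simp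
      then show ?thesis using nz0 unfolding B_def by (simp only: powr_add powr_to_1) 
    qed
    have "(T has_vector_derivative
      (of_real ((1 - s * x) powr (\<alpha> + 1)) * (- cnj z * (of_real (- \<alpha> - 1) * B s)) +
       of_real ((\<alpha> + 1) * A s * (- x)) * (1 - of_real s * cnj z) powr of_real (- \<alpha> - 1))) (at s)"
      unfolding T_def by (rule has_vector_derivative_mult[OF d1 d2])
    also have "(of_real ((1 - s * x) powr (\<alpha> + 1)) * (- cnj z * (of_real (- \<alpha> - 1) * B s)) +
       of_real ((\<alpha> + 1) * A s * (- x)) * (1 - of_real s * cnj z) powr of_real (- \<alpha> - 1)) = (1 - z) * F s"
      unfolding A1 B1 unfolding F_def of_real_mult of_real_minus of_real_diff n2 by (simp add: algebra_simps)
    finally show "(T has_vector_derivative (1 - z) * F s) (at s within {0..1})"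
      by (rule has_vector_derivative_at_within)
  qed simp
  from integral_unique[OF this] have "(1 - z) * integral {0..1} F = T 1 - T 0"
    by simp
  then have "(1 - z) * integral {0..1} F = T 1 - 1" by (simp add: T_def)
  then have "integral {0..1} F = (T 1 - 1) / (1 - z)" using z1 by (simp add: field_simps)
  moreover have "integral {0..1} F =
      anti_part \<alpha> (\<lambda>w. of_real (\<alpha> + 1) * (1 - w) powr of_real (- \<alpha> - 2)) z"
    by (simp add: anti_part_def F_def[abs_def] A_def B_def x_def)
  moreover have "poisson_kernel \<alpha> z = T 1 / (1 - z)"
  proof -
    have "complex_of_real (- \<alpha> - 1) = - of_real (\<alpha> + 1)" by simp
    then have "T 1 = of_real ((1 - x) powr (\<alpha> + 1)) / (1 - cnj z) powr of_real (\<alpha> + 1)"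
      unfolding T_def by (simp only: powr_minus divide_inverse mult_1 of_real_1)
    then show ?thesis by (simp add: poisson_kernel_def x_def)
  qed
  ultimately show ?thesis by (simp add: diff_divide_distrib)
qed

lemma poisson_kernel_expansion: "has_alpha_expansion \<alpha> (poisson_kernel \<alpha>) (kernel_coeff \<alpha>)"
  unfolding has_alpha_expansion_iff
proof (intro conjI ballI)
  show "subexp (kernel_coeff \<alpha>)"
    by (rule poly_bounded_imp_subexp[OF kernel_coeff_poly_bounded])
  fix z :: complex assume z: "z \<in> ball 0 1"
  have "(\<lambda>k. kernel_coeff \<alpha> (int k) * z ^ k) sums (1 / (1 - z))"
    using z geometric_sums[of z] by (simp add: kernel_coeff_simps)
  moreover have "(\<lambda>k. kernel_coeff \<alpha> (- int (Suc k)) * of_nat (Suc k) * w ^ k) sums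
      (of_real (\<alpha> + 1) * (1 - w) powr of_real (- \<alpha> - 2))" if w: "w \<in> ball 0 1" for w
  proof -
    have "(\<lambda>k. (complex_of_real (- \<alpha> - 2) gchoose k) * (- w) ^ k) sums (1 + (- w)) powr of_real (- \<alpha> - 2)"
      using w by (intro gen_binomial_complex) auto
    from sums_mult[OF this, of "of_real (\<alpha> + 1)"]
    have "(\<lambda>k. of_real (\<alpha> + 1) * ((complex_of_real (- \<alpha> - 2) gchoose k) * (- w) ^ k)) sums
      (of_real (\<alpha> + 1) * (1 - w) powr of_real (- \<alpha> - 2))" by simp
    moreover have "of_real (\<alpha> + 1) * ((complex_of_real (- \<alpha> - 2) gchoose k) * (- w) ^ k) =
        kernel_coeff \<alpha> (- int (Suc k)) * of_nat (Suc k) * w ^ k" for k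
    proof -
      have "(complex_of_real (- \<alpha> - 2) gchoose k) * (- w) ^ k = of_real (pochhammer (\<alpha> + 2) k / fact k) * w ^ k"
        by (simp add: gbinomial_pochhammer pochhammer_of_real[symmetric] power_minus[of w] add.commute)
      \<comment> \<open>The first factor \<open>\<alpha> + 1\<close> of the Pochhammer symbol is the
        constant in front of the binomial series.\<close>
      moreover have "pochhammer (\<alpha> + 1) (Suc k) / fact (Suc k) * real (Suc k) = (\<alpha> + 1) * (pochhammer (\<alpha> + 2) k / fact k)"
        using pochhammer_rec[of "\<alpha> + 1" k] by (simp add: add.assoc)
      then have "kernel_coeff \<alpha> (- int (Suc k)) * of_nat (Suc k) = of_real ((\<alpha> + 1) * (pochhammer (\<alpha> + 2) k / fact k))"
        unfolding kernel_coeff_simps by (metis of_real_mult of_real_of_nat_eq)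
      ultimately show ?thesis by simp
    qed
    ultimately show ?thesis by simp
  qed
  from anti_part_sums[OF this z]
  have "(\<lambda>k. kernel_coeff \<alpha> (- int (Suc k)) * of_real (radial \<alpha> k ((cmod z)\<^sup>2)) * cnj z ^ Suc k) sums
    anti_part \<alpha> (\<lambda>w. of_real (\<alpha> + 1) * (1 - w) powr of_real (- \<alpha> - 2)) z" .
  ultimately show "\<exists>a b. (\<lambda>k. kernel_coeff \<alpha> (int k) * z ^ k) sums a \<and>
    (\<lambda>k. kernel_coeff \<alpha> (- int (Suc k)) * of_real (radial \<alpha> k ((cmod z)\<^sup>2)) * cnj z ^ Suc k) sums b \<and>
    poisson_kernel \<alpha> z = a + b"
    using poisson_kernel_decomp[OF z] by (intro exI conjI)
qed

section \<open>Fourier series on the circle\<close>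

text \<open>The indices \<open>k\<close> and \<open>- (k + 1)\<close> are paired, so that a series
  over the integers becomes an ordinary one with the index conventions of
  \<open>has_alpha_expansion\<close>.\<close>

definition two_sided_term :: "(int \<Rightarrow> complex) \<Rightarrow> nat \<Rightarrow> complex \<Rightarrow> complex" where
  "two_sided_term d k z =
     d (int k) * circle_char (int k) z + d (- int (Suc k)) * circle_char (- int (Suc k)) z"

definition two_sided_series :: "(int \<Rightarrow> complex) \<Rightarrow> complex \<Rightarrow> complex" where
  "two_sided_series d z = (\<Sum>k. two_sided_term d k z)"

definition abs_summable2 :: "(int \<Rightarrow> complex) \<Rightarrow> bool" where
  "abs_summable2 d \<longleftrightarrow> summable (\<lambda>k. cmod (d (int k)) + cmod (d (- int (Suc k))))"

text \<open>The gauge integral is taken because the fundamental theorem and uniform limits apply to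
  it directly; \<open>distribution_of_eq\<close> links it to the Lebesgue integral in
  \<open>distribution_of\<close>.\<close>

definition circle_coeff :: "(complex \<Rightarrow> complex) \<Rightarrow> int \<Rightarrow> complex" where
  "circle_coeff \<psi> k = integral {0..2 * pi} (\<lambda>t. \<psi> (cis t) * circle_char (- k) (cis t)) / of_real (2 * pi)"

lemma circle_char_cis: "circle_char k (cis t) = cis (of_int k * t)"
  by (simp add: circle_char_def cis_power_int)

lemma norm_circle_char [simp]: "cmod (circle_char k (cis t)) = 1"
  by (simp add: circle_char_cis)

lemma circle_char_mult:
  "circle_char j (cis t) * circle_char k (cis t) = circle_char (j + k) (cis t)"
  by (simp add: circle_char_cis cis_mult distrib_right)

lemma cnj_circle_char: "cnj (circle_char k (cis t)) = circle_char (- k) (cis t)"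
  by (simp add: circle_char_cis cis_cnj)

lemma circle_char_has_vector_derivative:
  "((\<lambda>t. circle_char k (cis t)) has_vector_derivative \<i> * of_int k * circle_char k (cis t)) (at t within S)"
proof -
  have 1: "((\<lambda>t. \<i> * of_real (of_int k * t)) has_vector_derivative \<i> * of_int k) (at t within S)"
    by (auto intro!: derivative_eq_intros)
  have "((\<lambda>t. exp (\<i> * of_real (of_int k * t))) has_vector_derivative
      \<i> * of_int k * exp (\<i> * of_real (of_int k * t))) (at t within S)"
    using field_vector_diff_chain_within[OF 1 has_field_derivative_at_within[OF DERIV_exp]]
    by (simp add: o_def)
  then show ?thesis unfolding circle_char_cis unfolding cis_conv_exp .
qed

lemma continuous_on_circle_char [continuous_intros]:
  "continuous_on S (\<lambda>t. circle_char k (cis t))"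
  unfolding circle_char_cis by (intro continuous_intros)

lemma norm_two_sided_term:
  "cmod (two_sided_term d k (cis t)) \<le> cmod (d (int k)) + cmod (d (- int (Suc k)))"
  unfolding two_sided_term_def by (rule order.trans[OF norm_triangle_ineq]) (simp add: norm_mult)

lemma summable_two_sided_term:
  "abs_summable2 d \<Longrightarrow> summable (\<lambda>k. two_sided_term d k (cis t))"
  unfolding abs_summable2_def by (rule summable_comparison_test'[OF _ norm_two_sided_term])

lemma two_sided_series_sums:
  "abs_summable2 d \<Longrightarrow> (\<lambda>k. two_sided_term d k (cis t)) sums two_sided_series d (cis t)"
  unfolding two_sided_series_def by (rule summable_sums[OF summable_two_sided_term])

lemma uniform_limit_two_sided_series:
  assumes "abs_summable2 d"
  shows "uniform_limit S (\<lambda>n t. \<Sum>k<n. two_sided_term d k (cis t)) (\<lambda>t. two_sided_series d (cis t)) sequentially"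
  unfolding two_sided_series_def
  by (rule Weierstrass_m_test[OF norm_two_sided_term assms[unfolded abs_summable2_def]])

lemma continuous_on_two_sided_term [continuous_intros]:
  "continuous_on S (\<lambda>t. two_sided_term d k (cis t))"
  unfolding two_sided_term_def by (intro continuous_intros)

lemma continuous_on_two_sided_series:
  "abs_summable2 d \<Longrightarrow> continuous_on S (\<lambda>t. two_sided_series d (cis t))"
  by (rule uniform_limit_theorem[OF _ uniform_limit_two_sided_series])
    (auto intro!: always_eventually continuous_intros)

lemma integral_circle_char:
  "((\<lambda>t. circle_char k (cis t)) has_integral (if k = 0 then of_real (2 * pi) else 0)) {0..2 * pi}"
proof (cases "k = 0")
  case True
  have "((\<lambda>t::real. 1 :: complex) has_integral of_real (2 * pi)) {0..2 * pi}"
    using has_integral_const_real[of "1::complex" 0 "2 * pi"] by (simp add: scaleR_conv_of_real)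
  then show ?thesis using True by (simp add: circle_char_def)
next
  case False
  have "((\<lambda>t. circle_char k (cis t)) has_integral
      (circle_char k (cis (2 * pi)) / (\<i> * of_int k) - circle_char k (cis 0) / (\<i> * of_int k))) {0..2 * pi}"
  proof (rule fundamental_theorem_of_calculus)
    fix t
    show "((\<lambda>t. circle_char k (cis t) / (\<i> * of_int k)) has_vector_derivative circle_char k (cis t))
        (at t within {0..2 * pi})"
      using has_vector_derivative_divide[OF circle_char_has_vector_derivative[of k t "{0..2 * pi}"], of "\<i> * of_int k"] False
      by simp
  qed simp
  then show ?thesis using False by simp
qed

lemma circle_coeff_two_sided_series:
  assumes "abs_summable2 d"
  shows "circle_coeff (two_sided_series d) m = d m"
proof -
  define f where "f n t = (\<Sum>k<n. two_sided_term d k (cis t)) * circle_char (- m) (cis t)" for n t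
  \<comment> \<open>After integration against a character, a pair contributes only if one of its two
    indices is \<open>m\<close>.\<close>
  define \<delta> where "\<delta> k = (if int k = m then d m else 0) + (if - int (Suc k) = m then d m else 0)" for k
  have "uniform_limit {0..2 * pi} f (\<lambda>t. two_sided_series d (cis t) * circle_char (- m) (cis t)) sequentially"
    unfolding f_def
    by (intro uniform_lim_mult uniform_limit_two_sided_series assms uniform_limit_const
        compact_imp_bounded compact_continuous_image continuous_on_two_sided_series continuous_intros)
       auto
  moreover have "continuous_on {0..2 * pi} (f n)" for n
    unfolding f_def by (intro continuous_intros)
  ultimately obtain I J where IJ: "\<And>n. (f n has_integral I n) {0..2 * pi}"
    "((\<lambda>t. two_sided_series d (cis t) * circle_char (- m) (cis t)) has_integral J) {0..2 * pi}" "I \<longlonglongrightarrow> J"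
    by (rule uniform_limit_integral) (auto simp: trivial_limit_sequentially)
  have tm: "((\<lambda>t. two_sided_term d k (cis t) * circle_char (- m) (cis t)) has_integral
      (of_real (2 * pi) * \<delta> k)) {0..2 * pi}" for k
  proof -
    have "((\<lambda>t. d (int k) * circle_char (int k - m) (cis t) + d (- int (Suc k)) * circle_char (- int (Suc k) - m) (cis t))
       has_integral (d (int k) * (if int k - m = 0 then of_real (2 * pi) else 0) +
          d (- int (Suc k)) * (if - int (Suc k) - m = 0 then of_real (2 * pi) else 0))) {0..2 * pi}"
      by (intro has_integral_add has_integral_mult_right integral_circle_char)
    moreover have "d (int k) * (if int k - m = 0 then of_real (2 * pi) else 0) +
          d (- int (Suc k)) * (if - int (Suc k) - m = 0 then of_real (2 * pi) else 0) = of_real (2 * pi) * \<delta> k"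
      unfolding \<delta>_def by auto
    moreover have "d (int k) * circle_char (int k - m) (cis t) + d (- int (Suc k)) * circle_char (- int (Suc k) - m) (cis t)
      = two_sided_term d k (cis t) * circle_char (- m) (cis t)" for t
      unfolding two_sided_term_def distrib_right mult.assoc circle_char_mult by simp
    ultimately show ?thesis by simp
  qed
  have "(f n has_integral (\<Sum>k<n. of_real (2 * pi) * \<delta> k)) {0..2 * pi}" for n
    unfolding f_def sum_distrib_right by (intro has_integral_sum tm) auto
  then have "I = (\<lambda>n. \<Sum>k<n. of_real (2 * pi) * \<delta> k)" using IJ(1) has_integral_unique by blast
  then have "(\<lambda>k. of_real (2 * pi) * \<delta> k) sums J" using IJ(3) by (simp add: sums_def)
  moreover have "\<delta> sums d m"
  proof (cases m rule: int_cases)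
    case (nonneg i)
    then have "\<delta> = (\<lambda>k. if k = i then d m else 0)" by (auto simp: \<delta>_def fun_eq_iff)
    then show ?thesis using sums_single[of i "\<lambda>_. d m"] by simp
  next
    case (neg i)
    then have "\<delta> = (\<lambda>k. if k = i then d m else 0)" by (auto simp: \<delta>_def fun_eq_iff)
    then show ?thesis using sums_single[of i "\<lambda>_. d m"] by simp
  qed
  then have "(\<lambda>k. of_real (2 * pi) * \<delta> k) sums (of_real (2 * pi) * d m)" by (rule sums_mult)
  ultimately have "J = of_real (2 * pi) * d m" by (rule sums_unique2)
  then show ?thesis using integral_unique[OF IJ(2)] by (simp add: circle_coeff_def)
qed

section \<open>Uniqueness of Fourier coefficients by trigonometric approximation\<close>

text \<open>Products of characters are characters, so this class is closed under multiplication and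
  contains all polynomials in the two real coordinates, restricted to the circle.\<close>

inductive trig_poly :: "(real \<Rightarrow> complex) \<Rightarrow> bool" where
  char: "trig_poly (\<lambda>t. c * circle_char k (cis t))"
| add: "trig_poly f \<Longrightarrow> trig_poly g \<Longrightarrow> trig_poly (\<lambda>t. f t + g t)"

lemma trig_poly_const: "trig_poly (\<lambda>t. c)"
  using char[of c 0] by (simp add: circle_char_def)

lemma trig_poly_mult: "trig_poly f \<Longrightarrow> trig_poly g \<Longrightarrow> trig_poly (\<lambda>t. f t * g t)"
proof (induction rule: trig_poly.induct)
  case (char c k)
  from char show ?case
  proof (induction rule: trig_poly.induct)
    case (char b j)
    have "(\<lambda>t. c * circle_char k (cis t) * (b * circle_char j (cis t))) = (\<lambda>t. (c * b) * circle_char (k + j) (cis t))"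
      by (simp add: circle_char_mult[symmetric] mult_ac)
    then show ?case using trig_poly.char by simp
  qed (use trig_poly.add in \<open>simp add: distrib_left\<close>)
qed (use trig_poly.add in \<open>simp add: distrib_right\<close>)

lemma trig_poly_cos_sin: "trig_poly (\<lambda>t. of_real (cos t))" "trig_poly (\<lambda>t. of_real (sin t))"
proof -
  have c: "(\<lambda>t. of_real (cos t)) = (\<lambda>t. (1/2) * circle_char 1 (cis t) + (1/2) * circle_char (-1) (cis t))"
    by (auto simp: circle_char_cis complex_eq_iff)
  show "trig_poly (\<lambda>t. of_real (cos t))" unfolding c by (intro trig_poly.intros)
  have s: "(\<lambda>t. of_real (sin t)) = (\<lambda>t. (- \<i>/2) * circle_char 1 (cis t) + (\<i>/2) * circle_char (-1) (cis t))"
    by (auto simp: circle_char_cis complex_eq_iff)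
  show "trig_poly (\<lambda>t. of_real (sin t))" unfolding s by (intro trig_poly.intros)
qed

lemma trig_poly_real_polynomial_function:
  "real_polynomial_function p \<Longrightarrow> trig_poly (\<lambda>t. of_real (p (cis t)))"
proof (induction rule: real_polynomial_function.induct)
  case (linear f)
  have "f (cis t) = cos t * f 1 + sin t * f \<i>" for t
  proof -
    have "cis t = cos t *\<^sub>R 1 + sin t *\<^sub>R \<i>" by (simp add: complex_eq_iff)
    then show ?thesis using linear by (simp add: linear_add linear_scale bounded_linear.linear)
  qed
  then have "(\<lambda>t. complex_of_real (f (cis t))) =
      (\<lambda>t. of_real (cos t) * of_real (f 1) + of_real (sin t) * of_real (f \<i>))" by simp
  then show ?case by (simp only:) (intro trig_poly.add trig_poly_mult trig_poly_cos_sin trig_poly_const)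
qed (auto intro: trig_poly_const trig_poly.add trig_poly_mult)

lemma trig_poly_polynomial_function:
  fixes p :: "complex \<Rightarrow> complex"
  assumes "polynomial_function p"
  shows "trig_poly (\<lambda>t. p (cis t))"
proof -
  have "real_polynomial_function (Re \<circ> p)" "real_polynomial_function (Im \<circ> p)"
    using assms bounded_linear_Re bounded_linear_Im unfolding polynomial_function_def by blast+
  then have "trig_poly (\<lambda>t. of_real (Re (p (cis t))) + \<i> * of_real (Im (p (cis t))))"
    using trig_poly_real_polynomial_function by (intro trig_poly.add trig_poly_mult trig_poly_const) fastforce+
  then show ?thesis by (simp add: complex_eq[symmetric])
qed

lemma trig_poly_continuous: "trig_poly f \<Longrightarrow> continuous_on S f"
  by (induction rule: trig_poly.induct) (auto intro!: continuous_intros)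

text \<open>\<open>cis\<close> maps a compact interval onto the circle, so the part of the circle
  that \<open>\<psi>\<close> sends into a closed set is the image of a compact set.\<close>

lemma continuous_on_sphere:
  fixes \<psi> :: "complex \<Rightarrow> complex"
  assumes "continuous_on UNIV (\<lambda>t. \<psi> (cis t))"
  shows "continuous_on (sphere 0 1) \<psi>"
  unfolding continuous_on_closed_vimage[OF closed_sphere]
proof (intro allI impI)
  fix T :: "complex set" assume T: "closed T"
  have "\<psi> -` T \<inter> sphere 0 1 = cis ` ({0..2 * pi} \<inter> (\<lambda>t. \<psi> (cis t)) -` T)"
  proof (intro set_eqI iffI)
    fix z assume z: "z \<in> \<psi> -` T \<inter> sphere 0 1"
    then have "z = cis (Arg2pi z)" using Arg2pi_eq[of z] by (simp add: cis_conv_exp)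
    then show "z \<in> cis ` ({0..2 * pi} \<inter> (\<lambda>t. \<psi> (cis t)) -` T)"
      using z Arg2pi_ge_0[of z] Arg2pi_lt_2pi[of z] by (intro image_eqI[of _ _ "Arg2pi z"]) auto
  qed auto
  moreover have "compact ({0..2 * pi} \<inter> (\<lambda>t. \<psi> (cis t)) -` T)"
    using assms T by (intro compact_Int_closed closed_vimage) auto
  then have "compact (cis ` ({0..2 * pi} \<inter> (\<lambda>t. \<psi> (cis t)) -` T))"
    by (rule compact_continuous_image[rotated]) (intro continuous_intros)
  ultimately show "closed (\<psi> -` T \<inter> sphere 0 1)" by (simp add: compact_imp_closed)
qed

text \<open>Vanishing coefficients make \<open>\<psi>\<close> orthogonal to every trigonometric
  polynomial \<open>p\<close>. The integral of \<open>|\<psi>|^2\<close> therefore equals that of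
  \<open>\<psi>\<close> times the conjugate of \<open>\<psi> - p\<close>, which is at most
  \<open>e\<close> times the integral of \<open>|\<psi>|\<close> if \<open>p\<close> is uniformly
  \<open>e\<close>-close.\<close>

lemma circle_coeff_eq_0_imp:
  assumes c: "continuous_on UNIV (\<lambda>t. \<psi> (cis t))" and z: "\<And>k. circle_coeff \<psi> k = 0"
  shows "\<psi> (cis t) = 0"
proof -
  have cS: "continuous_on S (\<lambda>t. \<psi> (cis t))" for S using c continuous_on_subset by blast
  have int0: "integral {0..2 * pi} (\<lambda>t. \<psi> (cis t) * cnj (f t)) = 0" if "trig_poly f" for f
    using that
  proof (induction rule: trig_poly.induct)
    case (char b k)
    have "(\<lambda>t. \<psi> (cis t) * cnj (b * circle_char k (cis t))) = (\<lambda>t. cnj b * (\<psi> (cis t) * circle_char (- k) (cis t)))"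
      by (simp add: cnj_circle_char mult_ac)
    then show ?case using z[of k] by (simp add: circle_coeff_def)
  next
    case (add f g)
    have "(\<lambda>t. \<psi> (cis t) * cnj (f t)) integrable_on {0..2 * pi}" "(\<lambda>t. \<psi> (cis t) * cnj (g t)) integrable_on {0..2 * pi}"
      by (intro integrable_continuous_interval continuous_intros cS trig_poly_continuous add)+
    then show ?case using add by (simp add: distrib_left integral_add)
  qed
  define Q where "Q = integral {0..2 * pi} (\<lambda>t. (cmod (\<psi> (cis t)))\<^sup>2)"
  define L where "L = integral {0..2 * pi} (\<lambda>t. cmod (\<psi> (cis t)))"
  have "Q \<ge> 0" unfolding Q_def by (intro integral_nonneg integrable_continuous_interval continuous_intros cS) auto
  have L0: "L \<ge> 0" unfolding L_def by (intro integral_nonneg integrable_continuous_interval continuous_intros cS) auto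
  have QeL: "Q \<le> e * L" if e: "e > 0" for e
  proof -
    obtain p where p: "polynomial_function p" "\<And>x. x \<in> sphere 0 1 \<Longrightarrow> cmod (\<psi> x - p x) < e"
      using Stone_Weierstrass_polynomial_function[OF compact_sphere continuous_on_sphere[OF c] e] by blast
    note tp = trig_poly_polynomial_function[OF p(1)]
    have "((\<lambda>t. complex_of_real ((cmod (\<psi> (cis t)))\<^sup>2)) has_integral of_real Q) {0..2 * pi}"
      unfolding Q_def
      by (intro has_integral_linear[OF integrable_integral bounded_linear_of_real, unfolded o_def]
          integrable_continuous_interval continuous_intros cS)
    moreover have "((\<lambda>t. \<psi> (cis t) * cnj (p (cis t))) has_integral 0) {0..2 * pi}"
    proof -
      have "(\<lambda>t. \<psi> (cis t) * cnj (p (cis t))) integrable_on {0..2 * pi}"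
        by (intro integrable_continuous_interval continuous_intros cS trig_poly_continuous tp)
      from integrable_integral[OF this] show ?thesis using int0[OF tp] by simp
    qed
    ultimately have "((\<lambda>t. of_real ((cmod (\<psi> (cis t)))\<^sup>2) - \<psi> (cis t) * cnj (p (cis t))) has_integral (of_real Q - 0)) {0..2 * pi}"
      by (rule has_integral_diff)
    then have "integral {0..2 * pi} (\<lambda>t. of_real ((cmod (\<psi> (cis t)))\<^sup>2) - \<psi> (cis t) * cnj (p (cis t))) = of_real Q"
      by (simp add: integral_unique)
    then have "Q = cmod (integral {0..2 * pi} (\<lambda>t. of_real ((cmod (\<psi> (cis t)))\<^sup>2) - \<psi> (cis t) * cnj (p (cis t))))"
      using \<open>Q \<ge> 0\<close> by simp
    also have "\<dots> \<le> integral {0..2 * pi} (\<lambda>t. e * cmod (\<psi> (cis t)))"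
    proof (rule integral_norm_bound_integral)
      show "(\<lambda>t. of_real ((cmod (\<psi> (cis t)))\<^sup>2) - \<psi> (cis t) * cnj (p (cis t))) integrable_on {0..2 * pi}"
        by (intro integrable_continuous_interval continuous_intros cS trig_poly_continuous tp)
      show "(\<lambda>t. e * cmod (\<psi> (cis t))) integrable_on {0..2 * pi}"
        by (intro integrable_continuous_interval continuous_intros cS)
      fix t
      have "of_real ((cmod (\<psi> (cis t)))\<^sup>2) - \<psi> (cis t) * cnj (p (cis t)) = \<psi> (cis t) * cnj (\<psi> (cis t) - p (cis t))"
        unfolding complex_norm_square by (simp add: right_diff_distrib)
      then have "cmod (of_real ((cmod (\<psi> (cis t)))\<^sup>2) - \<psi> (cis t) * cnj (p (cis t))) = cmod (\<psi> (cis t)) * cmod (\<psi> (cis t) - p (cis t))"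
        by (simp only: norm_mult complex_mod_cnj)
      also have "\<dots> \<le> cmod (\<psi> (cis t)) * e" using p(2)[of "cis t"] by (intro mult_left_mono) auto
      finally show "cmod (of_real ((cmod (\<psi> (cis t)))\<^sup>2) - \<psi> (cis t) * cnj (p (cis t))) \<le> e * cmod (\<psi> (cis t))"
        by (simp add: mult.commute)
    qed
    also have "\<dots> = e * L" by (simp add: L_def)
    finally show ?thesis .
  qed
  have "Q \<le> 0"
  proof (rule field_le_epsilon)
    fix e :: real assume e: "e > 0"
    \<comment> \<open>Dividing by \<open>L + 1\<close> avoids a separate case
      \<open>L = 0\<close>.\<close>
    have "Q \<le> (e / (L + 1)) * L" using e L0 by (intro QeL) simp
    also have "\<dots> \<le> e" using L0 e by (simp add: field_simps)
    finally show "Q \<le> 0 + e" by simp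
  qed
  then have "Q = 0" using \<open>Q \<ge> 0\<close> by (rule antisym)
  have zero: "\<psi> (cis s) = 0" if "s \<in> {0..2 * pi}" for s
  proof -
    have "continuous_on {0..2 * pi} (\<lambda>t. (cmod (\<psi> (cis t)))\<^sup>2)" by (intro continuous_intros cS)
    from integral_eq_0_iff[OF this] have "(cmod (\<psi> (cis s)))\<^sup>2 = 0"
      using \<open>Q = 0\<close>[unfolded Q_def] that by simp
    then show ?thesis by simp
  qed
  define s where "s = Arg2pi (cis t)"
  have "s \<in> {0..2 * pi}" using Arg2pi_ge_0[of "cis t"] Arg2pi_lt_2pi[of "cis t"] by (simp add: s_def)
  moreover have "cis s = cis t" using Arg2pi_eq[of "cis t"] by (simp add: s_def cis_conv_exp)
  ultimately show ?thesis using zero[of s] by simp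
qed

section \<open>Smooth functions and distributions on the circle\<close>

definition diff_coeffs :: "nat \<Rightarrow> (int \<Rightarrow> complex) \<Rightarrow> int \<Rightarrow> complex" where
  "diff_coeffs j d k = (\<i> * of_int k) ^ j * d k"

definition rapid :: "(int \<Rightarrow> complex) \<Rightarrow> bool" where
  "rapid d \<longleftrightarrow> (\<forall>N. \<exists>C. \<forall>k. cmod (d k) * (1 + real_of_int \<bar>k\<bar>) ^ N \<le> C)"

definition inverse_square_sum :: real where
  "inverse_square_sum = (\<Sum>k. 1 / (1 + real k)\<^sup>2)"

lemma inverse_square_summable: "summable (\<lambda>k. 1 / (1 + real k)\<^sup>2)"
proof -
  have "summable (\<lambda>n. inverse (real n ^ 2))" by (rule inverse_power_summable) simp
  then have "summable (\<lambda>n. inverse (real (Suc n) ^ 2))" by (subst summable_Suc_iff)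
  then show ?thesis by (simp add: inverse_eq_divide add.commute)
qed

text \<open>Comparison with the inverse squares; the 2 counts the two indices of a pair, both of
  modulus at least \<open>n\<close>. The explicit dependence on \<open>C\<close> later yields the
  continuity estimate of a distribution.\<close>

lemma quadratic_decay:
  assumes d: "\<And>k. cmod (d k) * (1 + real_of_int \<bar>k\<bar>)\<^sup>2 \<le> C"
  shows "abs_summable2 d" "cmod (two_sided_series d (cis t)) \<le> 2 * C * inverse_square_sum"
proof -
  have C: "0 \<le> C" by (rule order.trans[OF _ d[of 0]]) auto
  have b: "cmod (d k) \<le> C / (1 + real n)\<^sup>2" if "int n \<le> \<bar>k\<bar>" for k n
  proof -
    have "cmod (d k) * (1 + real n)\<^sup>2 \<le> cmod (d k) * (1 + real_of_int \<bar>k\<bar>)\<^sup>2"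
      using that by (intro mult_left_mono power_mono) auto
    also have "\<dots> \<le> C" by (rule d)
    finally show ?thesis by (simp add: pos_le_divide_eq)
  qed
  have le: "cmod (d (int n)) + cmod (d (- int (Suc n))) \<le> 2 * C * (1 / (1 + real n)\<^sup>2)" for n
    using b[of n "int n"] b[of n "- int (Suc n)"] by simp
  have s: "summable (\<lambda>n. 2 * C * (1 / (1 + real n)\<^sup>2))"
    by (intro summable_mult inverse_square_summable)
  have a: "summable (\<lambda>n. cmod (d (int n)) + cmod (d (- int (Suc n))))"
    by (rule summable_comparison_test'[OF s]) (use le in auto)
  then show "abs_summable2 d" by (simp add: abs_summable2_def)
  have "cmod (two_sided_series d (cis t)) \<le> (\<Sum>n. cmod (d (int n)) + cmod (d (- int (Suc n))))"
    unfolding two_sided_series_def by (rule norm_suminf_le[OF norm_two_sided_term a])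
  also have "\<dots> \<le> (\<Sum>n. 2 * C * (1 / (1 + real n)\<^sup>2))"
    by (rule suminf_le[OF le a s])
  also have "\<dots> = 2 * C * inverse_square_sum"
    unfolding inverse_square_sum_def by (rule suminf_mult[OF inverse_square_summable])
  finally show "cmod (two_sided_series d (cis t)) \<le> 2 * C * inverse_square_sum" .
qed

lemma rapid_imp_abs_summable2: "rapid d \<Longrightarrow> abs_summable2 d"
  unfolding rapid_def using quadratic_decay(1) by metis

lemma rapid_mult_poly_bounded:
  assumes "poly_bounded c" "rapid d"
  shows "rapid (\<lambda>k. c k * d k)"
  unfolding rapid_def
proof
  fix N
  obtain C M where C: "\<And>k. cmod (c k) \<le> C * (1 + real_of_int \<bar>k\<bar>) ^ M"
    using assms(1) unfolding poly_bounded_def by blast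
  obtain D where D: "\<And>k. cmod (d k) * (1 + real_of_int \<bar>k\<bar>) ^ (M + N) \<le> D"
    using assms(2) unfolding rapid_def by blast
  have "C \<ge> 0" using order.trans[OF norm_ge_zero C[of 0]] by simp
  have "cmod (c k * d k) * (1 + real_of_int \<bar>k\<bar>) ^ N \<le> C * D" for k
  proof -
    have "cmod (c k * d k) * (1 + real_of_int \<bar>k\<bar>) ^ N
        \<le> (C * (1 + real_of_int \<bar>k\<bar>) ^ M) * cmod (d k) * (1 + real_of_int \<bar>k\<bar>) ^ N"
      unfolding norm_mult by (intro mult_right_mono C) auto
    also have "\<dots> = C * (cmod (d k) * (1 + real_of_int \<bar>k\<bar>) ^ (M + N))"
      by (simp add: power_add mult_ac)
    also have "\<dots> \<le> C * D" by (intro mult_left_mono D \<open>C \<ge> 0\<close>)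
    finally show ?thesis .
  qed
  then show "\<exists>C. \<forall>k. cmod (c k * d k) * (1 + real_of_int \<bar>k\<bar>) ^ N \<le> C" by blast
qed

lemma rapid_diff_coeffs: 
  assumes "rapid d"
  shows "rapid (diff_coeffs j d)"
proof -
  have "cmod ((\<i> * of_int k) ^ j) \<le> 1 * (1 + real_of_int \<bar>k\<bar>) ^ j" for k
    by (simp add: norm_mult norm_power power_mono)
  then have "poly_bounded (\<lambda>k. (\<i> * of_int k) ^ j)" unfolding poly_bounded_def by blast
  from rapid_mult_poly_bounded[OF this assms] show ?thesis by (simp add: diff_coeffs_def[abs_def])
qed

lemma two_sided_term_has_vector_derivative:
  "((\<lambda>t. two_sided_term (diff_coeffs j d) k (cis t)) has_vector_derivative
     two_sided_term (diff_coeffs (Suc j) d) k (cis t)) (at t)"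
  unfolding two_sided_term_def
proof -
  have "((\<lambda>t. diff_coeffs j d (int k) * circle_char (int k) (cis t) +
      diff_coeffs j d (- int (Suc k)) * circle_char (- int (Suc k)) (cis t)) has_vector_derivative
     (diff_coeffs j d (int k) * (\<i> * of_int (int k) * circle_char (int k) (cis t)) +
      diff_coeffs j d (- int (Suc k)) * (\<i> * of_int (- int (Suc k)) * circle_char (- int (Suc k)) (cis t)))) (at t)"
    by (intro has_vector_derivative_add has_vector_derivative_mult_right circle_char_has_vector_derivative)
  then show "((\<lambda>t. diff_coeffs j d (int k) * circle_char (int k) (cis t) +
      diff_coeffs j d (- int (Suc k)) * circle_char (- int (Suc k)) (cis t)) has_vector_derivative
     diff_coeffs (Suc j) d (int k) * circle_char (int k) (cis t) +
      diff_coeffs (Suc j) d (- int (Suc k)) * circle_char (- int (Suc k)) (cis t)) (at t)"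
    unfolding diff_coeffs_def power_Suc by (simp only: mult_ac)
qed

text \<open>Rapid decay survives multiplication by powers of the index, so the series of derivatives
  converges uniformly and termwise differentiation is legitimate.\<close>

lemma two_sided_series_has_vector_derivative:
  assumes "rapid d"
  shows "((\<lambda>t. two_sided_series (diff_coeffs j d) (cis t)) has_vector_derivative
     two_sided_series (diff_coeffs (Suc j) d) (cis t)) (at t)"
proof -
  note a = rapid_imp_abs_summable2[OF rapid_diff_coeffs[OF assms]]
  have "\<exists>g. \<forall>x\<in>UNIV. (\<lambda>n. two_sided_term (diff_coeffs j d) n (cis x)) sums g x \<and>
    (g has_derivative (\<lambda>h. h *\<^sub>R two_sided_series (diff_coeffs (Suc j) d) (cis x))) (at x within UNIV)"
  proof (rule has_derivative_series[where f' = "\<lambda>n x h. h *\<^sub>R two_sided_term (diff_coeffs (Suc j) d) n (cis x)"])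
    show "((\<lambda>t. two_sided_term (diff_coeffs j d) n (cis t)) has_derivative
        (\<lambda>h. h *\<^sub>R two_sided_term (diff_coeffs (Suc j) d) n (cis x))) (at x within UNIV)" for n x
      using two_sided_term_has_vector_derivative[of j d n x] by (simp add: has_vector_derivative_def)
    show "\<forall>\<^sub>F n in sequentially. \<forall>x\<in>UNIV. \<forall>h. norm ((\<Sum>i<n. h *\<^sub>R two_sided_term (diff_coeffs (Suc j) d) i (cis x)) -
        h *\<^sub>R two_sided_series (diff_coeffs (Suc j) d) (cis x)) \<le> e * norm h" if "e > 0" for e
      using uniform_limitD[OF uniform_limit_two_sided_series[OF a[of "Suc j"], of UNIV] that]
    proof (rule eventually_mono)
      fix n assume n: "\<forall>x\<in>UNIV. dist (\<Sum>k<n. two_sided_term (diff_coeffs (Suc j) d) k (cis x))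
          (two_sided_series (diff_coeffs (Suc j) d) (cis x)) < e"
      show "\<forall>x\<in>UNIV. \<forall>h. norm ((\<Sum>i<n. h *\<^sub>R two_sided_term (diff_coeffs (Suc j) d) i (cis x)) -
        h *\<^sub>R two_sided_series (diff_coeffs (Suc j) d) (cis x)) \<le> e * norm h"
      proof (intro ballI allI)
        fix x h :: real
        have "norm ((\<Sum>i<n. h *\<^sub>R two_sided_term (diff_coeffs (Suc j) d) i (cis x)) -
          h *\<^sub>R two_sided_series (diff_coeffs (Suc j) d) (cis x)) =
          \<bar>h\<bar> * norm ((\<Sum>i<n. two_sided_term (diff_coeffs (Suc j) d) i (cis x)) - two_sided_series (diff_coeffs (Suc j) d) (cis x))"
          unfolding scaleR_sum_right[symmetric] scaleR_diff_right[symmetric] norm_scaleR ..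
        also have "\<dots> \<le> \<bar>h\<bar> * e"
          using bspec[OF n UNIV_I[of x]] by (intro mult_left_mono) (auto simp: dist_norm)
        finally show "norm ((\<Sum>i<n. h *\<^sub>R two_sided_term (diff_coeffs (Suc j) d) i (cis x)) -
          h *\<^sub>R two_sided_series (diff_coeffs (Suc j) d) (cis x)) \<le> e * norm h" by (simp add: mult.commute)
      qed
    qed
    show "(\<lambda>n. two_sided_term (diff_coeffs j d) n (cis 0)) sums two_sided_series (diff_coeffs j d) (cis 0)"
      by (rule two_sided_series_sums[OF a])
  qed auto
  then obtain g where g: "\<And>x. (\<lambda>n. two_sided_term (diff_coeffs j d) n (cis x)) sums g x"
    "\<And>x. (g has_derivative (\<lambda>h. h *\<^sub>R two_sided_series (diff_coeffs (Suc j) d) (cis x))) (at x)" by auto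
  have "g x = two_sided_series (diff_coeffs j d) (cis x)" for x
    using sums_unique2[OF g(1) two_sided_series_sums[OF a]] .
  then have "g = (\<lambda>t. two_sided_series (diff_coeffs j d) (cis t))" by (rule ext)
  with g(2)[of t] show ?thesis by (simp add: has_vector_derivative_def)
qed

section \<open>Smooth functions on the circle and their suprema\<close>

text \<open>Exhibiting the whole sequence of derivatives at once proves smoothness and identifies
  every \<open>circle_deriv\<close> in a single induction.\<close>

lemma circle_smoothI:
  assumes g0: "g 0 = (\<lambda>t. \<psi> (cis t))"
    and g: "\<And>n t. (g n has_vector_derivative g (Suc n) t) (at t)"
  shows "\<psi> \<in> C_infinity_circle" "circle_deriv n \<psi> = g n"
proof -
  have *: "circle_deriv n \<psi> = g n" for n
  proof (induction n)
    case (Suc n)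
    have "circle_deriv (Suc n) \<psi> = (\<lambda>t. vector_derivative (circle_deriv n \<psi>) (at t))"
      by (simp add: circle_deriv_def)
    then show ?case using vector_derivative_at[OF g] by (simp add: Suc)
  qed (simp add: circle_deriv_def g0)
  show "circle_deriv n \<psi> = g n" by (rule *)
  show "\<psi> \<in> C_infinity_circle"
    using differentiableI_vector[OF g] by (simp add: C_infinity_circle_def *)
qed

lemma circle_deriv_0: "circle_deriv 0 \<psi> = (\<lambda>t. \<psi> (cis t))"
  by (simp add: circle_deriv_def)

lemma circle_deriv_has_vector_derivative:
  assumes "\<psi> \<in> C_infinity_circle"
  shows "(circle_deriv n \<psi> has_vector_derivative circle_deriv (Suc n) \<psi> t) (at t)"
proof -
  have "circle_deriv (Suc n) \<psi> t = vector_derivative (circle_deriv n \<psi>) (at t)"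
    by (simp add: circle_deriv_def)
  moreover have "circle_deriv n \<psi> differentiable (at t)"
    using assms by (simp add: C_infinity_circle_def)
  ultimately show ?thesis by (simp add: vector_derivative_works)
qed

lemma circle_deriv_continuous:
  "\<psi> \<in> C_infinity_circle \<Longrightarrow> continuous_on S (circle_deriv n \<psi>)"
  by (rule continuous_on_vector_derivative[OF has_vector_derivative_at_within[OF circle_deriv_has_vector_derivative]])

lemma C_infinity_circle_continuous:
  "\<psi> \<in> C_infinity_circle \<Longrightarrow> continuous_on S (\<lambda>t. \<psi> (cis t))"
  using circle_deriv_continuous[of \<psi> S 0] by (simp add: circle_deriv_0)

lemma C_infinity_circle_add:
  assumes "\<psi> \<in> C_infinity_circle" "\<eta> \<in> C_infinity_circle"
  shows "(\<lambda>z. \<psi> z + \<eta> z) \<in> C_infinity_circle"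
    "circle_deriv n (\<lambda>z. \<psi> z + \<eta> z) = (\<lambda>t. circle_deriv n \<psi> t + circle_deriv n \<eta> t)"
  by (rule circle_smoothI[where g = "\<lambda>n t. circle_deriv n \<psi> t + circle_deriv n \<eta> t"];
      simp add: circle_deriv_0 has_vector_derivative_add circle_deriv_has_vector_derivative assms)+

lemma C_infinity_circle_cmult:
  assumes "\<psi> \<in> C_infinity_circle"
  shows "(\<lambda>z. a * \<psi> z) \<in> C_infinity_circle"
    "circle_deriv n (\<lambda>z. a * \<psi> z) = (\<lambda>t. a * circle_deriv n \<psi> t)"
  by (rule circle_smoothI[where g = "\<lambda>n t. a * circle_deriv n \<psi> t"];
      simp add: circle_deriv_0 has_vector_derivative_mult_right circle_deriv_has_vector_derivative assms)+

lemma circle_char_smooth: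
  "circle_char k \<in> C_infinity_circle"
  "circle_deriv n (circle_char k) = (\<lambda>t. (\<i> * of_int k) ^ n * circle_char k (cis t))"
proof -
  have "((\<lambda>t. (\<i> * of_int k) ^ n * circle_char k (cis t)) has_vector_derivative
      (\<i> * of_int k) ^ Suc n * circle_char k (cis t)) (at t)" for n t
    using has_vector_derivative_mult_right[OF circle_char_has_vector_derivative[of k t UNIV], of "(\<i> * of_int k) ^ n"]
    by (simp add: mult_ac)
  then show "circle_char k \<in> C_infinity_circle"
    "circle_deriv n (circle_char k) = (\<lambda>t. (\<i> * of_int k) ^ n * circle_char k (cis t))"
    by (intro circle_smoothI[where g = "\<lambda>n t. (\<i> * of_int k) ^ n * circle_char k (cis t)"]; simp)+
qed

lemma diff_coeffs_0: "diff_coeffs 0 d = d"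
  by (simp add: diff_coeffs_def[abs_def])

lemma rapid_series_smooth:
  assumes "rapid d" "\<And>t. \<psi> (cis t) = two_sided_series d (cis t)"
  shows "\<psi> \<in> C_infinity_circle" "circle_deriv n \<psi> = (\<lambda>t. two_sided_series (diff_coeffs n d) (cis t))"
  by (rule circle_smoothI[where g = "\<lambda>n t. two_sided_series (diff_coeffs n d) (cis t)"];
      simp add: two_sided_series_has_vector_derivative assms diff_coeffs_0)+

lemma partial_series_smooth:
  "(\<lambda>z. \<Sum>k<n. two_sided_term d k z) \<in> C_infinity_circle"
  "circle_deriv j (\<lambda>z. \<Sum>k<n. two_sided_term d k z) = (\<lambda>t. \<Sum>k<n. two_sided_term (diff_coeffs j d) k (cis t))"
  by (rule circle_smoothI[where g = "\<lambda>j t. \<Sum>k<n. two_sided_term (diff_coeffs j d) k (cis t)"];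
      simp add: has_vector_derivative_sum two_sided_term_has_vector_derivative diff_coeffs_0)+

lemma circle_deriv_periodic:
  assumes "\<psi> \<in> C_infinity_circle"
  shows "circle_deriv n \<psi> (t + 2 * pi) = circle_deriv n \<psi> t"
proof (induction n arbitrary: t)
  case (Suc n)
  have 1: "((\<lambda>s. s + 2 * pi) has_vector_derivative 1) (at t)"
    by (auto intro!: derivative_eq_intros)
  have "(circle_deriv n \<psi> \<circ> (\<lambda>s. s + 2 * pi)) = circle_deriv n \<psi>" using Suc by (simp add: fun_eq_iff)
  with vector_diff_chain_at[OF 1 circle_deriv_has_vector_derivative[OF assms, of n]]
  have "(circle_deriv n \<psi> has_vector_derivative circle_deriv (Suc n) \<psi> (t + 2 * pi)) (at t)" by simp
  from vector_derivative_unique_at[OF this circle_deriv_has_vector_derivative[OF assms]] show ?case .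
qed (simp add: circle_deriv_0 flip: cis_mult)

text \<open>Periodicity reduces the claim to a compact interval. Without boundedness the suprema in
  the definition of a distribution would carry no information.\<close>

lemma circle_deriv_bdd_above:
  assumes "\<psi> \<in> C_infinity_circle"
  shows "bdd_above (range (\<lambda>t. cmod (circle_deriv n \<psi> t)))"
proof -
  interpret periodic_fun_simple "circle_deriv n \<psi>" "2 * pi"
    by standard (rule circle_deriv_periodic[OF assms])
  have "bounded (circle_deriv n \<psi> ` {0..2 * pi})"
    by (intro compact_imp_bounded compact_continuous_image circle_deriv_continuous assms) simp
  then obtain B where B: "\<And>t. t \<in> {0..2 * pi} \<Longrightarrow> cmod (circle_deriv n \<psi> t) \<le> B"
    unfolding bounded_iff by blast
  have "cmod (circle_deriv n \<psi> t) \<le> B" for t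
  proof -
    define k where "k = \<lfloor>t / (2 * pi)\<rfloor>"
    have "real_of_int k \<le> t / (2 * pi)" "t / (2 * pi) \<le> real_of_int k + 1"
      unfolding k_def by linarith+
    then have "t - of_int k * (2 * pi) \<in> {0..2 * pi}"
      by (simp add: field_simps)
    from B[OF this] show ?thesis by (simp add: minus_of_int)
  qed
  then show ?thesis by (intro bdd_aboveI[of _ B]) blast
qed

abbreviation circle_sup :: "nat \<Rightarrow> (complex \<Rightarrow> complex) \<Rightarrow> real" where
  "circle_sup j \<psi> \<equiv> (SUP t. cmod (circle_deriv j \<psi> t))"

lemma circle_deriv_le_sup:
  "\<psi> \<in> C_infinity_circle \<Longrightarrow> cmod (circle_deriv n \<psi> t) \<le> circle_sup n \<psi>"
  by (rule cSUP_upper[OF UNIV_I circle_deriv_bdd_above])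

lemma circle_sup_nonneg: "\<psi> \<in> C_infinity_circle \<Longrightarrow> 0 \<le> circle_sup n \<psi>"
  by (rule order.trans[OF norm_ge_zero circle_deriv_le_sup[of \<psi> n 0]])

section \<open>Fourier coefficients of smooth functions\<close>

text \<open>Integration by parts; the boundary terms cancel by periodicity.\<close>

lemma circle_coeff_deriv:
  assumes "\<psi> \<in> C_infinity_circle"
  shows "integral {0..2 * pi} (\<lambda>t. circle_deriv n \<psi> t * circle_char (- k) (cis t)) =
    (\<i> * of_int k) ^ n * of_real (2 * pi) * circle_coeff \<psi> k"
proof (induction n)
  case 0
  show ?case by (simp add: circle_deriv_0 circle_coeff_def)
next
  case (Suc n)
  have i: "(\<lambda>t. circle_deriv n \<psi> t * circle_char (- k) (cis t)) integrable_on {0..2 * pi}" for n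
    by (intro integrable_continuous_interval continuous_intros circle_deriv_continuous assms)
  have "((\<lambda>t. circle_deriv n \<psi> t * (\<i> * of_int (- k) * circle_char (- k) (cis t)) +
        circle_deriv (Suc n) \<psi> t * circle_char (- k) (cis t)) has_integral
      (circle_deriv n \<psi> (2 * pi) * circle_char (- k) (cis (2 * pi)) - circle_deriv n \<psi> 0 * circle_char (- k) (cis 0))) {0..2 * pi}"
    by (intro fundamental_theorem_of_calculus has_vector_derivative_mult circle_char_has_vector_derivative
        has_vector_derivative_at_within[OF circle_deriv_has_vector_derivative[OF assms]]) simp
  moreover have "circle_deriv n \<psi> (2 * pi) = circle_deriv n \<psi> 0"
    using circle_deriv_periodic[OF assms, of n 0] by simp
  ultimately have z: "((\<lambda>t. circle_deriv n \<psi> t * (\<i> * of_int (- k) * circle_char (- k) (cis t)) +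
        circle_deriv (Suc n) \<psi> t * circle_char (- k) (cis t)) has_integral 0) {0..2 * pi}" by simp
  have eq: "circle_deriv n \<psi> t * (\<i> * of_int (- k) * circle_char (- k) (cis t)) =
    (\<i> * of_int (- k)) * (circle_deriv n \<psi> t * circle_char (- k) (cis t))" for t by (simp only: mult_ac)
  have "((\<lambda>t. (\<i> * of_int (- k)) * (circle_deriv n \<psi> t * circle_char (- k) (cis t)) +
        circle_deriv (Suc n) \<psi> t * circle_char (- k) (cis t)) has_integral
      ((\<i> * of_int (- k)) * integral {0..2 * pi} (\<lambda>t. circle_deriv n \<psi> t * circle_char (- k) (cis t)) +
        integral {0..2 * pi} (\<lambda>t. circle_deriv (Suc n) \<psi> t * circle_char (- k) (cis t)))) {0..2 * pi}"
    by (intro has_integral_add has_integral_mult_right integrable_integral i)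
  from has_integral_unique[OF this z[unfolded eq]]
  show ?case unfolding Suc by (simp add: algebra_simps eq_neg_iff_add_eq_0)
qed

lemma norm_integral_circle_char_le:
  assumes "continuous_on {0..2 * pi} f" "\<And>t. t \<in> {0..2 * pi} \<Longrightarrow> cmod (f t) \<le> B"
  shows "cmod (integral {0..2 * pi} (\<lambda>t. f t * circle_char k (cis t))) \<le> B * (2 * pi)"
proof -
  have "cmod (integral {0..2 * pi} (\<lambda>t. f t * circle_char k (cis t))) \<le> integral {0..2 * pi} (\<lambda>t. B)"
    by (intro integral_norm_bound_integral integrable_continuous_interval continuous_intros assms(1))
      (use assms(2) in \<open>auto simp: norm_mult\<close>)
  then show ?thesis by (simp add: mult.commute)
qed

text \<open>Each derivative gains a power of \<open>|k|\<close>, not of \<open>1 + |k|\<close>. The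
  supremum of \<open>\<psi>\<close> itself makes up for small \<open>k\<close>, at the price of the
  factor \<open>2^n\<close>.\<close>

lemma circle_coeff_decay:
  assumes "\<psi> \<in> C_infinity_circle"
  shows "cmod (circle_coeff \<psi> k) * (1 + real_of_int \<bar>k\<bar>) ^ n \<le> 2 ^ n * (circle_sup 0 \<psi> + circle_sup n \<psi>)"
proof -
  define y where "y = real_of_int \<bar>k\<bar>"
  have y: "y \<ge> 0" by (simp add: y_def)
  have *: "y ^ n * cmod (circle_coeff \<psi> k) \<le> circle_sup n \<psi>" for n
  proof -
    have "y ^ n * cmod (circle_coeff \<psi> k) * (2 * pi) = cmod ((\<i> * of_int k) ^ n * of_real (2 * pi) * circle_coeff \<psi> k)"
      by (simp add: norm_mult norm_power y_def)
    also have "\<dots> = cmod (integral {0..2 * pi} (\<lambda>t. circle_deriv n \<psi> t * circle_char (- k) (cis t)))"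
      unfolding circle_coeff_deriv[OF assms] ..
    also have "\<dots> \<le> circle_sup n \<psi> * (2 * pi)"
      by (intro norm_integral_circle_char_le circle_deriv_continuous circle_deriv_le_sup assms)
    finally show ?thesis by simp
  qed
  have "(1 + y) ^ n \<le> 2 ^ n * (1 + y ^ n)"
  proof (cases "y \<le> 1")
    case True
    then have "(1 + y) ^ n \<le> 2 ^ n" using y by (intro power_mono) auto
    also have "\<dots> \<le> 2 ^ n * (1 + y ^ n)" using y by simp
    finally show ?thesis .
  next
    case False
    then have "(1 + y) ^ n \<le> (2 * y) ^ n" by (intro power_mono) auto
    also have "\<dots> \<le> 2 ^ n * (1 + y ^ n)" by (simp add: power_mult_distrib)
    finally show ?thesis .
  qed
  then have "cmod (circle_coeff \<psi> k) * (1 + y) ^ n \<le> cmod (circle_coeff \<psi> k) * (2 ^ n * (1 + y ^ n))"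
    by (intro mult_left_mono) auto
  also have "\<dots> = 2 ^ n * (y ^ 0 * cmod (circle_coeff \<psi> k) + y ^ n * cmod (circle_coeff \<psi> k))"
    by (simp add: algebra_simps)
  also have "\<dots> \<le> 2 ^ n * (circle_sup 0 \<psi> + circle_sup n \<psi>)"
    by (intro mult_left_mono add_mono *) auto
  finally show ?thesis unfolding y_def .
qed

lemma circle_coeff_rapid: "\<psi> \<in> C_infinity_circle \<Longrightarrow> rapid (circle_coeff \<psi>)"
  unfolding rapid_def using circle_coeff_decay by blast

lemma circle_coeff_eq_imp:
  assumes "continuous_on UNIV (\<lambda>t. \<psi> (cis t))" "continuous_on UNIV (\<lambda>t. \<eta> (cis t))"
    and "\<And>k. circle_coeff \<psi> k = circle_coeff \<eta> k"
  shows "\<psi> (cis t) = \<eta> (cis t)"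
proof -
  have c: "continuous_on S (\<lambda>t. \<psi> (cis t))" "continuous_on S (\<lambda>t. \<eta> (cis t))" for S
    using assms(1,2) continuous_on_subset by blast+
  have "circle_coeff (\<lambda>z. \<psi> z - \<eta> z) k = circle_coeff \<psi> k - circle_coeff \<eta> k" for k
    unfolding circle_coeff_def left_diff_distrib
    by (subst integral_diff) (auto intro!: integrable_continuous_interval continuous_intros c simp: diff_divide_distrib)
  then have "circle_coeff (\<lambda>z. \<psi> z - \<eta> z) k = 0" for k using assms(3) by simp
  from circle_coeff_eq_0_imp[OF continuous_on_diff[OF assms(1,2)] this] show ?thesis by simp
qed

text \<open>Both sides are continuous on the circle and have the same Fourier coefficients.\<close>

lemma smooth_eq_series:
  assumes "\<psi> \<in> C_infinity_circle"
  shows "\<psi> (cis t) = two_sided_series (circle_coeff \<psi>) (cis t)"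
proof -
  note a = rapid_imp_abs_summable2[OF circle_coeff_rapid[OF assms]]
  show ?thesis
    by (rule circle_coeff_eq_imp[OF C_infinity_circle_continuous[OF assms] continuous_on_two_sided_series[OF a]])
      (simp add: circle_coeff_two_sided_series[OF a])
qed

lemma circle_coeff_circle_char: "circle_coeff (circle_char j) k = (if j = k then 1 else 0)"
  using integral_unique[OF integral_circle_char[of "j - k"]]
  by (simp add: circle_coeff_def circle_char_mult)

section \<open>Distributions and their Fourier coefficients\<close>

lemma circle_distributionsD:
  assumes "f \<in> circle_distributions"
  shows "f \<in> extensional C_infinity_circle"
    and "\<psi> \<in> C_infinity_circle \<Longrightarrow> \<eta> \<in> C_infinity_circle \<Longrightarrow> f (\<lambda>z. \<psi> z + \<eta> z) = f \<psi> + f \<eta>"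
    and "\<psi> \<in> C_infinity_circle \<Longrightarrow> f (\<lambda>z. a * \<psi> z) = a * f \<psi>"
  using assms unfolding circle_distributions_def by auto

lemma circle_distributions_bound:
  assumes "f \<in> circle_distributions"
  obtains C N where "C \<ge> 0" "\<And>\<psi>. \<psi> \<in> C_infinity_circle \<Longrightarrow> cmod (f \<psi>) \<le> C * (\<Sum>j\<le>N. circle_sup j \<psi>)"
proof -
  obtain C N where C: "\<And>\<psi>. \<psi> \<in> C_infinity_circle \<Longrightarrow> cmod (f \<psi>) \<le> C * (\<Sum>j\<le>N. circle_sup j \<psi>)"
    using assms unfolding circle_distributions_def by blast
  have "cmod (f \<psi>) \<le> \<bar>C\<bar> * (\<Sum>j\<le>N. circle_sup j \<psi>)" if "\<psi> \<in> C_infinity_circle" for \<psi>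
    by (rule order.trans[OF C[OF that]])
      (intro mult_right_mono sum_nonneg circle_sup_nonneg that abs_ge_self)
  then show ?thesis using that[of "\<bar>C\<bar>" N] by simp
qed

text \<open>The continuity estimate is tested on characters, whose derivative of order
  \<open>j\<close> has modulus \<open>|k|^j\<close>.\<close>

lemma fourier_coeff_poly_bounded:
  assumes f: "f \<in> circle_distributions"
  shows "poly_bounded (fourier_coeff f)"
proof -
  obtain C N where C: "C \<ge> 0" "\<And>\<psi>. \<psi> \<in> C_infinity_circle \<Longrightarrow> cmod (f \<psi>) \<le> C * (\<Sum>j\<le>N. circle_sup j \<psi>)"
    by (rule circle_distributions_bound[OF f]) (rule that)
  have "cmod (fourier_coeff f k) \<le> (C * (real N + 1)) * (1 + real_of_int \<bar>k\<bar>) ^ N" for k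
  proof -
    have "circle_sup j (circle_char (- k)) \<le> (1 + real_of_int \<bar>k\<bar>) ^ N" if "j \<le> N" for j
    proof (rule cSUP_least)
      fix t :: real
      have "cmod (circle_deriv j (circle_char (- k)) t) = real_of_int \<bar>k\<bar> ^ j"
        by (simp add: circle_char_smooth norm_mult norm_power)
      also have "\<dots> \<le> (1 + real_of_int \<bar>k\<bar>) ^ j" by (intro power_mono) auto
      also have "\<dots> \<le> (1 + real_of_int \<bar>k\<bar>) ^ N" using that by (intro power_increasing) auto
      finally show "cmod (circle_deriv j (circle_char (- k)) t) \<le> (1 + real_of_int \<bar>k\<bar>) ^ N" .
    qed simp
    then have "(\<Sum>j\<le>N. circle_sup j (circle_char (- k))) \<le> (\<Sum>j\<le>N. (1 + real_of_int \<bar>k\<bar>) ^ N)"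
      by (intro sum_mono) auto
    then have "C * (\<Sum>j\<le>N. circle_sup j (circle_char (- k))) \<le> C * (\<Sum>j\<le>N. (1 + real_of_int \<bar>k\<bar>) ^ N)"
      by (rule mult_left_mono[OF _ C(1)])
    with C(2)[OF circle_char_smooth(1), of "- k"] show ?thesis
      unfolding fourier_coeff_def by (simp add: mult.assoc add.commute)
  qed
  then show ?thesis unfolding poly_bounded_def by blast
qed

lemma distribution_two_sided_term:
  assumes f: "f \<in> circle_distributions"
  shows "two_sided_term d k \<in> C_infinity_circle"
    "f (two_sided_term d k) = d (int k) * f (circle_char (int k)) + d (- int (Suc k)) * f (circle_char (- int (Suc k)))"
proof -
  note s = C_infinity_circle_cmult(1)[OF circle_char_smooth(1)]
  have e: "two_sided_term d k = (\<lambda>z. (\<lambda>z. d (int k) * circle_char (int k) z) z +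
      (\<lambda>z. d (- int (Suc k)) * circle_char (- int (Suc k)) z) z)"
    by (rule ext) (simp only: two_sided_term_def)
  show "two_sided_term d k \<in> C_infinity_circle" unfolding e by (rule C_infinity_circle_add(1)[OF s s])
  show "f (two_sided_term d k) = d (int k) * f (circle_char (int k)) + d (- int (Suc k)) * f (circle_char (- int (Suc k)))"
    unfolding e by (simp only: circle_distributionsD(2)[OF f s s] circle_distributionsD(3)[OF f circle_char_smooth(1)])
qed

lemma distribution_partial_series:
  assumes f: "f \<in> circle_distributions"
  shows "f (\<lambda>z. \<Sum>k<n. two_sided_term d k z) = (\<Sum>k<n. f (two_sided_term d k))"
proof (induction n)
  case 0
  have "f (\<lambda>z. 0 * circle_char 0 z) = 0 * f (circle_char 0)"
    by (rule circle_distributionsD(3)[OF f circle_char_smooth(1)])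
  then show ?case by simp
next
  case (Suc n)
  have "f (\<lambda>z. (\<Sum>k<n. two_sided_term d k z) + two_sided_term d n z) =
      f (\<lambda>z. \<Sum>k<n. two_sided_term d k z) + f (two_sided_term d n)"
    by (rule circle_distributionsD(2)[OF f partial_series_smooth(1) distribution_two_sided_term(1)[OF f]])
  then show ?case by (simp add: Suc)
qed

text \<open>The bound is the tail of a convergent series and does not depend on \<open>t\<close>, so
  it controls a supremum and tends to 0.\<close>

lemma two_sided_remainder:
  assumes "abs_summable2 d"
  shows "cmod (two_sided_series d (cis t) - (\<Sum>k<n. two_sided_term d k (cis t)))
    \<le> (\<Sum>k. cmod (d (int k)) + cmod (d (- int (Suc k)))) - (\<Sum>k<n. cmod (d (int k)) + cmod (d (- int (Suc k))))"
proof -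
  note s = assms[unfolded abs_summable2_def]
  have "two_sided_series d (cis t) - (\<Sum>k<n. two_sided_term d k (cis t)) = (\<Sum>k. two_sided_term d (k + n) (cis t))"
    unfolding two_sided_series_def
    by (rule suminf_minus_initial_segment[OF summable_two_sided_term[OF assms], symmetric])
  also have "cmod \<dots> \<le> (\<Sum>k. cmod (d (int (k + n))) + cmod (d (- int (Suc (k + n)))))"
    by (rule norm_suminf_le[OF norm_two_sided_term]) (rule summable_ignore_initial_segment[OF s])
  also have "\<dots> = (\<Sum>k. cmod (d (int k)) + cmod (d (- int (Suc k)))) - (\<Sum>k<n. cmod (d (int k)) + cmod (d (- int (Suc k))))"
    by (rule suminf_minus_initial_segment[OF s])
  finally show ?thesis .
qed

text \<open>Fourier series of test functions converge in the topology of \<open>C\<^sup>\<infinity>\<close>.\<close>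

lemma distribution_sums:
  assumes f: "f \<in> circle_distributions" and \<psi>: "\<psi> \<in> C_infinity_circle"
  shows "(\<lambda>k. circle_coeff \<psi> (int k) * f (circle_char (int k)) +
     circle_coeff \<psi> (- int (Suc k)) * f (circle_char (- int (Suc k)))) sums f \<psi>"
proof -
  define d where "d = circle_coeff \<psi>"
  have r: "rapid d" unfolding d_def by (rule circle_coeff_rapid[OF \<psi>])
  note as = rapid_imp_abs_summable2[OF rapid_diff_coeffs[OF r]]
  obtain C N where C: "C \<ge> 0" "\<And>\<psi>. \<psi> \<in> C_infinity_circle \<Longrightarrow> cmod (f \<psi>) \<le> C * (\<Sum>j\<le>N. circle_sup j \<psi>)"
    by (rule circle_distributions_bound[OF f]) (rule that)
  define M where "M j k = cmod (diff_coeffs j d (int k)) + cmod (diff_coeffs j d (- int (Suc k)))" for j k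
  have sM: "summable (M j)" for j using as[of j] unfolding abs_summable2_def M_def .
  define S where "S n = (\<lambda>z. \<Sum>k<n. two_sided_term d k z)" for n
  have S: "S n \<in> C_infinity_circle" for n unfolding S_def by (rule partial_series_smooth(1))
  have mS: "(\<lambda>z. (-1) * S n z) \<in> C_infinity_circle" for n by (rule C_infinity_circle_cmult(1)[OF S])
  \<comment> \<open>The difference is written with the scalar -1 because the definition of a
    distribution provides sums and scalar multiples.\<close>
  define R where "R n = (\<lambda>z. \<psi> z + (-1) * S n z)" for n
  have R: "R n \<in> C_infinity_circle" for n unfolding R_def by (rule C_infinity_circle_add(1)[OF \<psi> mS])
  have fR: "f (R n) = f \<psi> - f (S n)" for n
    unfolding R_def circle_distributionsD(2)[OF f \<psi> mS] circle_distributionsD(3)[OF f S] by simp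
  have dR: "circle_deriv j (R n) t = two_sided_series (diff_coeffs j d) (cis t) - (\<Sum>k<n. two_sided_term (diff_coeffs j d) k (cis t))" for j n t
    unfolding R_def C_infinity_circle_add(2)[OF \<psi> mS] C_infinity_circle_cmult(2)[OF S]
    by (simp add: S_def partial_series_smooth(2) rapid_series_smooth(2)[OF r smooth_eq_series[OF \<psi>, folded d_def]])
  have "cmod (f (R n)) \<le> C * (\<Sum>j\<le>N. suminf (M j) - (\<Sum>k<n. M j k))" for n
  proof (rule order.trans[OF C(2)[OF R]], intro mult_left_mono C(1) sum_mono cSUP_least)
    show "cmod (circle_deriv j (R n) t) \<le> suminf (M j) - (\<Sum>k<n. M j k)" for j t
      unfolding dR M_def by (rule two_sided_remainder[OF as])
  qed simp
  moreover have "(\<lambda>n. C * (\<Sum>j\<le>N. suminf (M j) - (\<Sum>k<n. M j k))) \<longlonglongrightarrow> C * (\<Sum>j\<le>N. suminf (M j) - suminf (M j))"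
    by (intro tendsto_intros summable_LIMSEQ sM)
  ultimately have "(\<lambda>n. f (R n)) \<longlonglongrightarrow> 0"
    by (intro Lim_null_comparison[of "\<lambda>n. f (R n)" "\<lambda>n. C * (\<Sum>j\<le>N. suminf (M j) - (\<Sum>k<n. M j k))"] always_eventually) simp_all
  then have "(\<lambda>n. f \<psi> - f (R n)) \<longlonglongrightarrow> f \<psi> - 0" by (intro tendsto_intros)
  then have "(\<lambda>n. f (S n)) \<longlonglongrightarrow> f \<psi>" by (simp add: fR)
  then show ?thesis
    unfolding sums_def S_def distribution_partial_series[OF f] distribution_two_sided_term(2)[OF f] d_def .
qed

text \<open>The series in \<open>distribution_sums\<close> involves the functional only through its
  values on characters. This is the uniqueness behind \<open>circle_conv\<close>.\<close>

lemma circle_distributions_eqI: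
  assumes f: "f \<in> circle_distributions" and g: "g \<in> circle_distributions"
    and eq: "\<And>k. fourier_coeff f k = fourier_coeff g k"
  shows "f = g"
proof (rule extensionalityI[OF circle_distributionsD(1)[OF f] circle_distributionsD(1)[OF g]])
  fix \<psi> assume \<psi>: "\<psi> \<in> C_infinity_circle"
  have "f (circle_char k) = g (circle_char k)" for k
    using eq[of "- k"] by (simp add: fourier_coeff_def)
  then show "f \<psi> = g \<psi>"
    using distribution_sums[OF f \<psi>] distribution_sums[OF g \<psi>] by (simp add: sums_iff)
qed

lemma two_sided_series_add:
  assumes "abs_summable2 c" "abs_summable2 d"
  shows "two_sided_series (\<lambda>k. c k + d k) (cis t) = two_sided_series c (cis t) + two_sided_series d (cis t)"
proof -
  have "two_sided_term (\<lambda>k. c k + d k) k z = two_sided_term c k z + two_sided_term d k z" for k z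
    by (simp add: two_sided_term_def algebra_simps)
  then show ?thesis unfolding two_sided_series_def
    by (simp add: suminf_add[OF summable_two_sided_term[OF assms(1)] summable_two_sided_term[OF assms(2)]])
qed

lemma two_sided_series_cmult:
  assumes "abs_summable2 d"
  shows "two_sided_series (\<lambda>k. a * d k) (cis t) = a * two_sided_series d (cis t)"
proof -
  have "two_sided_term (\<lambda>k. a * d k) k z = a * two_sided_term d k z" for k z
    by (simp add: two_sided_term_def algebra_simps)
  then show ?thesis unfolding two_sided_series_def
    by (simp add: suminf_mult[OF summable_two_sided_term[OF assms]])
qed

lemma circle_coeff_add:
  assumes "\<psi> \<in> C_infinity_circle" "\<eta> \<in> C_infinity_circle"
  shows "circle_coeff (\<lambda>z. \<psi> z + \<eta> z) k = circle_coeff \<psi> k + circle_coeff \<eta> k"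
proof -
  have "(\<lambda>t. \<psi> (cis t) * circle_char (- k) (cis t)) integrable_on {0..2 * pi}"
    if "\<psi> \<in> C_infinity_circle" for \<psi>
    by (rule integrable_continuous_interval[OF continuous_on_mult[OF C_infinity_circle_continuous[OF that]
          continuous_on_circle_char]])
  note i = this[OF assms(1)] this[OF assms(2)]
  show ?thesis
    unfolding circle_coeff_def distrib_right integral_add[OF i] add_divide_distrib ..
qed

lemma circle_coeff_cmult: "circle_coeff (\<lambda>z. a * \<psi> z) k = a * circle_coeff \<psi> k"
  unfolding circle_coeff_def mult.assoc by simp

text \<open>The functional pairs \<open>c k\<close> with the coefficient of the test function at
  \<open>- k\<close>. Growth of order \<open>N\<close> against \<open>N + 2\<close> powers of decay
  leaves the two powers that \<open>quadratic_decay\<close> needs, which is why seminorms up to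
  order \<open>N + 2\<close> occur.\<close>

lemma distribution_exists:
  assumes c: "poly_bounded c"
  obtains f where "f \<in> circle_distributions" "\<And>k. fourier_coeff f k = c k"
proof -
  define e where "e \<psi> k = c k * circle_coeff \<psi> (- k)" for \<psi> k
  \<comment> \<open>At the point 1 all characters equal 1, and the two-sided series becomes the
    plain sum of its coefficients.\<close>
  define f where "f = (\<lambda>\<psi>\<in>C_infinity_circle. two_sided_series (e \<psi>) (cis 0))"
  obtain C N where C: "\<And>k. cmod (c k) \<le> C * (1 + real_of_int \<bar>k\<bar>) ^ N"
    using c unfolding poly_bounded_def by blast
  have C0: "C \<ge> 0" using order.trans[OF norm_ge_zero C[of 0]] by simp
  have bd: "cmod (e \<psi> k) * (1 + real_of_int \<bar>k\<bar>)\<^sup>2 \<le> C * (2 ^ (N + 2) * (circle_sup 0 \<psi> + circle_sup (N + 2) \<psi>))"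
    if \<psi>: "\<psi> \<in> C_infinity_circle" for \<psi> k
  proof -
    have "cmod (e \<psi> k) * (1 + real_of_int \<bar>k\<bar>)\<^sup>2 \<le>
        (C * (1 + real_of_int \<bar>k\<bar>) ^ N) * cmod (circle_coeff \<psi> (- k)) * (1 + real_of_int \<bar>k\<bar>)\<^sup>2"
      unfolding e_def norm_mult by (intro mult_right_mono C) auto
    also have "\<dots> = C * (cmod (circle_coeff \<psi> (- k)) * (1 + real_of_int \<bar>- k\<bar>) ^ (N + 2))"
      by (simp only: power_add abs_minus_cancel mult_ac)
    also have "\<dots> \<le> C * (2 ^ (N + 2) * (circle_sup 0 \<psi> + circle_sup (N + 2) \<psi>))"
      by (intro mult_left_mono C0 circle_coeff_decay \<psi>)
    finally show ?thesis .
  qed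
  note as = quadratic_decay(1)[OF bd]
  have "f (\<lambda>z. \<psi> z + \<eta> z) = f \<psi> + f \<eta>" if \<psi>: "\<psi> \<in> C_infinity_circle" and \<eta>: "\<eta> \<in> C_infinity_circle" for \<psi> \<eta>
  proof -
    have "e (\<lambda>z. \<psi> z + \<eta> z) = (\<lambda>k. e \<psi> k + e \<eta> k)"
      by (rule ext) (simp add: e_def circle_coeff_add[OF \<psi> \<eta>] distrib_left)
    then show ?thesis using \<psi> \<eta> C_infinity_circle_add(1)[OF \<psi> \<eta>]
      by (simp add: f_def two_sided_series_add as del: cis_zero)
  qed
  moreover have "f (\<lambda>z. a * \<psi> z) = a * f \<psi>" if \<psi>: "\<psi> \<in> C_infinity_circle" for a \<psi>
  proof -
    have "e (\<lambda>z. a * \<psi> z) = (\<lambda>k. a * e \<psi> k)"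
      by (rule ext) (simp add: e_def circle_coeff_cmult)
    then show ?thesis using \<psi> C_infinity_circle_cmult(1)[OF \<psi>]
      by (simp add: f_def two_sided_series_cmult as del: cis_zero)
  qed
  moreover have "cmod (f \<psi>) \<le> (2 * (C * 2 ^ (N + 2)) * inverse_square_sum) * (\<Sum>j\<le>N + 2. circle_sup j \<psi>)"
    if \<psi>: "\<psi> \<in> C_infinity_circle" for \<psi>
  proof -
    have i0: "inverse_square_sum \<ge> 0" unfolding inverse_square_sum_def
      by (intro suminf_nonneg inverse_square_summable) simp
    have "circle_sup 0 \<psi> + circle_sup (N + 2) \<psi> = (\<Sum>j\<in>{0, N + 2}. circle_sup j \<psi>)" by simp
    also have "\<dots> \<le> (\<Sum>j\<le>N + 2. circle_sup j \<psi>)"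
      by (intro sum_mono2 circle_sup_nonneg \<psi>) auto
    finally have s: "circle_sup 0 \<psi> + circle_sup (N + 2) \<psi> \<le> (\<Sum>j\<le>N + 2. circle_sup j \<psi>)" .
    have "cmod (f \<psi>) \<le> 2 * (C * (2 ^ (N + 2) * (circle_sup 0 \<psi> + circle_sup (N + 2) \<psi>))) * inverse_square_sum"
      using quadratic_decay(2)[OF bd[OF \<psi>]] \<psi> by (simp add: f_def del: cis_zero)
    also have "\<dots> = (2 * (C * 2 ^ (N + 2)) * inverse_square_sum) * (circle_sup 0 \<psi> + circle_sup (N + 2) \<psi>)"
      by (simp only: mult_ac)
    also have "\<dots> \<le> (2 * (C * 2 ^ (N + 2)) * inverse_square_sum) * (\<Sum>j\<le>N + 2. circle_sup j \<psi>)"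
      using i0 C0 s by (intro mult_left_mono) auto
    finally show ?thesis .
  qed
  moreover have "f \<in> extensional C_infinity_circle" by (simp add: f_def)
  ultimately have fd: "f \<in> circle_distributions" unfolding circle_distributions_def by blast
  have "fourier_coeff f m = c m" for m
  proof -
    have e: "e (circle_char (- m)) = (\<lambda>k. if k = m then c m else 0)"
      by (rule ext) (simp add: e_def circle_coeff_circle_char)
    have "fourier_coeff f m = two_sided_series (\<lambda>k. if k = m then c m else 0) (cis 0)"
      by (simp add: fourier_coeff_def f_def circle_char_smooth(1) e del: cis_zero)
    also have "\<dots> = c m"
    proof (cases m rule: int_cases)
      case (nonneg i)
      have "(\<lambda>k. two_sided_term (\<lambda>k. if k = m then c m else 0) k (cis 0)) = (\<lambda>k. if k = i then c m else 0)"
        by (rule ext) (auto simp: two_sided_term_def nonneg circle_char_def)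
      then show ?thesis unfolding two_sided_series_def
        using sums_unique[OF sums_single[of i "\<lambda>_. c m"]] by simp
    next
      case (neg i)
      have "(\<lambda>k. two_sided_term (\<lambda>k. if k = m then c m else 0) k (cis 0)) = (\<lambda>k. if k = i then c m else 0)"
        by (rule ext) (auto simp: two_sided_term_def neg circle_char_def)
      then show ?thesis unfolding two_sided_series_def
        using sums_unique[OF sums_single[of i "\<lambda>_. c m"]] by simp
    qed
    finally show ?thesis .
  qed
  with fd show ?thesis by (rule that)
qed

lemma distribution_of_eq:
  assumes "\<psi> \<in> C_infinity_circle" "continuous_on {0..2 * pi} (\<lambda>t. h (cis t))"
  shows "distribution_of h \<psi> = integral {0..2 * pi} (\<lambda>t. h (cis t) * \<psi> (cis t)) / of_real (2 * pi)"
proof -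
  have "continuous_on {0..2 * pi} (\<lambda>t. h (cis t) * \<psi> (cis t))"
    by (intro continuous_intros assms C_infinity_circle_continuous)
  from set_borel_integral_eq_integral(2)[OF borel_integrable_atLeastAtMost'[OF this]]
  show ?thesis using assms(1) by (simp add: distribution_of_def)
qed

lemma fourier_coeff_distribution_of:
  "continuous_on {0..2 * pi} (\<lambda>t. h (cis t)) \<Longrightarrow> fourier_coeff (distribution_of h) k = circle_coeff h k"
  by (simp add: fourier_coeff_def distribution_of_eq circle_char_smooth(1) circle_coeff_def)

lemma distribution_of_smooth:
  assumes h: "h \<in> C_infinity_circle"
  shows "distribution_of h \<in> circle_distributions"
proof -
  note c = C_infinity_circle_continuous[OF h, of "{0..2 * pi}"]
  have i: "(\<lambda>t. h (cis t) * \<psi> (cis t)) integrable_on {0..2 * pi}" if "\<psi> \<in> C_infinity_circle" for \<psi>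
    by (intro integrable_continuous_interval continuous_intros c C_infinity_circle_continuous that)
  have "distribution_of h (\<lambda>z. \<psi> z + \<eta> z) = distribution_of h \<psi> + distribution_of h \<eta>"
    if "\<psi> \<in> C_infinity_circle" "\<eta> \<in> C_infinity_circle" for \<psi> \<eta>
    using that C_infinity_circle_add(1)[OF that]
    by (simp add: distribution_of_eq[OF _ c] distrib_left integral_add[OF i i] add_divide_distrib)
  moreover have "distribution_of h (\<lambda>z. a * \<psi> z) = a * distribution_of h \<psi>"
    if "\<psi> \<in> C_infinity_circle" for \<psi> a
    using that C_infinity_circle_cmult(1)[OF that, of a]
    by (simp add: distribution_of_eq[OF _ c] mult.left_commute)
  moreover have "cmod (distribution_of h \<psi>) \<le> circle_sup 0 h * (\<Sum>j\<le>0. circle_sup j \<psi>)"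
    if \<psi>: "\<psi> \<in> C_infinity_circle" for \<psi>
  proof -
    have "cmod (h (cis t) * \<psi> (cis t)) \<le> circle_sup 0 h * circle_sup 0 \<psi>" for t
      using circle_deriv_le_sup[OF h, of 0 t] circle_deriv_le_sup[OF \<psi>, of 0 t] circle_sup_nonneg[OF h, of 0]
      unfolding norm_mult circle_deriv_0 by (intro mult_mono) auto
    moreover have "continuous_on {0..2 * pi} (\<lambda>t. h (cis t) * \<psi> (cis t))"
      by (intro continuous_intros c C_infinity_circle_continuous \<psi>)
    \<comment> \<open>The character of index 0 is the constant 1, so the estimate for integrals
      against characters applies.\<close>
    ultimately have "cmod (integral {0..2 * pi} (\<lambda>t. h (cis t) * \<psi> (cis t))) \<le> circle_sup 0 h * circle_sup 0 \<psi> * (2 * pi)"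
      using norm_integral_circle_char_le[of "\<lambda>t. h (cis t) * \<psi> (cis t)" _ 0] by (simp add: circle_char_def)
    then show ?thesis unfolding distribution_of_eq[OF \<psi> c] norm_divide by (simp add: field_simps)
  qed
  moreover have "distribution_of h \<in> extensional C_infinity_circle" by (simp add: distribution_of_def)
  ultimately show ?thesis unfolding circle_distributions_def by blast
qed

section \<open>The Poisson integral\<close>

text \<open>The \<open>k\<close>-th term of an expansion at \<open>r e\<^sup>i\<^sup>t\<close> is \<open>c k * mode \<alpha> r k * e\<^sup>i\<^sup>k\<^sup>t\<close>.\<close>

definition mode :: "real \<Rightarrow> real \<Rightarrow> int \<Rightarrow> real" where
  "mode \<alpha> r k = (if k \<ge> 0 then r ^ nat k else radial \<alpha> (nat (- k) - 1) (r\<^sup>2) * r ^ nat (- k))"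

lemma mode_simps:
  "mode \<alpha> r (int k) = r ^ k"
  "mode \<alpha> r (- int (Suc k)) = radial \<alpha> k (r\<^sup>2) * r ^ Suc k"
  unfolding mode_def by (simp_all add: nat_add_distrib)

text \<open>Up to factors independent of \<open>k\<close> the mode is \<open>r^|k|\<close>. The
  upper factor serves the convergence and growth of the function, the lower one the recovery of its
  coefficients.\<close>

lemma mode_bounds:
  assumes r: "0 \<le> r" "r < 1"
  shows "(1 - r\<^sup>2) powr \<bar>\<alpha>\<bar> * r ^ nat \<bar>k\<bar> \<le> mode \<alpha> r k"
    and "mode \<alpha> r k \<le> (1 - r\<^sup>2) powr (- \<bar>\<alpha>\<bar>) * r ^ nat \<bar>k\<bar>"
proof -
  have r2: "0 \<le> r\<^sup>2" "r\<^sup>2 < 1" using r by (auto simp: abs_square_less_1)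
  have one: "(1 - r\<^sup>2) powr \<bar>\<alpha>\<bar> \<le> 1" using r2 by (intro powr_le1) auto
  have one': "1 \<le> (1 - r\<^sup>2) powr (- \<bar>\<alpha>\<bar>)" using one r2 by (simp add: powr_minus one_le_inverse_iff)
  have "(1 - r\<^sup>2) powr \<bar>\<alpha>\<bar> * r ^ nat \<bar>k\<bar> \<le> mode \<alpha> r k \<and> mode \<alpha> r k \<le> (1 - r\<^sup>2) powr (- \<bar>\<alpha>\<bar>) * r ^ nat \<bar>k\<bar>"
  proof (cases k rule: int_cases)
    case (nonneg n)
    have "(1 - r\<^sup>2) powr \<bar>\<alpha>\<bar> * r ^ n \<le> 1 * r ^ n" using r one by (intro mult_right_mono) auto
    moreover have "1 * r ^ n \<le> (1 - r\<^sup>2) powr (- \<bar>\<alpha>\<bar>) * r ^ n" using r one' by (intro mult_right_mono) auto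
    ultimately show ?thesis unfolding nonneg mode_simps by simp
  next
    case (neg n)
    have n: "nat \<bar>- int (Suc n)\<bar> = Suc n" by simp
    show ?thesis unfolding neg mode_simps n
      using r by (intro conjI mult_right_mono radial_bounds[OF r2]) auto
  qed
  then show "(1 - r\<^sup>2) powr \<bar>\<alpha>\<bar> * r ^ nat \<bar>k\<bar> \<le> mode \<alpha> r k" "mode \<alpha> r k \<le> (1 - r\<^sup>2) powr (- \<bar>\<alpha>\<bar>) * r ^ nat \<bar>k\<bar>"
    by simp_all
qed

lemma mode_nonneg: "0 \<le> r \<Longrightarrow> r < 1 \<Longrightarrow> 0 \<le> mode \<alpha> r k"
  by (rule order.trans[OF _ mode_bounds(1)]) auto

lemma rapid_mode:
  assumes c: "subexp c" and r: "0 \<le> r" "r < 1"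
  shows "rapid (\<lambda>k. c k * of_real (mode \<alpha> r k))"
  unfolding rapid_def
proof
  fix N
  have "poly_bounded (\<lambda>k. of_real ((1 + real_of_int \<bar>k\<bar>) ^ N))"
    unfolding poly_bounded_def by (intro exI[of _ 1] exI[of _ N] allI) (simp only: norm_of_real mult_1, simp)
  from subexp_mult[OF c poly_bounded_imp_subexp[OF this]]
  have s: "subexp (\<lambda>k. c k * of_real ((1 + real_of_int \<bar>k\<bar>) ^ N))" .
  \<comment> \<open>\<open>subexp\<close> speaks of positive radii only, while \<open>r\<close> may
    be 0.\<close>
  define q where "q = max r (1 / 2)"
  have q: "q \<in> {0<..<1}" "r \<le> q" using r by (auto simp: q_def)
  obtain C where C: "\<And>k. cmod (c k * of_real ((1 + real_of_int \<bar>k\<bar>) ^ N)) * q ^ nat \<bar>k\<bar> \<le> C"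
    using s q(1) unfolding subexp_def by blast
  define B where "B = (1 - r\<^sup>2) powr (- \<bar>\<alpha>\<bar>)"
  have "cmod (c k * of_real (mode \<alpha> r k)) * (1 + real_of_int \<bar>k\<bar>) ^ N \<le> B * C" for k
  proof -
    have "mode \<alpha> r k \<le> B * q ^ nat \<bar>k\<bar>"
      using r q by (intro order.trans[OF mode_bounds(2)[OF r]]) (auto simp: B_def intro!: mult_left_mono power_mono)
    then have "cmod (c k) * (1 + real_of_int \<bar>k\<bar>) ^ N * mode \<alpha> r k \<le>
        cmod (c k) * (1 + real_of_int \<bar>k\<bar>) ^ N * (B * q ^ nat \<bar>k\<bar>)" by (intro mult_left_mono) auto
    also have "\<dots> = B * (cmod (c k * of_real ((1 + real_of_int \<bar>k\<bar>) ^ N)) * q ^ nat \<bar>k\<bar>)"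
      unfolding norm_mult norm_of_real by simp
    also have "\<dots> \<le> B * C" by (intro mult_left_mono C) (simp add: B_def)
    finally show ?thesis using mode_nonneg[OF r, of \<alpha> k] by (simp add: norm_mult mult_ac)
  qed
  then show "\<exists>C. \<forall>k. cmod (c k * of_real (mode \<alpha> r k)) * (1 + real_of_int \<bar>k\<bar>) ^ N \<le> C" by blast
qed

lemma expansion_two_sided:
  assumes u: "has_alpha_expansion \<alpha> u c" and r: "0 \<le> r" "r < 1"
  shows "u (of_real r * cis t) = two_sided_series (\<lambda>k. c k * of_real (mode \<alpha> r k)) (cis t)"
proof -
  define z where "z = of_real r * cis t"
  have n: "cmod z = r" using r by (simp add: z_def norm_mult)
  have z: "z \<in> ball 0 1" using r n by simp
  obtain a b where a: "(\<lambda>k. c (int k) * z ^ k) sums a"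
    and b: "(\<lambda>k. c (- int (Suc k)) * of_real (radial \<alpha> k ((cmod z)\<^sup>2)) * cnj z ^ Suc k) sums b"
    and ab: "u z = a + b"
    using u[unfolded has_alpha_expansion_iff, THEN conjunct2, THEN bspec, OF z]
    by (elim exE conjE) (rule that)
  have zk: "z ^ k = of_real (r ^ k) * circle_char (int k) (cis t)" for k
    by (simp add: z_def power_mult_distrib circle_char_def)
  have zk': "cnj z ^ k = of_real (r ^ k) * circle_char (- int k) (cis t)" for k
    by (simp only: complex_cnj_power[symmetric] zk complex_cnj_mult complex_cnj_complex_of_real cnj_circle_char)
  have "two_sided_term (\<lambda>k. c k * of_real (mode \<alpha> r k)) k (cis t) =
     c (int k) * z ^ k + c (- int (Suc k)) * of_real (radial \<alpha> k ((cmod z)\<^sup>2)) * cnj z ^ Suc k" for k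
    unfolding two_sided_term_def mode_simps zk zk' n by (simp only: of_real_mult mult_ac)
  then have "(\<lambda>k. two_sided_term (\<lambda>k. c k * of_real (mode \<alpha> r k)) k (cis t)) sums (a + b)"
    using sums_add[OF a b] by simp
  then show ?thesis using ab unfolding two_sided_series_def z_def by (simp add: sums_unique)
qed

lemma expansion_circle:
  assumes u: "has_alpha_expansion \<alpha> u c" and r: "0 \<le> r" "r < 1"
  shows "continuous_on S (\<lambda>t. u (of_real r * cis t))"
    "circle_coeff (\<lambda>\<zeta>. u (of_real r * \<zeta>)) k = c k * of_real (mode \<alpha> r k)"
proof -
  have "subexp c" using u by (simp add: has_alpha_expansion_iff)
  note a = rapid_imp_abs_summable2[OF rapid_mode[OF this r]]
  note e = expansion_two_sided[OF u r]
  show "continuous_on S (\<lambda>t. u (of_real r * cis t))"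
    unfolding e by (rule continuous_on_two_sided_series[OF a])
  have "circle_coeff (\<lambda>\<zeta>. u (of_real r * \<zeta>)) k = circle_coeff (two_sided_series (\<lambda>k. c k * of_real (mode \<alpha> r k))) k"
    unfolding circle_coeff_def e ..
  then show "circle_coeff (\<lambda>\<zeta>. u (of_real r * \<zeta>)) k = c k * of_real (mode \<alpha> r k)"
    by (simp add: circle_coeff_two_sided_series[OF a])
qed

section \<open>Uniqueness and existence of expansions\<close>

text \<open>The coefficients are read off from the Fourier coefficients on a single circle, since
  the modes are positive there; the radius 1/2 is an arbitrary choice.\<close>

lemma has_alpha_expansion_unique:
  assumes "has_alpha_expansion \<alpha> u c" "has_alpha_expansion \<alpha> u d"
  shows "c = d"
proof
  fix k
  have r: "0 \<le> (1 / 2 :: real)" "(1 / 2 :: real) < 1" by simp_all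
  have "0 < (1 - (1 / 2)\<^sup>2) powr \<bar>\<alpha>\<bar> * (1 / 2 :: real) ^ nat \<bar>k\<bar>" by (simp add: power2_eq_square)
  then have "mode \<alpha> (1 / 2) k \<noteq> 0" using mode_bounds(1)[OF r, of \<alpha> k] by linarith
  then show "c k = d k"
    using expansion_circle(2)[OF assms(1) r, of k] expansion_circle(2)[OF assms(2) r, of k] by simp
qed

lemma alpha_coeff_eq: "has_alpha_expansion \<alpha> u c \<Longrightarrow> alpha_coeff \<alpha> u = c"
  unfolding alpha_coeff_def by (rule the_equality) (auto intro: has_alpha_expansion_unique)

lemma has_alpha_expansion_exists:
  assumes "subexp c"
  obtains U where "has_alpha_expansion \<alpha> U c"
proof -
  note s = subexp_series[OF assms]
  have "has_alpha_expansion \<alpha> (\<lambda>z. (\<Sum>k. c (int k) * z ^ k) +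
      anti_part \<alpha> (\<lambda>w. \<Sum>k. c (- int (Suc k)) * of_nat (Suc k) * w ^ k) z) c"
    unfolding has_alpha_expansion_iff
  proof (intro conjI ballI assms)
    fix z :: complex assume z: "z \<in> ball 0 1"
    from s(2)[OF z] anti_part_sums[OF s(4) z] show "\<exists>a b. (\<lambda>k. c (int k) * z ^ k) sums a \<and>
      (\<lambda>k. c (- int (Suc k)) * of_real (radial \<alpha> k ((cmod z)\<^sup>2)) * cnj z ^ Suc k) sums b \<and>
      (\<Sum>k. c (int k) * z ^ k) +
        anti_part \<alpha> (\<lambda>w. \<Sum>k. c (- int (Suc k)) * of_nat (Suc k) * w ^ k) z = a + b" by blast
  qed
  then show ?thesis by (rule that)
qed

lemma has_alpha_expansion_cong:
  assumes "has_alpha_expansion \<alpha> u c" "\<And>z. z \<in> ball 0 1 \<Longrightarrow> v z = u z"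
  shows "has_alpha_expansion \<alpha> v c"
  using assms(1) unfolding has_alpha_expansion_def by (simp add: assms(2) del: of_nat_Suc)

section \<open>Convolution with the kernel\<close>

lemma circle_conv_eq:
  assumes "h \<in> C_infinity_circle" "\<And>k. circle_coeff h k = fourier_coeff f k * fourier_coeff g k"
  shows "circle_conv f g = distribution_of h"
proof -
  have h: "fourier_coeff (distribution_of h) k = fourier_coeff f k * fourier_coeff g k" for k
    by (simp add: fourier_coeff_distribution_of[OF C_infinity_circle_continuous[OF assms(1)]] assms(2))
  show ?thesis unfolding circle_conv_def
  proof (rule the_equality)
    fix e assume "e \<in> circle_distributions \<and> (\<forall>k. fourier_coeff e k = fourier_coeff f k * fourier_coeff g k)"
    then show "e = distribution_of h"
      by (intro circle_distributions_eqI distribution_of_smooth assms) (simp_all add: h)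
  qed (simp add: h distribution_of_smooth assms)
qed

text \<open>Two smooth functions with the same distribution have the same Fourier coefficients,
  hence the same values on the circle.\<close>

lemma smooth_value_distribution_of:
  assumes h: "h \<in> C_infinity_circle"
  shows "smooth_value (distribution_of h) (cis t) = h (cis t)"
  unfolding smooth_value_def
proof (rule the_equality)
  fix w assume "\<exists>g\<in>C_infinity_circle. distribution_of g = distribution_of h \<and> g (cis t) = w"
  then obtain g where g: "g \<in> C_infinity_circle" "distribution_of g = distribution_of h" "g (cis t) = w"
    by blast
  have "circle_coeff g k = circle_coeff h k" for k
    using fourier_coeff_distribution_of[OF C_infinity_circle_continuous[OF g(1)], of k]
      fourier_coeff_distribution_of[OF C_infinity_circle_continuous[OF h], of k] g(2) by simp
  then have "g (cis t) = h (cis t)"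
    by (rule circle_coeff_eq_imp[OF C_infinity_circle_continuous[OF g(1)] C_infinity_circle_continuous[OF h]])
  then show "w = h (cis t)" using g(3) by simp
qed (use h in blast)

text \<open>Fourier coefficients multiply under convolution, and the modes come from the kernel
  alone. So on each circle the convolution has the Fourier coefficients of a function
  \<open>U\<close> with the expected expansion, and the Poisson integral agrees with
  \<open>U\<close>.\<close>

lemma poisson_integral_expansion:
  assumes f: "f \<in> circle_distributions"
  shows "has_alpha_expansion \<alpha> (poisson_integral \<alpha> f) (\<lambda>k. fourier_coeff f k * kernel_coeff \<alpha> k)"
proof -
  define c where "c k = fourier_coeff f k * kernel_coeff \<alpha> k" for k
  have "poly_bounded c" unfolding c_def[abs_def]
    by (intro poly_bounded_mult fourier_coeff_poly_bounded f kernel_coeff_poly_bounded)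
  then have c: "subexp c" by (rule poly_bounded_imp_subexp)
  obtain U where U: "has_alpha_expansion \<alpha> U c" by (rule has_alpha_expansion_exists[OF c])
  have "poisson_integral \<alpha> f z = U z" if z: "z \<in> ball 0 1" for z
  proof -
    define r where "r = cmod z"
    have r: "0 \<le> r" "r < 1" using z by (auto simp: r_def)
    define d where "d k = c k * of_real (mode \<alpha> r k)" for k
    have d: "rapid d" unfolding d_def[abs_def] by (rule rapid_mode[OF c r])
    have H: "two_sided_series d \<in> C_infinity_circle" by (rule rapid_series_smooth(1)[OF d refl])
    have "circle_conv (distribution_of (\<lambda>\<zeta>. poisson_kernel \<alpha> (of_real r * \<zeta>))) f = distribution_of (two_sided_series d)"
    proof (rule circle_conv_eq[OF H])
      fix k
      show "circle_coeff (two_sided_series d) k =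
          fourier_coeff (distribution_of (\<lambda>\<zeta>. poisson_kernel \<alpha> (of_real r * \<zeta>))) k * fourier_coeff f k"
        unfolding fourier_coeff_distribution_of[OF expansion_circle(1)[OF poisson_kernel_expansion r]]
          expansion_circle(2)[OF poisson_kernel_expansion r] circle_coeff_two_sided_series[OF rapid_imp_abs_summable2[OF d]]
        by (simp add: d_def c_def mult_ac)
    qed
    then have "poisson_integral \<alpha> f z = two_sided_series d (cis (Arg z))"
      unfolding poisson_integral_def r_def[symmetric] by (simp only: smooth_value_distribution_of[OF H])
    also have "\<dots> = U (of_real r * cis (Arg z))"
      unfolding expansion_two_sided[OF U r] d_def[abs_def] ..
    also have "of_real r * cis (Arg z) = z"
      using rcis_cmod_Arg[of z] by (simp add: r_def rcis_def)
    finally show ?thesis .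
  qed
  with U show ?thesis unfolding c_def[symmetric] by (rule has_alpha_expansion_cong)
qed

section \<open>Growth of a function and growth of its coefficients\<close>

text \<open>The power \<open>(1 + k)^N\<close> is at most \<open>(k + 1) ... (k + N)\<close>, which
  is \<open>fact N\<close> times a binomial coefficient with the generating function
  \<open>(1 - r)^(-N-1)\<close>.\<close>

lemma sum_power_bound:
  assumes r: "0 \<le> r" "r < (1::real)"
  shows "summable (\<lambda>k. (1 + real k) ^ N * r ^ k)"
    "(\<Sum>k. (1 + real k) ^ N * r ^ k) \<le> fact N * (1 - r) powr (- real (Suc N))"
proof -
  have le: "(1 + real k) ^ N \<le> fact N * (pochhammer (real N + 1) k / fact k)" for k
  proof (induction N)
    case 0
    show ?case by (simp add: pochhammer_fact[symmetric])
  next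
    case (Suc N)
    define p q where "p = pochhammer (real (Suc N) + 1) k" and "q = pochhammer (real N + 1) k"
    have "(real N + 1) * p = q * (real N + 1 + real k)"
      using pochhammer_rec[of "real N + 1" k] pochhammer_Suc[of "real N + 1" k]
      by (simp add: p_def q_def add_ac)
    then have "fact N * ((real N + 1) * p) / fact k = fact N * (q * (real N + 1 + real k)) / fact k" by simp
    then have "fact (Suc N) * (p / fact k) = fact N * (q / fact k) * (real N + 1 + real k)"
      by (simp add: fact_Suc mult_ac add.commute)
    then have "fact (Suc N) * (pochhammer (real (Suc N) + 1) k / fact k) =
        fact N * (pochhammer (real N + 1) k / fact k) * (real N + 1 + real k)"
      unfolding p_def q_def .
    moreover have "(1 + real k) ^ N * (1 + real k) \<le> fact N * (pochhammer (real N + 1) k / fact k) * (real N + 1 + real k)"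
      using order.trans[OF _ Suc] by (intro mult_mono Suc) auto
    ultimately show ?case by (simp only: power_Suc2)
  qed
  have s: "(\<lambda>k. fact N * (pochhammer (real N + 1) k / fact k * r ^ k)) sums (fact N * (1 - r) powr (- real (Suc N)))"
    using binomial_sums[of r "- real (Suc N)"] r by (intro sums_mult) (simp add: add.commute)
  have le': "(1 + real k) ^ N * r ^ k \<le> fact N * (pochhammer (real N + 1) k / fact k * r ^ k)" for k
    using mult_right_mono[OF le, of "r ^ k" k] r by (simp add: mult.assoc)
  show "summable (\<lambda>k. (1 + real k) ^ N * r ^ k)"
    by (rule summable_comparison_test'[OF sums_summable[OF s]]) (use le' r in auto)
  then show "(\<Sum>k. (1 + real k) ^ N * r ^ k) \<le> fact N * (1 - r) powr (- real (Suc N))"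
    unfolding sums_unique[OF s] by (rule suminf_le[OF le' _ sums_summable[OF s]])
qed

lemma poly_bounded_imp_temperate:
  assumes u: "has_alpha_expansion \<alpha> u c" and c: "poly_bounded c"
  shows "temperate_growth u"
proof -
  obtain C N where C: "\<And>k. cmod (c k) \<le> C * (1 + real_of_int \<bar>k\<bar>) ^ N"
    using c unfolding poly_bounded_def by blast
  have C0: "C \<ge> 0" using order.trans[OF norm_ge_zero C[of 0]] by simp
  \<comment> \<open>The summands 1 and \<open>2^N\<close> belong to the two indices of a pair, as
    \<open>k + 2 \<le> 2 (k + 1)\<close>; \<open>fact N\<close> comes from
    \<open>sum_power_bound\<close>, and \<open>2^(N+1)\<close> from
    \<open>1 - r \<ge> (1 - r^2) / 2\<close>.\<close>
  define K where "K = C * (1 + 2 ^ N) * fact N * 2 ^ Suc N"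
  have K0: "K \<ge> 0" using C0 by (simp add: K_def)
  define M where "M = \<bar>\<alpha>\<bar> + real (Suc N)"
  \<comment> \<open>\<open>temperate_growth\<close> asks for a positive constant, and
    \<open>K\<close> may be 0.\<close>
  have "cmod (u z) \<le> (K + 1) * (1 - (cmod z)\<^sup>2) powr (- M)" if z: "z \<in> ball 0 1" for z
  proof -
    define r where "r = cmod z"
    have r: "0 \<le> r" "r < 1" using z by (auto simp: r_def)
    define B where "B = (1 - r\<^sup>2) powr (- \<bar>\<alpha>\<bar>)"
    have B0: "B \<ge> 0" by (simp add: B_def)
    have r2: "r\<^sup>2 < 1" using r by (simp add: abs_square_less_1)
    define d where "d k = c k * of_real (mode \<alpha> r k)" for k
    have d: "cmod (d k) \<le> C * (1 + real_of_int \<bar>k\<bar>) ^ N * (B * r ^ nat \<bar>k\<bar>)" for k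
    proof -
      have "cmod (d k) = cmod (c k) * mode \<alpha> r k" using mode_nonneg[OF r] by (simp add: d_def norm_mult)
      also have "\<dots> \<le> C * (1 + real_of_int \<bar>k\<bar>) ^ N * (B * r ^ nat \<bar>k\<bar>)"
        unfolding B_def using C0 by (intro mult_mono C mode_bounds r mode_nonneg) auto
      finally show ?thesis .
    qed
    have t: "cmod (d (int k)) + cmod (d (- int (Suc k))) \<le> C * (1 + 2 ^ N) * B * ((1 + real k) ^ N * r ^ k)" for k
    proof -
      have "cmod (d (int k)) \<le> C * B * ((1 + real k) ^ N * r ^ k)" using d[of "int k"] by (simp add: mult_ac)
      moreover have "cmod (d (- int (Suc k))) \<le> C * B * (2 ^ N * ((1 + real k) ^ N * r ^ k))"
      proof -
        have "(1 + real (Suc k)) ^ N \<le> (2 * (1 + real k)) ^ N" by (intro power_mono) auto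
        then have "(1 + real (Suc k)) ^ N * r ^ Suc k \<le> (2 * (1 + real k)) ^ N * r ^ k"
          using r by (intro mult_mono power_decreasing) auto
        then have "C * B * ((1 + real (Suc k)) ^ N * r ^ Suc k) \<le> C * B * ((2 * (1 + real k)) ^ N * r ^ k)"
          using C0 B0 by (intro mult_left_mono) auto
        moreover have "real_of_int \<bar>- int (Suc k)\<bar> = real (Suc k)" "nat \<bar>- int (Suc k)\<bar> = Suc k" by simp_all
        ultimately show ?thesis
          using d[of "- int (Suc k)"] unfolding power_mult_distrib by (simp only: mult_ac)
      qed
      ultimately show ?thesis by (simp add: algebra_simps)
    qed
    have s: "summable (\<lambda>k. C * (1 + 2 ^ N) * B * ((1 + real k) ^ N * r ^ k))"
      by (intro summable_mult sum_power_bound r)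
    have "z = of_real r * cis (Arg z)"
      using rcis_cmod_Arg[of z] by (simp add: r_def rcis_def)
    then have "u z = two_sided_series d (cis (Arg z))"
      using expansion_two_sided[OF u r, of "Arg z"] by (simp add: d_def[abs_def])
    also have "cmod \<dots> \<le> (\<Sum>k. C * (1 + 2 ^ N) * B * ((1 + real k) ^ N * r ^ k))"
      unfolding two_sided_series_def
      by (rule norm_suminf_le[OF order.trans[OF norm_two_sided_term t] s])
    also have "\<dots> = C * (1 + 2 ^ N) * B * (\<Sum>k. (1 + real k) ^ N * r ^ k)"
      by (rule suminf_mult[OF sum_power_bound(1)[OF r]])
    also have "\<dots> \<le> C * (1 + 2 ^ N) * B * (fact N * (1 - r) powr (- real (Suc N)))"
      using C0 B0 by (intro mult_left_mono sum_power_bound r) auto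
    also have "\<dots> \<le> C * (1 + 2 ^ N) * B * (fact N * (2 ^ Suc N * (1 - r\<^sup>2) powr (- real (Suc N))))"
    proof -
      have "1 - r\<^sup>2 = (1 - r) * (1 + r)" by (simp add: power2_eq_square algebra_simps)
      also have "\<dots> \<le> (1 - r) * 2" using r by (intro mult_left_mono) auto
      finally have "(1 - r) powr (- real (Suc N)) \<le> ((1 - r\<^sup>2) / 2) powr (- real (Suc N))"
        using r r2 by (intro powr_mono2') auto
      also have "\<dots> = 2 ^ Suc N * (1 - r\<^sup>2) powr (- real (Suc N))"
        using r2 by (simp add: powr_divide powr_minus powr_realpow field_simps del: of_nat_Suc power_Suc)
      finally show ?thesis using C0 B0 by (intro mult_left_mono) auto
    qed
    also have "\<dots> = K * (B * (1 - r\<^sup>2) powr (- real (Suc N)))" by (simp only: K_def mult_ac)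
    also have "B * (1 - r\<^sup>2) powr (- real (Suc N)) = (1 - r\<^sup>2) powr (- M)"
      by (simp add: B_def M_def flip: powr_add)
    also have "K * (1 - r\<^sup>2) powr (- M) \<le> (K + 1) * (1 - r\<^sup>2) powr (- M)"
      by (intro mult_right_mono) auto
    finally show ?thesis unfolding r_def .
  qed
  moreover have "K + 1 > 0" "M > 0" using K0 by (simp_all add: M_def)
  ultimately show ?thesis unfolding temperate_growth_def by blast
qed

text \<open>The Fourier coefficients of \<open>u\<close> are estimated on the circle of radius \<open>1 - 1 / (|k| + 2)\<close>.\<close>

lemma temperate_imp_poly_bounded:
  assumes u: "has_alpha_expansion \<alpha> u c" and "temperate_growth u"
  shows "poly_bounded c"
proof -
  obtain C N where C: "C > 0" "N > 0" "\<And>z. z \<in> ball 0 1 \<Longrightarrow> cmod (u z) \<le> C * (1 - (cmod z)\<^sup>2) powr (-N)"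
    using assms(2) unfolding temperate_growth_def by blast
  obtain M :: nat where M: "N + \<bar>\<alpha>\<bar> \<le> real M" using real_arch_simple by blast
  have "cmod (c k) \<le> (C * exp 1 * 2 ^ M) * (1 + real_of_int \<bar>k\<bar>) ^ M" for k
  proof -
    define n where "n = nat \<bar>k\<bar>"
    \<comment> \<open>For this radius \<open>r^n\<close> stays above \<open>exp (-1)\<close>, while
      \<open>1 - r^2\<close> is at least \<open>1 / (n + 2)\<close>, so its negative powers are
      polynomially bounded in \<open>n\<close>.\<close>
    define r where "r = (real n + 1) / (real n + 2)"
    have r: "0 < r" "r < 1" by (auto simp: r_def)
    define y where "y = 1 - r\<^sup>2"
    have "1 - r = 1 / (real n + 2)" by (simp add: r_def field_simps)
    moreover have "(1 - r) * 1 \<le> (1 - r) * (1 + r)" using r by (intro mult_left_mono) auto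
    ultimately have y: "1 / (real n + 2) \<le> y" by (simp add: y_def power2_eq_square algebra_simps)
    have y0: "y > 0" by (rule less_le_trans[OF _ y]) simp
    have "y powr \<bar>\<alpha>\<bar> * r ^ n * cmod (c k) \<le> mode \<alpha> r k * cmod (c k)"
      unfolding y_def n_def using r by (intro mult_right_mono mode_bounds) auto
    also have "\<dots> = cmod (circle_coeff (\<lambda>\<zeta>. u (of_real r * \<zeta>)) k)"
      using r mode_nonneg[of r \<alpha> k] by (simp add: expansion_circle(2)[OF u] norm_mult)
    also have "\<dots> \<le> C * y powr (-N)"
    proof -
      have "cmod (u (of_real r * cis t)) \<le> C * y powr (-N)" for t
        using C(3)[of "of_real r * cis t"] r by (simp add: norm_mult y_def)
      then have "cmod (integral {0..2 * pi} (\<lambda>t. u (of_real r * cis t) * circle_char (- k) (cis t))) \<le> C * y powr (-N) * (2 * pi)"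
        using r by (intro norm_integral_circle_char_le expansion_circle(1)[OF u]) auto
      then show ?thesis by (simp add: circle_coeff_def norm_divide field_simps)
    qed
    finally have "y powr \<bar>\<alpha>\<bar> * r ^ n * cmod (c k) \<le> C * y powr (-N)" .
    then have "cmod (c k) \<le> C * y powr (-N) / (y powr \<bar>\<alpha>\<bar> * r ^ n)"
      using r y0 by (simp add: pos_le_divide_eq mult_ac)
    also have "\<dots> = C * y powr (- (N + \<bar>\<alpha>\<bar>)) * (1 / r) ^ n"
    proof -
      have "y powr (- (N + \<bar>\<alpha>\<bar>)) = y powr (-N) / y powr \<bar>\<alpha>\<bar>"
        by (simp add: powr_diff[symmetric])
      then show ?thesis by (simp add: power_divide)
    qed
    also have "\<dots> \<le> C * (2 ^ M * (1 + real n) ^ M) * exp 1"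
    proof (intro mult_mono mult_left_mono)
      have "y powr (- (N + \<bar>\<alpha>\<bar>)) \<le> (1 / (real n + 2)) powr (- (N + \<bar>\<alpha>\<bar>))"
        using C(2) y by (intro powr_mono2') auto
      also have "\<dots> = (real n + 2) powr (N + \<bar>\<alpha>\<bar>)"
      proof -
        have "1 / (real n + 2) = (real n + 2) powr (- 1)" by (simp add: powr_minus inverse_eq_divide)
        then show ?thesis by (simp only: powr_powr) (simp add: add.commute)
      qed
      also have "\<dots> \<le> (real n + 2) powr (real M)" using M by (intro powr_mono) auto
      also have "\<dots> = (real n + 2) ^ M" by (simp add: powr_realpow)
      also have "\<dots> \<le> (2 * (1 + real n)) ^ M" by (intro power_mono) auto
      finally show "y powr (- (N + \<bar>\<alpha>\<bar>)) \<le> 2 ^ M * (1 + real n) ^ M" unfolding power_mult_distrib .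
      have "1 / r = 1 + 1 / (real n + 1)" by (simp add: r_def field_simps)
      then have "(1 / r) ^ n \<le> exp (1 / (real n + 1)) ^ n"
        using r exp_ge_add_one_self[of "1 / (real n + 1)"] by (intro power_mono) auto
      also have "\<dots> = exp (real n * (1 / (real n + 1)))" by (rule exp_of_nat_mult[symmetric])
      also have "\<dots> \<le> exp 1" by (simp add: field_simps)
      finally show "(1 / r) ^ n \<le> exp 1" .
    qed (use C r in auto)
    finally show ?thesis by (simp add: n_def mult_ac)
  qed
  then show ?thesis unfolding poly_bounded_def by blast
qed

theorem theorem3p3:
  fixes \<alpha> :: real and u :: "complex \<Rightarrow> complex"
  shows "(\<exists>f\<in>circle_distributions. \<forall>z\<in>ball 0 1. u z = poisson_integral \<alpha> f z) \<longleftrightarrow>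
         alpha_harmonic \<alpha> u \<and> temperate_growth u \<and> Spec \<alpha> u \<subseteq> Spec \<alpha> (poisson_kernel \<alpha>)"
proof
  assume "\<exists>f\<in>circle_distributions. \<forall>z\<in>ball 0 1. u z = poisson_integral \<alpha> f z"
  then obtain f where f: "f \<in> circle_distributions"
    and u: "\<And>z. z \<in> ball 0 1 \<Longrightarrow> u z = poisson_integral \<alpha> f z" by blast
  have e: "has_alpha_expansion \<alpha> u (\<lambda>k. fourier_coeff f k * kernel_coeff \<alpha> k)"
    by (rule has_alpha_expansion_cong[OF poisson_integral_expansion[OF f] u])
  have "poly_bounded (\<lambda>k. fourier_coeff f k * kernel_coeff \<alpha> k)"
    by (intro poly_bounded_mult fourier_coeff_poly_bounded f kernel_coeff_poly_bounded)
  then have "temperate_growth u" by (rule poly_bounded_imp_temperate[OF e])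
  moreover have "alpha_harmonic \<alpha> u" unfolding alpha_harmonic_iff_expansion by (intro exI) (rule e)
  moreover have "Spec \<alpha> u \<subseteq> Spec \<alpha> (poisson_kernel \<alpha>)"
    unfolding Spec_def alpha_coeff_eq[OF e] alpha_coeff_eq[OF poisson_kernel_expansion] by auto
  ultimately show "alpha_harmonic \<alpha> u \<and> temperate_growth u \<and> Spec \<alpha> u \<subseteq> Spec \<alpha> (poisson_kernel \<alpha>)" by simp
next
  assume a: "alpha_harmonic \<alpha> u \<and> temperate_growth u \<and> Spec \<alpha> u \<subseteq> Spec \<alpha> (poisson_kernel \<alpha>)"
  then obtain c where c: "has_alpha_expansion \<alpha> u c" unfolding alpha_harmonic_iff_expansion by blast
  have sp: "kernel_coeff \<alpha> k \<noteq> 0" if "c k \<noteq> 0" for k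
    using a that unfolding Spec_def alpha_coeff_eq[OF c] alpha_coeff_eq[OF poisson_kernel_expansion] by auto
  have "poly_bounded (\<lambda>k. c k * inverse (kernel_coeff \<alpha> k))"
    using a by (intro poly_bounded_mult temperate_imp_poly_bounded[OF c] kernel_coeff_inverse_poly_bounded) simp
  then obtain f where f: "f \<in> circle_distributions"
    and fc: "\<And>k. fourier_coeff f k = c k * inverse (kernel_coeff \<alpha> k)"
    by (rule distribution_exists) (rule that)
  \<comment> \<open>Where the kernel coefficient vanishes, so does \<open>c k\<close> by the
    inclusion of the spectra, and both sides are 0.\<close>
  have "fourier_coeff f k * kernel_coeff \<alpha> k = c k" for k
    using sp[of k] by (cases "c k = 0") (simp_all add: fc)
  then have e: "has_alpha_expansion \<alpha> (poisson_integral \<alpha> f) c"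
    using poisson_integral_expansion[OF f, of \<alpha>] by simp
  have "u z = poisson_integral \<alpha> f z" if z: "z \<in> ball 0 1" for z
  proof -
    have "z = of_real (cmod z) * cis (Arg z)" using rcis_cmod_Arg[of z] by (simp add: rcis_def)
    moreover have "cmod z < 1" using z by simp
    ultimately show ?thesis
      using expansion_two_sided[OF c, of "cmod z" "Arg z"] expansion_two_sided[OF e, of "cmod z" "Arg z"] by simp
  qed
  with f show "\<exists>f\<in>circle_distributions. \<forall>z\<in>ball 0 1. u z = poisson_integral \<alpha> f z" by blast
qed


end
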